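(* Let $\mathcal{D}_{red}=\mathcal{D}(\Gamma,(L_i)_{1\le i\le\theta},(K_i)_{1\le i\le\theta},(\chi_i)_{1\le i\le\theta},(a_{ij}))$ be a generic, regular reduced YD-datum of Cartan type with linking parameter $\ell$, and let $\mathbf{U}=\mathcal{U}(\mathcal{D}_{red},\ell)$. Let $M$ be an integrable $\mathbf{U}$-module in $\mathcal{C}^{hi}$. Then $M$ is completely reducible, and $M$ is a direct sum of modules (each isomorphic to one) of the form $L(\chi)$ with $\chi\in\widehat{\Gamma}^+$.
   Context: $\Bbbk$ is an algebraically closed field of characteristic zero, $\mathbb{N}=\{0,1,\dots\}$, $\widehat{\Gamma}=\mathrm{Hom}(\Gamma,\Bbbk^\times)$. Yetter-Drinfeld modules and Nichols algebras. A Yetter-Drinfeld module over $\Bbbk\Gamma$ ($\Gamma$ abelian) is a $\Gamma$-graded vector space $V=\bigoplus_g V_g$ with a $\Gamma$-action stabilizing each $V_g$; $V_g^\chi=\{v\in V_g\mid hv=\chi(h)v\ \forall h\in\Gamma\}$; the braiding is $c(v\otimes w)=g\cdot w\otimes v$ for $v\in V_g$. $T(V)$ is a Hopf algebra in the braided category of Yetter-Drinfeld modules with the elements of $V$ primitive; $I(V)$ is the largest $\mathbb{N}$-graded ideal and coideal $I\subset T(V)$ with $I\cap V=0$. $T(V)\#\Bbbk\Gamma$ is the bosonization: $gv=(g\cdot v)g$, $\Delta(v)=g\otimes v+v\otimes1$ for $v\in V_g$, and elements of $\Gamma$ are group-like. Reduced data. A reduced YD-datum consists of an abelian group $\Gamma$,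 an integer $\theta\ge1$, $K_i,L_i\in\Gamma$, $\chi_i\in\widehat\Gamma$ ($1\le i\le\theta$) with $\chi_j(K_i)=\chi_i(L_j)$ for all $i,j$ and $K_iL_i\ne1$ for all $i$. Put $q_{ij}=\chi_j(K_i)$. It is generic if no $q_{ii}$ is a root of unity; regular if $\chi_1,\dots,\chi_\theta$ are $\mathbb{Z}$-linearly independent in $\widehat\Gamma$; (when generic) of Cartan type if $(a_{ij})$ is a generalized Cartan matrix with $q_{ij}q_{ji}=q_{ii}^{a_{ij}}$ for all $i,j$. A linking parameter is a family $\ell=(\ell_i)$ of non-zero elements of $\Bbbk$. $\mathbf{U}=\mathcal{U}(\mathcal{D}_{red},\ell)$ is the quotient Hopf algebra of $T(V\oplus W)\#\Bbbk\Gamma$, where $V$ has basis $v_i\in V_{K_i}^{\chi_i}$ and $W$ has basis $w_i\in W_{L_i}^{\chi_i^{-1}}$, by the ideal generated by $I(V)$, $I(W)$ and $v_iw_j-\chi_j^{-1}(K_i)w_jv_i-\delta_{ij}\ell_i(K_iL_i-1)$. Put $E_i=v_i$, $F_i=w_iL_i^{-1}$; $\mathbf{U}^+$ is the subalgebra generated by the $E_i$, $\mathbb{N}^\theta$-graded with $\deg E_i=\alpha_i$ (the standard basis); $|\sum n_i\alpha_i|=\sum n_i$. Modules. $M^\chi=\{m\in M\mid gm=\chi(g)m\ \forall g\in\Gamma\}$. $\mathcal{C}$ is the category of left $\mathbf{U}$-modules $M$ with $M=\bigoplus_{\chi\in\widehat\Gamma}M^\chi$; $\mathcal{C}^{hi}\subset\mathcal{C}$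 is the full subcategory of those $M$ such that for every $m\in M$ there is $N\ge0$ with $\mathbf{U}^+_\alpha m=0$ for all $\alpha\in\mathbb{N}^\theta$ with $|\alpha|\ge N$. $M$ is integrable if $M\in\mathcal{C}$ and for all $m\in M$ and $i$ there is $n\ge1$ with $E_i^nm=F_i^nm=0$. $\chi\in\widehat\Gamma$ is dominant if there are integers $m_i\ge0$ with $\chi(K_iL_i)=q_{ii}^{m_i}$ for all $i$; $\widehat\Gamma^+$ is the set of dominant characters. For $\chi\in\widehat\Gamma^+$, $L(\chi)=\mathbf{U}/\big(\sum_i\mathbf{U}E_i+\sum_i\mathbf{U}F_i^{m_i+1}+\sum_{g\in\Gamma}\mathbf{U}(g-\chi(g))\big)$. *)

theory Defs
  imports
    "HOL-Library.Poly_Mapping"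
    "HOL-Library.Product_Plus"
    "HOL-Computational_Algebra.Polynomial"
    "HOL-Algebra.QuotRing"
    "HOL-Algebra.Module"
    "HOL-Algebra.Free_Abelian_Groups"
begin

text \<open>
  The abelian group \<open>\<Gamma>\<close> is a type \<^typ>\<open>'g::ab_group_add\<close>, written additively, so that the
  product \<open>K\<^sub>i L\<^sub>i\<close> of the paper reads \<open>K i + L i\<close> and \<open>1 \<in> \<Gamma>\<close> reads \<open>0\<close>.
  The index set \<open>{1,\<dots>,\<theta>}\<close> (\<open>\<theta> \<ge> 1\<close>) is a type \<^typ>\<open>'i::finite\<close>.
\<close>


section \<open>Vector spaces with a basis, twisted monoid algebras\<close>

text \<open>A vector space with basis \<^typ>\<open>'a\<close> is \<^typ>\<open>'a \<Rightarrow>\<^sub>0 'k\<close>.\<close>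

definition scl :: "'k::comm_ring_1 \<Rightarrow> ('a \<Rightarrow>\<^sub>0 'k) \<Rightarrow> ('a \<Rightarrow>\<^sub>0 'k)" where
  "scl a p = Poly_Mapping.map ((*) a) p"

lemma lookup_scl [simp]: "Poly_Mapping.lookup (scl a p) x = a * Poly_Mapping.lookup p x"
  by (simp add: scl_def Poly_Mapping.map.rep_eq Poly_Mapping.when_def)

interpretation pm: vector_space "scl :: 'k::field \<Rightarrow> ('a \<Rightarrow>\<^sub>0 'k) \<Rightarrow> ('a \<Rightarrow>\<^sub>0 'k)"
  by unfold_locales (auto intro!: poly_mapping_eqI simp: lookup_add algebra_simps)

text \<open>The linear map sending the basis vector \<open>x\<close> to the basis vector \<open>f x\<close>.\<close>

definition push :: "('a \<Rightarrow> 'b) \<Rightarrow> ('a \<Rightarrow>\<^sub>0 'k::comm_ring_1) \<Rightarrow> ('b \<Rightarrow>\<^sub>0 'k)" where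
  "push f p = (\<Sum>x\<in>Poly_Mapping.keys p. Poly_Mapping.single (f x) (Poly_Mapping.lookup p x))"

text \<open>The product on the monoid algebra with \<open>a \<cdot> b = s a b (a + b)\<close> for basis vectors \<open>a\<close>, \<open>b\<close>.\<close>

definition tw_mult ::
  "('a::monoid_add \<Rightarrow> 'a \<Rightarrow> 'k::comm_ring_1) \<Rightarrow> ('a \<Rightarrow>\<^sub>0 'k) \<Rightarrow> ('a \<Rightarrow>\<^sub>0 'k) \<Rightarrow> ('a \<Rightarrow>\<^sub>0 'k)" where
  "tw_mult s x y =
     (\<Sum>a\<in>Poly_Mapping.keys x. \<Sum>b\<in>Poly_Mapping.keys y.
        Poly_Mapping.single (a + b) (s a b * Poly_Mapping.lookup x a * Poly_Mapping.lookup y b))"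

lemma tw_mult_superset:
  assumes "finite A" "Poly_Mapping.keys x \<subseteq> A" "finite B" "Poly_Mapping.keys y \<subseteq> B"
  shows "tw_mult s x y = (\<Sum>a\<in>A. \<Sum>b\<in>B.
    Poly_Mapping.single (a + b) (s a b * Poly_Mapping.lookup x a * Poly_Mapping.lookup y b))"
proof -
  have "(\<Sum>a\<in>A. \<Sum>b\<in>B.
      Poly_Mapping.single (a + b) (s a b * Poly_Mapping.lookup x a * Poly_Mapping.lookup y b))
    = (\<Sum>a\<in>Poly_Mapping.keys x. \<Sum>b\<in>B.
      Poly_Mapping.single (a + b) (s a b * Poly_Mapping.lookup x a * Poly_Mapping.lookup y b))"
    using assms by (intro sum.mono_neutral_right) (auto simp: in_keys_iff)
  also have "\<dots> = tw_mult s x y"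
    unfolding tw_mult_def using assms
    by (intro sum.cong sum.mono_neutral_right) (auto simp: in_keys_iff)
  finally show ?thesis by simp
qed

lemma tw_mult_add_left: "tw_mult s (x + x') y = tw_mult s x y + tw_mult s x' y"
proof -
  let ?A = "Poly_Mapping.keys x \<union> Poly_Mapping.keys x'"
  have "Poly_Mapping.keys (x + x') \<subseteq> ?A" by (rule Poly_Mapping.keys_add)
  then show ?thesis
    by (simp add: tw_mult_superset[of ?A _ "Poly_Mapping.keys y"] lookup_add single_add
        algebra_simps sum.distrib)
qed

lemma tw_mult_add_right: "tw_mult s x (y + y') = tw_mult s x y + tw_mult s x y'"
proof -
  let ?B = "Poly_Mapping.keys y \<union> Poly_Mapping.keys y'"
  have "Poly_Mapping.keys (y + y') \<subseteq> ?B" by (rule Poly_Mapping.keys_add)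
  then show ?thesis
    by (simp add: tw_mult_superset[of "Poly_Mapping.keys x" _ ?B] lookup_add single_add
        algebra_simps sum.distrib)
qed

lemma tw_mult_zero [simp]: "tw_mult s 0 y = 0" "tw_mult s x 0 = 0"
  by (simp_all add: tw_mult_def)

lemma tw_mult_single:
  "tw_mult s (Poly_Mapping.single a \<kappa>) (Poly_Mapping.single b \<mu>)
     = Poly_Mapping.single (a + b) (s a b * \<kappa> * \<mu>)"
  by (simp add: tw_mult_superset[of "{a}" _ "{b}"])

lemma pm_induct [case_names zero single add]:
  fixes x :: "'a \<Rightarrow>\<^sub>0 'k::comm_ring_1"
  assumes "P 0" and "\<And>a \<kappa>. P (Poly_Mapping.single a \<kappa>)"
    and "\<And>x y. P x \<Longrightarrow> P y \<Longrightarrow> P (x + y)"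
  shows "P x"
proof (induction x rule: Poly_Mapping.update_induct)
  case (update f a b)
  have "Poly_Mapping.update a b f = f + Poly_Mapping.single a b"
    using update(1) by (intro poly_mapping_eqI)
      (auto simp: lookup_update lookup_add lookup_single Poly_Mapping.when_def in_keys_iff)
  then show ?case using assms update by simp
qed (fact assms)

lemma tw_mult_assoc:
  assumes "\<And>a b c. s (a + b) c * s a b = s a (b + c) * s b c"
  shows "tw_mult s (tw_mult s x y) z = tw_mult s x (tw_mult s y z)"
proof (induction x rule: pm_induct)
  case (single a \<kappa>)
  show ?case
  proof (induction y rule: pm_induct)
    case (single b \<mu>)
    show ?case
    proof (induction z rule: pm_induct)
      case (single c \<nu>)
      have "s (a + b) c * (s a b * \<kappa> * \<mu>) * \<nu> = s a (b + c) * \<kappa> * (s b c * \<mu> * \<nu>)"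
        using assms[of a b c] by (metis (no_types, lifting) mult.assoc mult.commute)
      then show ?case by (simp add: tw_mult_single add.assoc)
    qed (simp_all add: tw_mult_add_right)
  qed (simp_all add: tw_mult_add_left tw_mult_add_right)
qed (simp_all add: tw_mult_add_left)

lemma tw_mult_one:
  assumes "\<And>a. s 0 a = 1" "\<And>a. s a 0 = 1"
  shows "tw_mult s (Poly_Mapping.single 0 1) x = x" "tw_mult s x (Poly_Mapping.single 0 1) = x"
  by (induction x rule: pm_induct)
     (simp_all add: tw_mult_add_left tw_mult_add_right tw_mult_single assms del: single_one)

text \<open>
  The free monoid on \<^typ>\<open>'x\<close>. With it \<^typ>\<open>'x list \<Rightarrow>\<^sub>0 'k\<close> is, with the ring structure of
  \<^theory>\<open>HOL-Library.Poly_Mapping\<close>, the free algebra on \<^typ>\<open>'x\<close>, i.e. the tensor algebra of the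
  vector space with basis \<^typ>\<open>'x\<close>.
\<close>

instantiation list :: (type) monoid_add
begin
definition zero_list_def: "0 = []"
definition plus_list_def: "xs + ys = xs @ ys"
instance by standard (auto simp: zero_list_def plus_list_def)
end


section \<open>Nichols algebras of Yetter-Drinfeld modules of diagonal type\<close>

definition character :: "('g::ab_group_add \<Rightarrow> 'k::field) \<Rightarrow> bool" where
  "character c \<longleftrightarrow> c 0 = 1 \<and> (\<forall>g h. c (g + h) = c g * c h)"

text \<open>
  In the following, \<open>V\<close> is the Yetter-Drinfeld module with basis \<open>(x)\<close> indexed by \<^typ>\<open>'x\<close>, where the
  basis vector \<open>x\<close> lies in \<open>V\<^sub>g\<^sup>c\<close> with \<open>g = d x\<close> and \<open>c = c x\<close>. The word \<open>u\<close>, as a basis vector of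
  \<open>T(V)\<close>, has degree \<open>wdeg d u\<close> and \<open>\<Gamma>\<close> acts on it by \<open>wchar c u\<close>.
\<close>

definition wdeg :: "('x \<Rightarrow> 'g::ab_group_add) \<Rightarrow> 'x list \<Rightarrow> 'g" where
  "wdeg d u = sum_list (map d u)"

definition wchar :: "('x \<Rightarrow> 'g::ab_group_add \<Rightarrow> 'k::field) \<Rightarrow> 'x list \<Rightarrow> 'g \<Rightarrow> 'k" where
  "wchar c u g = prod_list (map (\<lambda>x. c x g) u)"

text \<open>
  The algebra \<open>T(V) \<otimes> T(V)\<close> in the braided category, with basis the pairs of words:
  \<open>(a \<otimes> b)(a' \<otimes> b') = a (b\<^sub>(\<^sub>-\<^sub>1\<^sub>) \<cdot> a') \<otimes> b\<^sub>(\<^sub>0\<^sub>) b'\<close>.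
\<close>

definition braid_mult :: "('x \<Rightarrow> 'g::ab_group_add) \<Rightarrow> ('x \<Rightarrow> 'g \<Rightarrow> 'k::field) \<Rightarrow>
    ('x list \<times> 'x list \<Rightarrow>\<^sub>0 'k) \<Rightarrow> ('x list \<times> 'x list \<Rightarrow>\<^sub>0 'k) \<Rightarrow> ('x list \<times> 'x list \<Rightarrow>\<^sub>0 'k)" where
  "braid_mult d c = tw_mult (\<lambda>(a, b) (a', b'). wchar c a' (wdeg d b))"

text \<open>The coproduct of \<open>T(V)\<close>: the algebra map into \<open>T(V) \<otimes> T(V)\<close> with \<open>x \<mapsto> x \<otimes> 1 + 1 \<otimes> x\<close>.\<close>

primrec word_coprod :: "('x \<Rightarrow> 'g::ab_group_add) \<Rightarrow> ('x \<Rightarrow> 'g \<Rightarrow> 'k::field) \<Rightarrow>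
    'x list \<Rightarrow> ('x list \<times> 'x list \<Rightarrow>\<^sub>0 'k)" where
  "word_coprod d c [] = Poly_Mapping.single ([], []) 1"
| "word_coprod d c (x # u) =
     braid_mult d c (Poly_Mapping.single ([x], []) 1 + Poly_Mapping.single ([], [x]) 1)
       (word_coprod d c u)"

definition coprod :: "('x \<Rightarrow> 'g::ab_group_add) \<Rightarrow> ('x \<Rightarrow> 'g \<Rightarrow> 'k::field) \<Rightarrow>
    ('x list \<Rightarrow>\<^sub>0 'k) \<Rightarrow> ('x list \<times> 'x list \<Rightarrow>\<^sub>0 'k)" where
  "coprod d c t = (\<Sum>u\<in>Poly_Mapping.keys t. scl (Poly_Mapping.lookup t u) (word_coprod d c u))"

definition pure_tensor ::
  "('a \<Rightarrow>\<^sub>0 'k::comm_ring_1) \<Rightarrow> ('b \<Rightarrow>\<^sub>0 'k) \<Rightarrow> ('a \<times> 'b \<Rightarrow>\<^sub>0 'k)" where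
  "pure_tensor s t =
     (\<Sum>a\<in>Poly_Mapping.keys s. \<Sum>b\<in>Poly_Mapping.keys t.
        Poly_Mapping.single (a, b) (Poly_Mapping.lookup s a * Poly_Mapping.lookup t b))"

definition hom_part :: "nat \<Rightarrow> ('x list \<Rightarrow>\<^sub>0 'k::comm_ring_1) \<Rightarrow> ('x list \<Rightarrow>\<^sub>0 'k)" where
  "hom_part n t = Poly_Mapping.mapp (\<lambda>u a. if length u = n then a else 0) t"

definition graded_ideal :: "('x list \<Rightarrow>\<^sub>0 'k::field) set \<Rightarrow> bool" where
  "graded_ideal I \<longleftrightarrow> pm.subspace I \<and> (\<forall>t\<in>I. \<forall>s. s * t \<in> I \<and> t * s \<in> I)
     \<and> (\<forall>t\<in>I. \<forall>n. hom_part n t \<in> I)"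

text \<open>\<open>\<Delta>(I) \<subseteq> I \<otimes> T(V) + T(V) \<otimes> I\<close> and \<open>\<epsilon>(I) = 0\<close>.\<close>

definition coideal :: "('x \<Rightarrow> 'g::ab_group_add) \<Rightarrow> ('x \<Rightarrow> 'g \<Rightarrow> 'k::field) \<Rightarrow>
    ('x list \<Rightarrow>\<^sub>0 'k) set \<Rightarrow> bool" where
  "coideal d c I \<longleftrightarrow> pm.subspace I
     \<and> (\<forall>t\<in>I. coprod d c t \<in> pm.span {pure_tensor s s' | s s'. s \<in> I \<or> s' \<in> I})
     \<and> (\<forall>t\<in>I. Poly_Mapping.lookup t [] = 0)"

lemma lookup_hom_part:
  "Poly_Mapping.lookup (hom_part n t) u = (if length u = n then Poly_Mapping.lookup t u else 0)"
  by (simp add: hom_part_def lookup_mapp Poly_Mapping.when_def in_keys_iff)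

lemma hom_part_add: "hom_part n (s + t) = hom_part n s + hom_part n t"
  by (intro poly_mapping_eqI) (simp add: lookup_hom_part lookup_add)

lemma hom_part_1_eq:
  assumes "\<forall>u\<in>Poly_Mapping.keys t. length u = 1"
  shows "hom_part 1 t = t"
  using assms by (intro poly_mapping_eqI) (auto simp: lookup_hom_part in_keys_iff)

lemma hom_part_keys: "u \<in> Poly_Mapping.keys (hom_part n t) \<Longrightarrow> length u = n"
  by (auto simp: lookup_hom_part in_keys_iff split: if_splits)

lemma coprod_superset:
  assumes "finite A" "Poly_Mapping.keys t \<subseteq> A"
  shows "coprod d c t = (\<Sum>u\<in>A. scl (Poly_Mapping.lookup t u) (word_coprod d c u))"
  unfolding coprod_def using assms by (intro sum.mono_neutral_left) (auto simp: in_keys_iff)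

lemma coprod_add: "coprod d c (s + t) = coprod d c s + coprod d c t"
proof -
  let ?A = "Poly_Mapping.keys s \<union> Poly_Mapping.keys t"
  have "Poly_Mapping.keys (s + t) \<subseteq> ?A" by (rule Poly_Mapping.keys_add)
  then show ?thesis
    by (simp add: coprod_superset[of ?A] lookup_add pm.scale_left_distrib sum.distrib)
qed

definition nichols_cond :: "('x \<Rightarrow> 'g::ab_group_add) \<Rightarrow> ('x \<Rightarrow> 'g \<Rightarrow> 'k::field) \<Rightarrow>
    ('x list \<Rightarrow>\<^sub>0 'k) set \<Rightarrow> bool" where
  "nichols_cond d c I \<longleftrightarrow> graded_ideal I \<and> coideal d c I
     \<and> I \<inter> {t. \<forall>u\<in>Poly_Mapping.keys t. length u = 1} = {0}"

text \<open>
  \<open>I(V)\<close> is the largest graded ideal and coideal that intersects \<open>V\<close> trivially; it is obtained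
  as the union of all of them, see \<open>nichols_ideal_largest\<close> below.
\<close>

definition nichols_ideal :: "('x \<Rightarrow> 'g::ab_group_add) \<Rightarrow> ('x \<Rightarrow> 'g \<Rightarrow> 'k::field) \<Rightarrow>
    ('x list \<Rightarrow>\<^sub>0 'k) set" where
  "nichols_ideal d c = \<Union>{I. nichols_cond d c I}"

lemma nichols_cond_zero: "nichols_cond d c {0}"
  by (auto simp: nichols_cond_def graded_ideal_def coideal_def pm.subspace_def hom_part_def
      coprod_def pm.span_zero intro!: poly_mapping_eqI simp: lookup_mapp)

lemma nichols_cond_sum:
  assumes I: "nichols_cond d c I" and J: "nichols_cond d c J"
  shows "nichols_cond d c {s + t | s t. s \<in> I \<and> t \<in> J}" (is "nichols_cond d c ?K")
  unfolding nichols_cond_def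
proof (intro conjI)
  have gI: "graded_ideal I" "coideal d c I" and gJ: "graded_ideal J" "coideal d c J"
    using I J by (auto simp: nichols_cond_def)
  have sI: "pm.subspace I" and sJ: "pm.subspace J" using gI gJ by (auto simp: graded_ideal_def)
  have 0: "0 \<in> I" "0 \<in> J" using sI sJ by (auto simp: pm.subspace_def)
  have sK: "pm.subspace ?K" by (rule pm.subspace_sums[OF sI sJ])
  have sub: "I \<subseteq> ?K" "J \<subseteq> ?K" using 0 by force+
  show "graded_ideal ?K"
    unfolding graded_ideal_def
  proof (intro conjI ballI allI sK)
    fix x s n assume "x \<in> ?K"
    then obtain a b where x: "x = a + b" "a \<in> I" "b \<in> J" by blast
    have K: "p + r \<in> ?K" if "p \<in> I" "r \<in> J" for p r using that by blast
    have id: "s * y \<in> I" "y * s \<in> I" "hom_part n y \<in> I" if "y \<in> I" for y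
      using gI(1) that unfolding graded_ideal_def by blast+
    have jd: "s * y \<in> J" "y * s \<in> J" "hom_part n y \<in> J" if "y \<in> J" for y
      using gJ(1) that unfolding graded_ideal_def by blast+
    show "s * x \<in> ?K" "x * s \<in> ?K" "hom_part n x \<in> ?K"
      unfolding x(1) distrib_left distrib_right hom_part_add
      by (rule K; rule id jd; rule x)+
  qed
  show "coideal d c ?K"
    unfolding coideal_def
  proof (intro conjI ballI sK)
    fix x assume "x \<in> ?K"
    then obtain a b where x: "x = a + b" "a \<in> I" "b \<in> J" by blast
    let ?S = "\<lambda>I. {pure_tensor s s' | s s'. s \<in> I \<or> s' \<in> I}"
    have S: "pm.span (?S P) \<subseteq> pm.span (?S Q)" if "P \<subseteq> Q" for P Q
      by (rule pm.span_mono) (use that in blast)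
    have "coprod d c a \<in> pm.span (?S I)" "coprod d c b \<in> pm.span (?S J)"
      using x gI(2) gJ(2) by (simp_all add: coideal_def)
    then have "coprod d c a \<in> pm.span (?S ?K)" "coprod d c b \<in> pm.span (?S ?K)"
      using S[OF sub(1)] S[OF sub(2)] by (simp_all only: subset_iff)
    then show "coprod d c x \<in> pm.span (?S ?K)"
      unfolding coprod_add x(1) by (rule pm.span_add)
    show "Poly_Mapping.lookup x [] = 0"
      using x gI(2) gJ(2) by (simp add: coideal_def lookup_add)
  qed
  have "x = 0" if "x \<in> ?K" "\<forall>u\<in>Poly_Mapping.keys x. length u = 1" for x
  proof -
    from that(1) obtain a b where x: "x = a + b" "a \<in> I" "b \<in> J" by blast
    let ?T = "{t. \<forall>u\<in>Poly_Mapping.keys t. length u = 1}"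
    have T: "hom_part 1 y \<in> ?T" for y :: "'a list \<Rightarrow>\<^sub>0 'c"
      by (rule CollectI, rule ballI, erule hom_part_keys)
    have "hom_part 1 a \<in> I" using gI(1) x(2) unfolding graded_ideal_def by blast
    then have "hom_part 1 a \<in> I \<inter> ?T" using T by (rule IntI)
    moreover have "hom_part 1 b \<in> J" using gJ(1) x(3) unfolding graded_ideal_def by blast
    then have "hom_part 1 b \<in> J \<inter> ?T" using T by (rule IntI)
    moreover have "I \<inter> ?T = {0}" "J \<inter> ?T = {0}" using I J by (simp_all add: nichols_cond_def)
    ultimately have "hom_part 1 a = 0" "hom_part 1 b = 0" by (simp_all only: singleton_iff)
    then show ?thesis using hom_part_1_eq[OF that(2)] by (simp add: x hom_part_add)
  qed
  then show "?K \<inter> {t. \<forall>u\<in>Poly_Mapping.keys t. length u = 1} = {0}"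
    using pm.subspace_0[OF sK] by (intro equalityI subsetI) (blast, simp)
qed

lemma nichols_ideal_largest:
  "nichols_cond d c (nichols_ideal d c)"
  "nichols_cond d c I \<Longrightarrow> I \<subseteq> nichols_ideal d c"
proof -
  let ?N = "nichols_ideal d c"
  show sub: "I \<subseteq> ?N" if "nichols_cond d c I" for I using that by (auto simp: nichols_ideal_def)
  have mem: "\<exists>I. nichols_cond d c I \<and> x \<in> I" if "x \<in> ?N" for x
    using that by (auto simp: nichols_ideal_def)
  have z: "0 \<in> ?N" using sub[OF nichols_cond_zero] by blast
  have add: "x + y \<in> ?N" if "x \<in> ?N" "y \<in> ?N" for x y
  proof -
    from mem[OF that(1)] obtain I where I: "nichols_cond d c I" "x \<in> I" by blast
    from mem[OF that(2)] obtain J where J: "nichols_cond d c J" "y \<in> J" by blast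
    from I J show ?thesis using sub[OF nichols_cond_sum[of d c I J]] by blast
  qed
  have scale: "scl a x \<in> ?N" if "x \<in> ?N" for a x
  proof -
    from mem[OF that] obtain I where I: "nichols_cond d c I" "x \<in> I" by blast
    then have "scl a x \<in> I"
      unfolding nichols_cond_def graded_ideal_def using pm.subspace_scale by blast
    then show ?thesis using sub[OF I(1)] by blast
  qed
  have sN: "pm.subspace ?N" using z add scale by (simp add: pm.subspace_def)
  show "nichols_cond d c ?N"
    unfolding nichols_cond_def graded_ideal_def coideal_def
  proof (intro conjI ballI allI sN)
    fix x s n assume "x \<in> ?N"
    then obtain I where I: "nichols_cond d c I" "x \<in> I" using mem by blast
    then have "s * x \<in> I \<and> x * s \<in> I" "hom_part n x \<in> I"
      unfolding nichols_cond_def graded_ideal_def by blast+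
    then show "s * x \<in> ?N" "x * s \<in> ?N" "hom_part n x \<in> ?N" using sub[OF I(1)] by auto
    show "Poly_Mapping.lookup x [] = 0" using I by (simp add: nichols_cond_def coideal_def)
    let ?S = "\<lambda>I. {pure_tensor s s' | s s'. s \<in> I \<or> s' \<in> I}"
    have "pm.span (?S I) \<subseteq> pm.span (?S ?N)"
      by (rule pm.span_mono) (use sub[OF I(1)] in blast)
    moreover have "coprod d c x \<in> pm.span (?S I)"
      using I by (simp add: nichols_cond_def coideal_def)
    ultimately show "coprod d c x \<in> pm.span (?S ?N)" by (rule subsetD)
  next
    show "?N \<inter> {t. \<forall>u\<in>Poly_Mapping.keys t. length u = 1} = {0}"
      using z mem by (fastforce simp: nichols_cond_def)
  qed
qed


section \<open>Reduced data\<close>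

record ('g, 'i, 'k) yd_datum =
  elL :: "'i \<Rightarrow> 'g"
  elK :: "'i \<Rightarrow> 'g"
  chr :: "'i \<Rightarrow> 'g \<Rightarrow> 'k"
  cartan :: "'i \<Rightarrow> 'i \<Rightarrow> int"

definition q :: "('g::ab_group_add, 'i::finite, 'k::field) yd_datum \<Rightarrow> 'i \<Rightarrow> 'i \<Rightarrow> 'k" where
  "q D i j = chr D j (elK D i)"

definition reduced_datum :: "('g::ab_group_add, 'i::finite, 'k::field) yd_datum \<Rightarrow> bool" where
  "reduced_datum D \<longleftrightarrow> (\<forall>i. character (chr D i))
     \<and> (\<forall>i j. chr D j (elK D i) = chr D i (elL D j))
     \<and> (\<forall>i. elK D i + elL D i \<noteq> 0)"

definition generic :: "('g::ab_group_add, 'i::finite, 'k::field) yd_datum \<Rightarrow> bool" where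
  "generic D \<longleftrightarrow> (\<forall>i. \<forall>n\<ge>1. q D i i ^ n \<noteq> 1)"

definition regular :: "('g::ab_group_add, 'i::finite, 'k::field) yd_datum \<Rightarrow> bool" where
  "regular D \<longleftrightarrow>
     (\<forall>n :: 'i \<Rightarrow> int. (\<forall>g. (\<Prod>i\<in>UNIV. chr D i g powi n i) = 1) \<longrightarrow> (\<forall>i. n i = 0))"

definition generalized_cartan_matrix :: "('i \<Rightarrow> 'i \<Rightarrow> int) \<Rightarrow> bool" where
  "generalized_cartan_matrix a \<longleftrightarrow> (\<forall>i. a i i = 2) \<and> (\<forall>i j. i \<noteq> j \<longrightarrow> a i j \<le> 0)
     \<and> (\<forall>i j. a i j = 0 \<longrightarrow> a j i = 0)"

definition cartan_type :: "('g::ab_group_add, 'i::finite, 'k::field) yd_datum \<Rightarrow> bool" where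
  "cartan_type D \<longleftrightarrow> generalized_cartan_matrix (cartan D)
     \<and> (\<forall>i j. q D i j * q D j i = q D i i powi cartan D i j)"

definition linking_parameter :: "('i \<Rightarrow> 'k::field) \<Rightarrow> bool" where
  "linking_parameter l \<longleftrightarrow> (\<forall>i. l i \<noteq> 0)"


section \<open>The algebra \<open>U\<close>\<close>

text \<open>
  \<open>V \<oplus> W\<close> has basis \<^typ>\<open>'i + 'i\<close>, with \<open>v\<^sub>i\<close> being \<open>Inl i\<close> and \<open>w\<^sub>i\<close> being \<open>Inr i\<close>. The bosonization
  \<open>T(V \<oplus> W) # k\<Gamma>\<close> has as basis the pairs \<open>(u, g)\<close>, standing for \<open>u g\<close>, and \<open>g u = (g \<cdot> u) g\<close>.
  Modules depend on the algebra structure only, so the coalgebra structure is not recorded.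
\<close>

type_synonym ('g, 'i, 'k) smash = "('i + 'i) list \<times> 'g \<Rightarrow>\<^sub>0 'k"

definition chr_VW :: "('g::ab_group_add, 'i::finite, 'k::field) yd_datum \<Rightarrow> 'i + 'i \<Rightarrow> 'g \<Rightarrow> 'k" where
  "chr_VW D = case_sum (chr D) (\<lambda>i g. inverse (chr D i g))"

definition smash_alg :: "('g::ab_group_add, 'i::finite, 'k::field) yd_datum \<Rightarrow>
    ('g, 'i, 'k) smash ring" where
  "smash_alg D = \<lparr>carrier = UNIV,
     mult = tw_mult (\<lambda>(u, g) (u', g'). wchar (chr_VW D) u' g),
     one = Poly_Mapping.single ([], 0) 1, ring.zero = 0, add = (+)\<rparr>"

lemma ring_smash_alg:
  fixes D :: "('g::ab_group_add, 'i::finite, 'k::field) yd_datum"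
  assumes "\<And>i. character (chr D i)"
  shows "ring (smash_alg D)"
proof -
  let ?s = "\<lambda>(u, g) (u', g'). wchar (chr_VW D) u' g"
  have chr: "chr_VW D x 0 = 1" "chr_VW D x (g + h) = chr_VW D x g * chr_VW D x h" for x g h
    using assms by (auto simp: chr_VW_def character_def split: sum.splits)
  have w: "wchar (chr_VW D) u 0 = 1" "wchar (chr_VW D) [] g = 1"
    "wchar (chr_VW D) (u @ u') g = wchar (chr_VW D) u g * wchar (chr_VW D) u' g"
    "wchar (chr_VW D) u (g + h) = wchar (chr_VW D) u g * wchar (chr_VW D) u h" for u u' g h
    by (induction u) (simp_all add: wchar_def chr algebra_simps)
  have assoc: "tw_mult ?s (tw_mult ?s x y) z = tw_mult ?s x (tw_mult ?s y z)" for x y z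
    by (rule tw_mult_assoc) (auto simp: w plus_list_def)
  have one: "tw_mult ?s (Poly_Mapping.single ([], 0) 1) x = x"
    "tw_mult ?s x (Poly_Mapping.single ([], 0) 1) = x" for x
    using tw_mult_one[of ?s x] by (simp_all add: w zero_prod_def zero_list_def split: prod.splits)
  show ?thesis
  proof (intro ringI abelian_groupI monoidI)
    fix x :: "('g, 'i, 'k) smash"
    show "\<exists>y\<in>carrier (smash_alg D). y \<oplus>\<^bsub>smash_alg D\<^esub> x = \<zero>\<^bsub>smash_alg D\<^esub>"
      by (rule bexI[of _ "- x"]) (simp_all add: smash_alg_def)
  qed (simp_all add: smash_alg_def assoc one tw_mult_add_left tw_mult_add_right ac_simps)
qed

definition vgen :: "'i \<Rightarrow> ('g::ab_group_add, 'i, 'k::field) smash" where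
  "vgen i = Poly_Mapping.single ([Inl i], 0) 1"

definition wgen :: "'i \<Rightarrow> ('g::ab_group_add, 'i, 'k::field) smash" where
  "wgen i = Poly_Mapping.single ([Inr i], 0) 1"

definition grp :: "'g::ab_group_add \<Rightarrow> ('g, 'i, 'k::field) smash" where
  "grp g = Poly_Mapping.single ([], g) 1"

definition incl_V :: "('i list \<Rightarrow>\<^sub>0 'k::field) \<Rightarrow> ('g::ab_group_add, 'i, 'k) smash" where
  "incl_V = push (\<lambda>u. (map Inl u, 0))"

definition incl_W :: "('i list \<Rightarrow>\<^sub>0 'k::field) \<Rightarrow> ('g::ab_group_add, 'i, 'k) smash" where
  "incl_W = push (\<lambda>u. (map Inr u, 0))"

definition linking_rel :: "('g::ab_group_add, 'i::finite, 'k::field) yd_datum \<Rightarrow> ('i \<Rightarrow> 'k) \<Rightarrow>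
    'i \<Rightarrow> 'i \<Rightarrow> ('g, 'i, 'k) smash" where
  "linking_rel D l i j =
     vgen i \<otimes>\<^bsub>smash_alg D\<^esub> wgen j
     - scl (inverse (chr D j (elK D i))) (wgen j \<otimes>\<^bsub>smash_alg D\<^esub> vgen i)
     - (if i = j then scl (l i) (grp (elK D i + elL D i) - grp 0) else 0)"

definition U_ideal :: "('g::ab_group_add, 'i::finite, 'k::field) yd_datum \<Rightarrow> ('i \<Rightarrow> 'k) \<Rightarrow>
    ('g, 'i, 'k) smash set" where
  "U_ideal D l = Idl\<^bsub>smash_alg D\<^esub>
     (incl_V ` nichols_ideal (elK D) (chr D)
      \<union> incl_W ` nichols_ideal (elL D) (\<lambda>i g. inverse (chr D i g))
      \<union> {linking_rel D l i j | i j. True})"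

definition U_alg :: "('g::ab_group_add, 'i::finite, 'k::field) yd_datum \<Rightarrow> ('i \<Rightarrow> 'k) \<Rightarrow>
    ('g, 'i, 'k) smash set ring" where
  "U_alg D l = smash_alg D Quot U_ideal D l"

lemma ring_U_alg:
  assumes "reduced_datum D"
  shows "ideal (U_ideal D l) (smash_alg D)" "ring (U_alg D l)"
proof -
  have "ring (smash_alg D)" using assms by (intro ring_smash_alg) (simp add: reduced_datum_def)
  then show "ideal (U_ideal D l) (smash_alg D)"
    unfolding U_ideal_def by (rule ring.genideal_ideal) (simp add: smash_alg_def)
  then show "ring (U_alg D l)" unfolding U_alg_def by (rule ideal.quotient_is_ring)
qed

definition U_class :: "('g::ab_group_add, 'i::finite, 'k::field) yd_datum \<Rightarrow> ('i \<Rightarrow> 'k) \<Rightarrow>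
    ('g, 'i, 'k) smash \<Rightarrow> ('g, 'i, 'k) smash set" where
  "U_class D l x = U_ideal D l +>\<^bsub>smash_alg D\<^esub> x"

definition U_scalar :: "('g::ab_group_add, 'i::finite, 'k::field) yd_datum \<Rightarrow> ('i \<Rightarrow> 'k) \<Rightarrow>
    'k \<Rightarrow> ('g, 'i, 'k) smash set" where
  "U_scalar D l a = U_class D l (scl a (grp 0))"

definition U_grp :: "('g::ab_group_add, 'i::finite, 'k::field) yd_datum \<Rightarrow> ('i \<Rightarrow> 'k) \<Rightarrow>
    'g \<Rightarrow> ('g, 'i, 'k) smash set" where
  "U_grp D l g = U_class D l (grp g)"

definition U_E :: "('g::ab_group_add, 'i::finite, 'k::field) yd_datum \<Rightarrow> ('i \<Rightarrow> 'k) \<Rightarrow>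
    'i \<Rightarrow> ('g, 'i, 'k) smash set" where
  "U_E D l i = U_class D l (vgen i)"

definition U_F :: "('g::ab_group_add, 'i::finite, 'k::field) yd_datum \<Rightarrow> ('i \<Rightarrow> 'k) \<Rightarrow>
    'i \<Rightarrow> ('g, 'i, 'k) smash set" where
  "U_F D l i = U_class D l (wgen i \<otimes>\<^bsub>smash_alg D\<^esub> grp (- elL D i))"

text \<open>
  The component of degree \<open>\<alpha>\<close> of the subalgebra \<open>U\<^sup>+\<close> generated by the \<open>E\<^sub>i\<close>: the image of the
  component of degree \<open>\<alpha>\<close> of \<open>T(V)\<close>, i.e. the span of the monomials in which each \<open>E\<^sub>i\<close> occurs
  \<open>\<alpha> i\<close> times.
\<close>

definition U_plus_comp :: "('g::ab_group_add, 'i::finite, 'k::field) yd_datum \<Rightarrow> ('i \<Rightarrow> 'k) \<Rightarrow>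
    ('i \<Rightarrow> nat) \<Rightarrow> ('g, 'i, 'k) smash set set" where
  "U_plus_comp D l \<alpha> =
     {U_class D l (incl_V t) | t. \<forall>u\<in>Poly_Mapping.keys t. \<forall>i. count_list u i = \<alpha> i}"


section \<open>Left modules over a not necessarily commutative ring\<close>

text \<open>
  Modules are elements of the library's record type, whose fields \<^const>\<open>monoid.mult\<close> and
  \<^const>\<open>monoid.one\<close> are irrelevant. The locale for modules in the library asks for a commutative
  ring of scalars; \<^const>\<open>submodule\<close> does not.
\<close>

locale left_module = R?: ring R + M?: abelian_group M
  for R (structure) and M :: "('a, 'm, 'z) module_scheme" (structure) +
  assumes smult_closed: "\<lbrakk>a \<in> carrier R; x \<in> carrier M\<rbrakk> \<Longrightarrow> a \<odot>\<^bsub>M\<^esub> x \<in> carrier M"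
    and smult_l_distr: "\<lbrakk>a \<in> carrier R; b \<in> carrier R; x \<in> carrier M\<rbrakk> \<Longrightarrow>
      (a \<oplus>\<^bsub>R\<^esub> b) \<odot>\<^bsub>M\<^esub> x = a \<odot>\<^bsub>M\<^esub> x \<oplus>\<^bsub>M\<^esub> b \<odot>\<^bsub>M\<^esub> x"
    and smult_r_distr: "\<lbrakk>a \<in> carrier R; x \<in> carrier M; y \<in> carrier M\<rbrakk> \<Longrightarrow>
      a \<odot>\<^bsub>M\<^esub> (x \<oplus>\<^bsub>M\<^esub> y) = a \<odot>\<^bsub>M\<^esub> x \<oplus>\<^bsub>M\<^esub> a \<odot>\<^bsub>M\<^esub> y"
    and smult_assoc: "\<lbrakk>a \<in> carrier R; b \<in> carrier R; x \<in> carrier M\<rbrakk> \<Longrightarrow>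
      (a \<otimes>\<^bsub>R\<^esub> b) \<odot>\<^bsub>M\<^esub> x = a \<odot>\<^bsub>M\<^esub> (b \<odot>\<^bsub>M\<^esub> x)"
    and smult_one: "x \<in> carrier M \<Longrightarrow> \<one>\<^bsub>R\<^esub> \<odot>\<^bsub>M\<^esub> x = x"

definition regular_module :: "'a ring \<Rightarrow> ('a, 'a) module" where
  "regular_module R = \<lparr>carrier = carrier R, mult = mult R, one = one R, ring.zero = ring.zero R, add = add R,
     smult = mult R\<rparr>"

definition gen_submodule :: "'a ring \<Rightarrow> ('a, 'm) module \<Rightarrow> 'm set \<Rightarrow> 'm set" where
  "gen_submodule R M S = \<Inter>{N. submodule N R M \<and> S \<subseteq> N}"

lemma submodule_gen_submodule:
  assumes "left_module R M" and "S \<subseteq> carrier M"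
  shows "submodule (gen_submodule R M S) R M" "S \<subseteq> gen_submodule R M S"
proof -
  interpret M: left_module R M by fact
  have "submodule (carrier M) R M"
    using M.smult_closed by (intro submodule.intro submodule_axioms.intro M.M.add.subgroup_self)
  then have ne: "{N. submodule N R M \<and> S \<subseteq> N} \<noteq> {}" using assms(2) by blast
  have "subgroup (gen_submodule R M S) (add_monoid M)"
    unfolding gen_submodule_def using ne
    by (intro M.M.add.subgroups_Inter) (auto simp: submodule_def)
  then show "submodule (gen_submodule R M S) R M"
    by (intro submodule.intro submodule_axioms.intro)
       (auto simp: gen_submodule_def submodule.smult_closed)
  show "S \<subseteq> gen_submodule R M S" by (auto simp: gen_submodule_def)
qed

definition quot_module :: "('a, 'm) module \<Rightarrow> 'm set \<Rightarrow> ('a, 'm set) module" where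
  "quot_module M N = \<lparr>carrier = a_rcosets\<^bsub>M\<^esub> N, mult = undefined, one = undefined,
     ring.zero = N, add = set_add M, smult = (\<lambda>a X. \<Union>x\<in>X. N +>\<^bsub>M\<^esub> (a \<odot>\<^bsub>M\<^esub> x))\<rparr>"

lemma left_module_regular: "ring R \<Longrightarrow> left_module R (regular_module R)"
proof -
  assume "ring R"
  then interpret R: ring R .
  have "abelian_group (regular_module R)"
    by (rule abelian_groupI)
       (auto simp: regular_module_def R.add.m_assoc intro: R.add.m_comm intro!: bexI R.l_neg)
  then show ?thesis
    by (intro left_module.intro left_module_axioms.intro R.ring_axioms)
       (auto simp: regular_module_def R.l_distr R.r_distr R.m_assoc)
qed

lemma left_module_quot_module:
  assumes "left_module R M" and "submodule N R M"
  shows "left_module R (quot_module M N)"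
proof -
  interpret M: left_module R M by fact
  interpret N: submodule N R M by fact
  have N: "abelian_subgroup N M"
    by (rule abelian_subgroupI3)
       (simp_all add: additive_subgroup_def N.subgroup_axioms M.M.abelian_group_axioms)
  interpret N: abelian_subgroup N M by fact
  have car: "carrier (quot_module M N) = {N +>\<^bsub>M\<^esub> x | x. x \<in> carrier M}"
    by (auto simp: quot_module_def A_RCOSETS_def RCOSETS_def a_r_coset_def)
  have add: "X \<oplus>\<^bsub>quot_module M N\<^esub> Y = X <+>\<^bsub>M\<^esub> Y" for X Y by (simp add: quot_module_def)
  interpret Q: comm_group "M A_Mod N" by (rule N.a_factorgroup_is_comm_group)
  have Q: "carrier (quot_module M N) = carrier (M A_Mod N)"
    "add (quot_module M N) = mult (M A_Mod N)" "ring.zero (quot_module M N) = one (M A_Mod N)"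
    by (simp_all add: quot_module_def A_FactGroup_def FactGroup_def A_RCOSETS_def set_add_def)
  have ag: "abelian_group (quot_module M N)"
  proof (rule abelian_groupI)
    fix X assume "X \<in> carrier (quot_module M N)"
    then show "\<exists>Y\<in>carrier (quot_module M N).
        Y \<oplus>\<^bsub>quot_module M N\<^esub> X = \<zero>\<^bsub>quot_module M N\<^esub>"
      unfolding Q using Q.l_inv Q.inv_closed by blast
  qed (unfold Q, (rule Q.m_closed Q.one_closed Q.m_assoc Q.m_comm Q.l_one; assumption)+)
  have sm: "a \<odot>\<^bsub>quot_module M N\<^esub> (N +>\<^bsub>M\<^esub> x) = N +>\<^bsub>M\<^esub> (a \<odot>\<^bsub>M\<^esub> x)"
    if ax: "a \<in> carrier R" "x \<in> carrier M" for a x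
  proof -
    have eq: "N +>\<^bsub>M\<^esub> (a \<odot>\<^bsub>M\<^esub> y) = N +>\<^bsub>M\<^esub> (a \<odot>\<^bsub>M\<^esub> x)" if y: "y \<in> N +>\<^bsub>M\<^esub> x" for y
    proof -
      obtain n where n: "n \<in> N" "y = n \<oplus>\<^bsub>M\<^esub> x"
        using y by (auto simp: a_r_coset_def r_coset_def)
      have nM: "n \<in> carrier M" using n N.a_subset by blast
      have "a \<odot>\<^bsub>M\<^esub> y = a \<odot>\<^bsub>M\<^esub> n \<oplus>\<^bsub>M\<^esub> a \<odot>\<^bsub>M\<^esub> x"
        using n nM ax by (simp add: M.smult_r_distr)
      moreover have "a \<odot>\<^bsub>M\<^esub> n \<in> N" using n ax by simp
      ultimately have "a \<odot>\<^bsub>M\<^esub> y \<in> N +>\<^bsub>M\<^esub> (a \<odot>\<^bsub>M\<^esub> x)"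
        by (auto simp: a_r_coset_def r_coset_def)
      then show ?thesis
        by (rule M.a_repr_independence[OF _ M.smult_closed[OF ax] N.subgroup_axioms, symmetric])
    qed
    have "x \<in> N +>\<^bsub>M\<^esub> x" using ax by (intro N.a_rcos_self)
    then have ne: "N +>\<^bsub>M\<^esub> x \<noteq> {}" by blast
    have "(\<Union>y\<in>N +>\<^bsub>M\<^esub> x. N +>\<^bsub>M\<^esub> (a \<odot>\<^bsub>M\<^esub> y)) = N +>\<^bsub>M\<^esub> (a \<odot>\<^bsub>M\<^esub> x)"
      by (rule SUP_eq_const[OF ne eq])
    then show ?thesis by (simp add: quot_module_def)
  qed
  have rs: "X <+>\<^bsub>M\<^esub> Y = N +>\<^bsub>M\<^esub> (x \<oplus>\<^bsub>M\<^esub> y)"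
    if "X = N +>\<^bsub>M\<^esub> x" "Y = N +>\<^bsub>M\<^esub> y" "x \<in> carrier M" "y \<in> carrier M" for X Y x y
    using that by (simp add: N.a_rcos_sum)
  have props: "a \<odot>\<^bsub>quot_module M N\<^esub> X \<in> carrier (quot_module M N)"
      "(a \<oplus>\<^bsub>R\<^esub> b) \<odot>\<^bsub>quot_module M N\<^esub> X
          = a \<odot>\<^bsub>quot_module M N\<^esub> X \<oplus>\<^bsub>quot_module M N\<^esub> b \<odot>\<^bsub>quot_module M N\<^esub> X"
      "a \<odot>\<^bsub>quot_module M N\<^esub> (X \<oplus>\<^bsub>quot_module M N\<^esub> Y)
          = a \<odot>\<^bsub>quot_module M N\<^esub> X \<oplus>\<^bsub>quot_module M N\<^esub> a \<odot>\<^bsub>quot_module M N\<^esub> Y"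
      "(a \<otimes>\<^bsub>R\<^esub> b) \<odot>\<^bsub>quot_module M N\<^esub> X
          = a \<odot>\<^bsub>quot_module M N\<^esub> (b \<odot>\<^bsub>quot_module M N\<^esub> X)"
      "\<one>\<^bsub>R\<^esub> \<odot>\<^bsub>quot_module M N\<^esub> X = X"
    if ab: "a \<in> carrier R" "b \<in> carrier R"
      and XY: "X \<in> carrier (quot_module M N)" "Y \<in> carrier (quot_module M N)" for a b X Y
  proof -
    from XY obtain x y where xy: "X = N +>\<^bsub>M\<^esub> x" "Y = N +>\<^bsub>M\<^esub> y" "x \<in> carrier M" "y \<in> carrier M"
      unfolding car by blast
    note c = M.smult_closed[OF ab(1) xy(3)] M.smult_closed[OF ab(2) xy(3)]
      M.smult_closed[OF ab(1) xy(4)]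
    show "a \<odot>\<^bsub>quot_module M N\<^esub> X \<in> carrier (quot_module M N)"
      unfolding xy(1) sm[OF ab(1) xy(3)] car using c by blast
    show "(a \<oplus>\<^bsub>R\<^esub> b) \<odot>\<^bsub>quot_module M N\<^esub> X
        = a \<odot>\<^bsub>quot_module M N\<^esub> X \<oplus>\<^bsub>quot_module M N\<^esub> b \<odot>\<^bsub>quot_module M N\<^esub> X"
      unfolding add xy(1) sm[OF ab(1) xy(3)] sm[OF ab(2) xy(3)] sm[OF M.R.add.m_closed[OF ab] xy(3)]
        rs[OF refl refl c(1,2)] by (simp only: M.smult_l_distr[OF ab xy(3)])
    show "a \<odot>\<^bsub>quot_module M N\<^esub> (X \<oplus>\<^bsub>quot_module M N\<^esub> Y)
        = a \<odot>\<^bsub>quot_module M N\<^esub> X \<oplus>\<^bsub>quot_module M N\<^esub> a \<odot>\<^bsub>quot_module M N\<^esub> Y"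
      unfolding add rs[OF xy] sm[OF ab(1) M.M.add.m_closed[OF xy(3,4)]]
      unfolding xy(1,2) sm[OF ab(1) xy(3)] sm[OF ab(1) xy(4)] rs[OF refl refl c(1,3)]
      by (simp only: M.smult_r_distr[OF ab(1) xy(3,4)])
    show "(a \<otimes>\<^bsub>R\<^esub> b) \<odot>\<^bsub>quot_module M N\<^esub> X
        = a \<odot>\<^bsub>quot_module M N\<^esub> (b \<odot>\<^bsub>quot_module M N\<^esub> X)"
      unfolding xy(1) sm[OF M.R.m_closed[OF ab] xy(3)] sm[OF ab(2) xy(3)] sm[OF ab(1) c(2)]
      by (simp only: M.smult_assoc[OF ab xy(3)])
    show "\<one>\<^bsub>R\<^esub> \<odot>\<^bsub>quot_module M N\<^esub> X = X"
      unfolding xy(1) sm[OF M.R.one_closed xy(3)] by (simp only: M.smult_one[OF xy(3)])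
  qed
  show ?thesis
    by (intro left_module.intro left_module_axioms.intro M.R.ring_axioms ag)
       (rule props; (assumption | rule M.R.one_closed))+
qed

definition isomorphic_modules :: "'a ring \<Rightarrow> ('a, 'm) module \<Rightarrow> ('a, 'n) module \<Rightarrow> bool" where
  "isomorphic_modules R M N \<longleftrightarrow> (\<exists>f \<in> iso (add_monoid M) (add_monoid N).
     \<forall>a\<in>carrier R. \<forall>x\<in>carrier M. f (a \<odot>\<^bsub>M\<^esub> x) = a \<odot>\<^bsub>N\<^esub> f x)"

text \<open>\<open>M\<close> is the (internal) direct sum of the subgroups \<open>N i\<close>, \<open>i \<in> I\<close>.\<close>

definition internal_direct_sum :: "('a, 'm) module \<Rightarrow> 'j set \<Rightarrow> ('j \<Rightarrow> 'm set) \<Rightarrow> bool" where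
  "internal_direct_sum M I N \<longleftrightarrow> (\<forall>i\<in>I. subgroup (N i) (add_monoid M)) \<and>
     (\<lambda>f. gfinprod (add_monoid M) f I)
       \<in> iso (sum_group I (\<lambda>i. add_monoid (M\<lparr>carrier := N i\<rparr>))) (add_monoid M)"

definition simple_submodule :: "'m set \<Rightarrow> 'a ring \<Rightarrow> ('a, 'm) module \<Rightarrow> bool" where
  "simple_submodule N R M \<longleftrightarrow> submodule N R M \<and> N \<noteq> {\<zero>\<^bsub>M\<^esub>}
     \<and> (\<forall>N'. submodule N' R M \<and> N' \<subseteq> N \<longrightarrow> N' = {\<zero>\<^bsub>M\<^esub>} \<or> N' = N)"

definition completely_reducible :: "'a ring \<Rightarrow> ('a, 'm) module \<Rightarrow> bool" where
  "completely_reducible R M \<longleftrightarrow>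
     (\<exists>\<N>. (\<forall>N\<in>\<N>. simple_submodule N R M) \<and> internal_direct_sum M \<N> (\<lambda>N. N))"


section \<open>Modules over \<open>U\<close>\<close>

type_synonym ('g, 'i, 'k, 'm) U_module = "(('g, 'i, 'k) smash set, 'm) module"

definition weight_space :: "('g::ab_group_add, 'i::finite, 'k::field) yd_datum \<Rightarrow> ('i \<Rightarrow> 'k) \<Rightarrow>
    ('g, 'i, 'k, 'm) U_module \<Rightarrow> ('g \<Rightarrow> 'k) \<Rightarrow> 'm set" where
  "weight_space D l M c =
     {m \<in> carrier M. \<forall>g. U_grp D l g \<odot>\<^bsub>M\<^esub> m = U_scalar D l (c g) \<odot>\<^bsub>M\<^esub> m}"

definition in_C :: "('g::ab_group_add, 'i::finite, 'k::field) yd_datum \<Rightarrow> ('i \<Rightarrow> 'k) \<Rightarrow>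
    ('g, 'i, 'k, 'm) U_module \<Rightarrow> bool" where
  "in_C D l M \<longleftrightarrow> left_module (U_alg D l) M
     \<and> internal_direct_sum M {c. character c} (weight_space D l M)"

definition in_C_hi :: "('g::ab_group_add, 'i::finite, 'k::field) yd_datum \<Rightarrow> ('i \<Rightarrow> 'k) \<Rightarrow>
    ('g, 'i, 'k, 'm) U_module \<Rightarrow> bool" where
  "in_C_hi D l M \<longleftrightarrow> in_C D l M
     \<and> (\<forall>m\<in>carrier M. \<exists>N. \<forall>\<alpha> :: 'i \<Rightarrow> nat. (\<Sum>i\<in>UNIV. \<alpha> i) \<ge> N \<longrightarrow>
          (\<forall>x\<in>U_plus_comp D l \<alpha>. x \<odot>\<^bsub>M\<^esub> m = \<zero>\<^bsub>M\<^esub>))"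

definition integrable :: "('g::ab_group_add, 'i::finite, 'k::field) yd_datum \<Rightarrow> ('i \<Rightarrow> 'k) \<Rightarrow>
    ('g, 'i, 'k, 'm) U_module \<Rightarrow> bool" where
  "integrable D l M \<longleftrightarrow> in_C D l M
     \<and> (\<forall>m\<in>carrier M. \<forall>i. \<exists>n::nat. n \<ge> 1
          \<and> (U_E D l i [^]\<^bsub>U_alg D l\<^esub> n) \<odot>\<^bsub>M\<^esub> m = \<zero>\<^bsub>M\<^esub>
          \<and> (U_F D l i [^]\<^bsub>U_alg D l\<^esub> n) \<odot>\<^bsub>M\<^esub> m = \<zero>\<^bsub>M\<^esub>)"

definition dominant :: "('g::ab_group_add, 'i::finite, 'k::field) yd_datum \<Rightarrow> ('g \<Rightarrow> 'k) \<Rightarrow> bool" where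
  "dominant D c \<longleftrightarrow> character c
     \<and> (\<exists>m :: 'i \<Rightarrow> nat. \<forall>i. c (elK D i + elL D i) = q D i i ^ m i)"

text \<open>The exponent is unique when \<open>D\<close> is generic.\<close>

definition dom_exp :: "('g::ab_group_add, 'i::finite, 'k::field) yd_datum \<Rightarrow> ('g \<Rightarrow> 'k) \<Rightarrow> 'i \<Rightarrow> nat" where
  "dom_exp D c i = (THE m. c (elK D i + elL D i) = q D i i ^ m)"

definition L_ideal :: "('g::ab_group_add, 'i::finite, 'k::field) yd_datum \<Rightarrow> ('i \<Rightarrow> 'k) \<Rightarrow>
    ('g \<Rightarrow> 'k) \<Rightarrow> ('g, 'i, 'k) smash set set" where
  "L_ideal D l c = gen_submodule (U_alg D l) (regular_module (U_alg D l))
     (range (U_E D l)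
      \<union> range (\<lambda>i. U_F D l i [^]\<^bsub>U_alg D l\<^esub> (dom_exp D c i + 1))
      \<union> range (\<lambda>g. U_grp D l g \<ominus>\<^bsub>U_alg D l\<^esub> U_scalar D l (c g)))"

definition L_mod :: "('g::ab_group_add, 'i::finite, 'k::field) yd_datum \<Rightarrow> ('i \<Rightarrow> 'k) \<Rightarrow>
    ('g \<Rightarrow> 'k) \<Rightarrow> ('g, 'i, 'k, ('g, 'i, 'k) smash set set) U_module" where
  "L_mod D l c = quot_module (regular_module (U_alg D l)) (L_ideal D l c)"

lemma left_module_L_mod:
  assumes "reduced_datum D"
  shows "left_module (U_alg D l) (L_mod D l c)"
proof -
  interpret U: ring "U_alg D l" by (rule ring_U_alg[OF assms])
  have mem: "U_class D l x \<in> carrier (U_alg D l)" for x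
    by (auto simp: U_class_def U_alg_def FactRing_def A_RCOSETS_def RCOSETS_def a_r_coset_def
        smash_alg_def)
  have "left_module (U_alg D l) (regular_module (U_alg D l))"
    by (rule left_module_regular[OF U.ring_axioms])
  then show ?thesis
    unfolding L_mod_def L_ideal_def
    by (intro left_module_quot_module submodule_gen_submodule)
       (auto simp: regular_module_def U_E_def U_F_def U_grp_def U_scalar_def mem U.minus_closed)
qed

end

theory Submission
  imports Defs "HOL-Combinatorics.Multiset_Permutations"
begin

text \<open>
  The form on the free algebra whose adjoints of left and right multiplication are skew derivations
  has a radical that lies in the Nichols ideals of both \<open>V\<close> and \<open>W\<close>. Hence a generalised inverse of
  its Gram matrix in degree \<open>\<beta>\<close> yields a canonical element, and summing these over \<open>\<beta>\<close>, weighted by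
  a quadratic function of the weight, gives Casimir operators that commute with all \<open>E\<^sub>i\<close> and \<open>F\<^sub>i\<close>.
  There is one such operator for each connected component of the Cartan matrix: within a component
  all \<open>q\<^sub>i\<^sub>i\<close> have common positive powers, so its eigenvalues separate dominant weights that differ by
  a sum of simple roots meeting the component. This makes integrable highest weight modules simple
  and lets vectors that are primitive modulo a sum of such modules be lifted to primitive vectors.
\<close>

text \<open>The operator calculus lives on a vector space that fills a type, while \<open>M\<close>
  has an arbitrary carrier. The bridge is cyclic: both decisive assertions, that a primitive vector
  generates a simple submodule and that a weight vector lies in the sum of such submodules, concern
  a single vector \<open>m\<close>, and the submodule it generates is the smash product modulo the
  left annihilator of \<open>m\<close>. A linear projection \<open>P\<close> with this kernel turns
  the quotient into operators on the smash product itself. The module \<open>L(\<chi>)\<close> is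
  treated in the same way. Its defining left ideal turns out to be maximal, hence equals the
  annihilator of every nonzero primitive vector of weight \<open>\<chi>\<close> in an integrable
  module; simplicity and the isomorphism follow together. Its local nilpotency must first be derived
  from its relations, by quantum Serre relations, since these only mention the generator. Regularity
  lets the letters of a nonvanishing word in the \<open>w i\<close> on a highest weight vector be
  read off its weight. Dominance makes all exponents in the comparison of Casimir eigenvalues
  positive, so that no cancellation can occur.\<close>

abbreviation word :: "'x list \<Rightarrow> ('x list \<Rightarrow>\<^sub>0 'k::comm_ring_1)" where
  "word u \<equiv> Poly_Mapping.single u 1"

interpretation fld: vector_space "(*) :: 'k::field \<Rightarrow> 'k \<Rightarrow> 'k"
  by unfold_locales (auto simp: algebra_simps)

text \<open>This rule undoes the normalisation by \<open>mult.assoc\<close>.\<close>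
declare fld.scale_scale [simp del]

lemma scl_single [simp]: "scl a (Poly_Mapping.single u b) = Poly_Mapping.single u (a * b)"
  by (intro poly_mapping_eqI) (simp add: lookup_single when_def)

lemma scl_mult_left: "scl a (x * y) = scl a x * (y :: 'x list \<Rightarrow>\<^sub>0 'k::field)"
proof (induction x rule: pm_induct)
  case (single u b)
  show ?case by (induction y rule: pm_induct)
    (simp_all add: mult_single pm.scale_right_distrib distrib_left mult.assoc)
qed (simp_all add: pm.scale_right_distrib distrib_right)

lemma scl_mult_right: "scl a (x * y) = x * scl a (y :: 'x list \<Rightarrow>\<^sub>0 'k::field)"
proof (induction x rule: pm_induct)
  case (single u b)
  show ?case by (induction y rule: pm_induct)
    (simp_all add: mult_single pm.scale_right_distrib distrib_left mult_ac)
qed (simp_all add: pm.scale_right_distrib distrib_right)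

lemma word_mult: "word u * (word v :: 'x list \<Rightarrow>\<^sub>0 'k::comm_ring_1) = word (u @ v)"
  by (simp add: mult_single plus_list_def)

section \<open>Linear extension of maps given on a basis\<close>

definition lext :: "('k::field \<Rightarrow> 'v \<Rightarrow> 'v::ab_group_add) \<Rightarrow> ('a \<Rightarrow> 'v) \<Rightarrow> ('a \<Rightarrow>\<^sub>0 'k) \<Rightarrow> 'v" where
  "lext s f t = (\<Sum>u\<in>Poly_Mapping.keys t. s (Poly_Mapping.lookup t u) (f u))"

context vector_space
begin

lemma lext_superset:
  assumes "finite A" "Poly_Mapping.keys t \<subseteq> A"
  shows "lext scale f t = (\<Sum>u\<in>A. scale (Poly_Mapping.lookup t u) (f u))"
  unfolding lext_def using assms by (intro sum.mono_neutral_left) (auto simp: in_keys_iff)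

lemma lext_zero [simp]: "lext scale f 0 = 0"
  by (simp add: lext_def)

lemma lext_single [simp]: "lext scale f (Poly_Mapping.single u a) = scale a (f u)"
  by (simp add: lext_superset[of "{u}"])

lemma lext_add: "lext scale f (s + t) = lext scale f s + lext scale f t"
proof -
  let ?A = "Poly_Mapping.keys s \<union> Poly_Mapping.keys t"
  have "Poly_Mapping.keys (s + t) \<subseteq> ?A" by (rule Poly_Mapping.keys_add)
  then show ?thesis
    by (simp add: lext_superset[of ?A] lookup_add scale_left_distrib sum.distrib)
qed

lemma lext_scl: "lext scale f (scl a t) = scale a (lext scale f t)"
proof -
  have "Poly_Mapping.keys (scl a t) \<subseteq> Poly_Mapping.keys t" by (auto simp: in_keys_iff)
  then show ?thesis
    by (simp add: lext_superset[of "Poly_Mapping.keys t"] scale_sum_right)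
qed

lemma lext_cong:
  assumes "\<And>u. u \<in> Poly_Mapping.keys t \<Longrightarrow> f u = h u"
  shows "lext scale f t = lext scale h t"
  unfolding lext_def using assms by (intro sum.cong) auto

lemma linear_pm_lext:
  assumes "Vector_Spaces.linear scl scale f"
  shows "f t = lext scale (\<lambda>u. f (Poly_Mapping.single u 1)) t"
proof -
  interpret f: Vector_Spaces.linear scl scale f by fact
  show ?thesis
  proof (induction t rule: pm_induct)
    case (single u a)
    have "Poly_Mapping.single u a = scl a (Poly_Mapping.single u 1)" by simp
    then show ?case using f.scale by (metis lext_single)
  qed (simp_all add: f.add lext_add f.zero)
qed

end

lemma linear_scl_iff:
  assumes "vector_space s"
  shows "Vector_Spaces.linear scl s f \<longleftrightarrow>
    (\<forall>x y. f (x + y) = f x + f y) \<and> (\<forall>a x. f (scl a x) = s a (f x))"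
proof -
  interpret vector_space s by fact
  show ?thesis
    by (simp add: Vector_Spaces.linear_def module_hom_def module_hom_axioms_def
      pm.vector_space_axioms pm.module_axioms vector_space_axioms module_axioms)
qed

section \<open>Skew derivations of the free algebra and the form\<close>

text \<open>\<open>dL\<close> weighs a deleted letter \<open>i\<close> by the letters to its left,
  \<open>dR\<close> by those to its right. For the form below, \<open>dR\<close> is adjoint to left
  and \<open>dL\<close> to right multiplication by \<open>i\<close>.\<close>

primrec dL :: "('x \<Rightarrow> 'x \<Rightarrow> 'k::field) \<Rightarrow> 'x \<Rightarrow> 'x list \<Rightarrow> ('x list \<Rightarrow>\<^sub>0 'k)" where
  "dL p i [] = 0"
| "dL p i (y # v) = (if y = i then word v else 0) + scl (p y i) (word [y] * dL p i v)"

primrec dR :: "('x \<Rightarrow> 'x \<Rightarrow> 'k::field) \<Rightarrow> 'x \<Rightarrow> 'x list \<Rightarrow> ('x list \<Rightarrow>\<^sub>0 'k)" where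
  "dR p i [] = 0"
| "dR p i (y # v) = (if y = i then scl (\<Prod>s\<leftarrow>v. p i s) (word v) else 0) + word [y] * dR p i v"

abbreviation DL where "DL p i \<equiv> lext scl (dL p i)"
abbreviation DR where "DR p i \<equiv> lext scl (dR p i)"
text \<open>The twist in the braided Leibniz rules: the group element attached to \<open>i\<close>,
  acting diagonally on words.\<close>

abbreviation TW :: "('x \<Rightarrow> 'x \<Rightarrow> 'k::field) \<Rightarrow> 'x \<Rightarrow> ('x list \<Rightarrow>\<^sub>0 'k) \<Rightarrow> ('x list \<Rightarrow>\<^sub>0 'k)" where
  "TW p i \<equiv> lext scl (\<lambda>u. Poly_Mapping.single u (\<Prod>s\<leftarrow>u. p i s))"

lemmas lext_simps = pm.lext_add pm.lext_scl pm.scale_right_distrib distrib_left distrib_right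
  scl_mult_left[symmetric] scl_mult_right[symmetric]

lemma single_eq_scl: "Poly_Mapping.single u a = scl a (Poly_Mapping.single u 1)" by simp

lemma word_mult_single: "word u * Poly_Mapping.single v a = Poly_Mapping.single (u @ v) (a::'k::comm_ring_1)"
  by (simp add: mult_single plus_list_def)

lemma single_mult_word: "Poly_Mapping.single v a * word u = Poly_Mapping.single (v @ u) (a::'k::comm_ring_1)"
  by (simp add: mult_single plus_list_def)

lemma DL_mult: "DL p i (word [y] * t) = (if y = i then t else 0) + scl (p y i) (word [y] * DL p i t)"
  by (induction t rule: pm_induct)
    (auto simp: lext_simps word_mult_single pm.scale_left_commute)

lemma DR_mult: "DR p i (word [y] * t) = (if y = i then TW p i t else 0) + word [y] * DR p i t"
  by (induction t rule: pm_induct)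
    (auto simp: lext_simps word_mult_single)

lemma TW_mult: "TW p i (word [y] * t) = scl (p i y) (word [y] * TW p i t)"
  by (induction t rule: pm_induct)
    (auto simp: lext_simps word_mult_single mult_ac)

lemma DR_mult_right: "DR p k (t * word [y]) = (if y = k then t else 0) + scl (p k y) (DR p k t * word [y])"
proof (induction t rule: pm_induct)
  case (single u a)
  have *: "dR p k (u @ [y]) = (if y = k then word u else 0) + scl (p k y) (dR p k u * word [y])"
    by (induction u) (auto simp: lext_simps word_mult single_mult_word word_mult_single mult.assoc mult.commute split: if_splits)
  show ?case by (auto simp: single_mult_word * lext_simps pm.scale_left_commute)
qed (auto simp: lext_simps)

lemma dR_append: "dR p y (u' @ u) = word u' * dR p y u + scl (\<Prod>s\<leftarrow>u. p y s) (dR p y u' * word u)"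
proof -
  have 1: "word [] * t = t" for t :: "'a list \<Rightarrow>\<^sub>0 'b"
    by (simp add: zero_list_def[symmetric])
  show ?thesis
    by (induction u') (auto simp: lext_simps word_mult single_mult_word word_mult_single 1
      mult.assoc[symmetric] mult.commute)
qed

text \<open>The words of \<open>dL p i v\<close> have one \<open>i\<close> fewer than
  \<open>v\<close>, so their twist lacks one factor \<open>p j i\<close>. It is multiplied across to
  avoid an inverse.\<close>

lemma TW_dL:
  "scl (p j i) (TW p j (dL p i v)) = scl (\<Prod>s\<leftarrow>v. p j s) (dL p i v)"
proof (induction v)
  case (Cons y v)
  have "scl (p j i) (word [y] * TW p j (dL p i v)) = scl (\<Prod>s\<leftarrow>v. p j s) (word [y] * dL p i v)"
    unfolding scl_mult_right by (simp only: Cons)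
  then have "scl a (scl (p j i) (word [y] * TW p j (dL p i v)))
      = scl a (scl (\<Prod>s\<leftarrow>v. p j s) (word [y] * dL p i v))" for a by simp
  from this[of "p y i * p j y"] show ?case
    by (auto simp: lext_simps TW_mult mult_ac)
qed auto

text \<open>If the deleted \<open>j\<close> stands before the deleted \<open>i\<close>, the factor
  \<open>p j i\<close> is picked up once in either order, by whichever deletion comes first;
  otherwise it never occurs.\<close>

lemma DL_DR_commute: 
  assumes p: "\<And>i j. p i j \<noteq> 0"
  shows "DL p i (DR p j t) = DR p j (DL p i t)"
proof -
  have TW: "TW p j (dL p i v) = scl (inverse (p j i) * (\<Prod>s\<leftarrow>v. p j s)) (dL p i v)" for i j v
  proof -
    have "TW p j (dL p i v) = scl (inverse (p j i)) (scl (p j i) (TW p j (dL p i v)))"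
      using p by simp
    then show ?thesis by (simp only: TW_dL pm.scale_scale)
  qed
  have "DL p i (dR p j u) = DR p j (dL p i u)" for u
  proof (induction u)
    case (Cons y v)
    show ?case
      using Cons by (cases "y = j"; cases "y = i") (simp_all add: p TW lext_simps DL_mult DR_mult mult.assoc[symmetric])
  qed auto
  then show ?thesis by (induction t rule: pm_induct) (auto simp: lext_simps)
qed

text \<open>Up to reversing \<open>u\<close>, \<open>fm p u (word v)\<close> is the coefficient of
  \<open>u\<close> in the quantum symmetriser applied to \<open>v\<close>, for the diagonal braiding
  with matrix \<open>p\<close>. Keeping the first argument a word makes the recursion primitive;
  linearity there is recovered by \<open>fm_sym\<close>.\<close>

primrec fm :: "('x \<Rightarrow> 'x \<Rightarrow> 'k::field) \<Rightarrow> 'x list \<Rightarrow> ('x list \<Rightarrow>\<^sub>0 'k) \<Rightarrow> 'k" where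
  "fm p [] t = Poly_Mapping.lookup t []"
| "fm p (i # u) t = fm p u (DR p i t)"

lemma fm_linear [simp]:
  "fm p u (s + t) = fm p u s + fm p u t" "fm p u (scl a t) = a * fm p u t" "fm p u 0 = 0"
  by (induction u arbitrary: s t) (auto simp: lookup_add lext_simps)

lemma linear_fm: "Vector_Spaces.linear scl (*) (fm p u)"
  by (simp add: linear_scl_iff fld.vector_space_axioms)

lemma fm_single: "fm p u (Poly_Mapping.single v a) = a * fm p u (word v)"
  by (subst single_eq_scl) (simp only: fm_linear)

lemma fm_diff [simp]: "fm p u (s - t) = fm p u s - fm p u t"
  using fm_linear(1)[of p u "s - t" t] by simp

lemma fm_sum: "fm p u (\<Sum>x\<in>A. f x) = (\<Sum>x\<in>A. fm p u (f x))"
  by (induction A rule: infinite_finite_induct) auto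

lemma fm_expand: "fm p u t = lext (*) (\<lambda>v. fm p u (word v)) t"
  by (rule fld.linear_pm_lext[OF linear_fm])

lemma keys_addD: "v \<in> Poly_Mapping.keys (s + t) \<Longrightarrow> v \<in> Poly_Mapping.keys s \<or> v \<in> Poly_Mapping.keys t"
  using Poly_Mapping.keys_add[of s t] by blast

lemma keys_dR: "v \<in> Poly_Mapping.keys (dR p i x) \<Longrightarrow> add_mset i (mset v) = mset x"
proof (induction x arbitrary: v)
  case (Cons y x)
  have "v \<in> Poly_Mapping.keys (if y = i then scl (\<Prod>s\<leftarrow>x. p i s) (word x) else 0) \<or>
    v \<in> Poly_Mapping.keys (word [y] * dR p i x)"
    using Cons.prems unfolding dL.simps dR.simps by (rule keys_addD)
  then show ?case
  proof
    assume "v \<in> Poly_Mapping.keys (word [y] * dR p i x)"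
    then obtain b where "b \<in> Poly_Mapping.keys (dR p i x)" "v = y # b"
      using keys_mult[of "word [y]" "dR p i x"] by (fastforce simp: plus_list_def)
    with Cons.IH show ?thesis by auto
  qed (auto split: if_splits)
qed auto

lemma keys_dL:
  fixes p :: "'x \<Rightarrow> 'x \<Rightarrow> 'k::field"
  shows "v \<in> Poly_Mapping.keys (dL p i x) \<Longrightarrow> add_mset i (mset v) = mset x"
proof (induction x arbitrary: v)
  case (Cons y x)
  have "v \<in> Poly_Mapping.keys (if y = i then word x else (0 :: 'x list \<Rightarrow>\<^sub>0 'k)) \<or>
    v \<in> Poly_Mapping.keys (scl (p y i) (word [y] * dL p i x))"
    using Cons.prems unfolding dL.simps dR.simps by (rule keys_addD)
  then show ?case
  proof
    assume "v \<in> Poly_Mapping.keys (scl (p y i) (word [y] * dL p i x))"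
    then have "v \<in> Poly_Mapping.keys (word [y] * dL p i x)" by (auto simp: in_keys_iff)
    then obtain b where "b \<in> Poly_Mapping.keys (dL p i x)" "v = y # b"
      using keys_mult[of "word [y]" "dL p i x"] by (fastforce simp: plus_list_def)
    with Cons.IH show ?thesis by auto
  qed (auto split: if_splits)
qed auto

lemma fm_homogeneous: "mset u \<noteq> mset x \<Longrightarrow> fm p u (word x) = 0"
proof (induction u arbitrary: x)
  case (Cons i u)
  have "fm p (i # u) (word x) = lext (*) (\<lambda>v. fm p u (word v)) (dR p i x)"
    using fm_expand[of p u "dR p i x"] by simp
  also have "\<dots> = lext (*) (\<lambda>v. 0) (dR p i x)"
    using Cons by (intro fld.lext_cong Cons.IH) (auto dest!: keys_dR)
  finally show ?case by (simp add: lext_def)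
qed (auto simp: lookup_single when_def)

text \<open>\<open>DL\<close> is moved past all the \<open>DR\<close>; at the empty word both
  derivations read off the coefficient of the word \<open>[i]\<close>.\<close>

lemma fm_snoc:
  assumes p: "\<And>i j. p i j \<noteq> 0"
  shows "fm p (u @ [i]) t = fm p u (DL p i t)"
proof (induction u arbitrary: t)
  case Nil
  have *: "Poly_Mapping.lookup (word [a] * s) [] = (0::'b)" for a :: 'a and s
  proof (rule ccontr)
    assume "\<not> ?thesis"
    then have "[] \<in> Poly_Mapping.keys (word [a] * s)" by (simp add: in_keys_iff)
    then show False using keys_mult[of "word [a] " s] by (auto simp: plus_list_def)
  qed
  have "Poly_Mapping.lookup (dR p i u) [] = Poly_Mapping.lookup (dL p i u) []" for u
    by (cases u) (auto simp: lookup_add * lookup_single when_def)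
  then show ?case by (induction t rule: pm_induct) (auto simp: lext_simps lookup_add)
next
  case (Cons a u)
  then show ?case by (simp add: DL_DR_commute[OF p])
qed

text \<open>The twist depends only on the multiset of letters, and words with different multisets
  are orthogonal, so it can be read on either argument.\<close>

lemma fm_TW: "fm p u (TW p i t) = (\<Prod>s\<leftarrow>u. p i s) * fm p u t"
proof (induction t rule: pm_induct)
  case (single v a)
  show ?case
  proof (cases "mset u = mset v")
    case True
    then have "mset (map (p i) u) = mset (map (p i) v)" by simp
    then have "(\<Prod>s\<leftarrow>u. p i s) = (\<Prod>s\<leftarrow>v. p i s)" by (metis prod_mset_prod_list)
    then show ?thesis by (simp add: fm_single[of _ _ _ "_ * _"] fm_single[of _ _ _ a])
  next
    case False
    then show ?thesis by (simp add: fm_single[of _ _ _ "_ * _"] fm_single[of _ _ _ a] fm_homogeneous)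
  qed
qed (simp_all add: lext_simps algebra_simps)

text \<open>The Leibniz rule of \<open>DR\<close> on \<open>word [j] * t\<close> matches the
  recursion of \<open>dR\<close> on \<open>i # u\<close> once \<open>fm_TW\<close> has moved the
  twist from \<open>t\<close> to \<open>u\<close>.\<close>

lemma fm_mult_left: "fm p u (word [j] * t) = lext (*) (\<lambda>u'. fm p u' t) (dR p j u)"
proof (induction u arbitrary: t)
  case Nil
  have "[] \<notin> Poly_Mapping.keys (word [j] * t)"
    using keys_mult[of "word [j] " t] by (auto simp: plus_list_def)
  then show ?case by (simp add: in_keys_iff)
next
  case (Cons i u)
  have *: "lext (*) (\<lambda>u'. fm p u' t) (word [i] * s) = lext (*) (\<lambda>u'. fm p u' (DR p i t)) s" for s
    by (induction s rule: pm_induct) (auto simp: fld.lext_add distrib_left word_mult_single)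
  show ?case by (auto simp: DR_mult fm_TW Cons * fld.lext_add)
qed

lemma fm_sym: "fm p u (word x) = fm p x (word u)"
proof (induction x arbitrary: u)
  case Nil
  show ?case by (cases u) (auto simp: lookup_single when_def)
next
  case (Cons y x)
  have "fm p u (word (y # x)) = lext (*) (\<lambda>u'. fm p u' (word x)) (dR p y u)"
    using fm_mult_left[of p u y "word x"] by (simp add: word_mult)
  also have "\<dots> = lext (*) (\<lambda>u'. fm p x (word u')) (dR p y u)" by (simp only: Cons)
  also have "\<dots> = fm p x (dR p y u)" by (rule fm_expand[symmetric])
  finally show ?case by simp
qed

section \<open>The radical of the form and the Nichols ideal\<close>

definition Rad :: "('x \<Rightarrow> 'x \<Rightarrow> 'k::field) \<Rightarrow> ('x list \<Rightarrow>\<^sub>0 'k) set" where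
  "Rad p = {t. \<forall>u. fm p u t = 0}"

lemma Rad_iff: "t \<in> Rad p \<longleftrightarrow> (\<forall>u. fm p u t = 0)"
  by (simp add: Rad_def)

lemma subspace_Rad: "pm.subspace (Rad p)"
  by (simp add: pm.subspace_def Rad_iff)

text \<open>On the left this is adjointness. On the right the induction on the first argument works
  because \<open>DR\<close> maps the radical into itself.\<close>

lemma Rad_word_mult:
  assumes p: "\<And>i j. p i j \<noteq> 0" and t: "t \<in> Rad p"
  shows "word u * t \<in> Rad p" "t * word u \<in> Rad p"
proof -
  have L: "word [y] * t \<in> Rad p" if t: "t \<in> Rad p" for y t
  proof -
    have "fm p u (word [y] * t) = lext (*) (\<lambda>u'. 0) (dR p y u)" for u
      using t by (simp add: fm_mult_left Rad_iff)
    then show ?thesis by (simp add: Rad_iff lext_def)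
  qed
  have 1: "word [] * t = t" "t * word [] = t" for t :: "'a list \<Rightarrow>\<^sub>0 'b"
    by (simp_all add: zero_list_def[symmetric])
  show "word u * t \<in> Rad p"
  proof (induction u)
    case (Cons y u)
    have "word (y # u) * t = word [y] * (word u * t)"
      by (simp add: word_mult mult.assoc[symmetric])
    then show ?case using L Cons by simp
  qed (simp add: 1 t)
  have R: "t * word [y] \<in> Rad p" if t: "t \<in> Rad p" for y t
  proof -
    have "fm p u (t * word [y]) = 0" for u
    using t proof (induction u arbitrary: t)
      case Nil
      have "[] \<notin> Poly_Mapping.keys (t * word [y])"
        using keys_mult[of t "word [y]"] by (auto simp: plus_list_def)
      then show ?case by (simp add: in_keys_iff)
    next
      case (Cons i u)
      have "DR p i t \<in> Rad p" using Cons.prems by (simp add: Rad_iff flip: fm.simps(2))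
      with Cons show ?case by (auto simp: DR_mult_right Rad_iff)
    qed
    then show ?thesis by (simp add: Rad_iff)
  qed
  show "t * word u \<in> Rad p"
  proof (induction u rule: rev_induct)
    case (snoc y u)
    have "t * word (u @ [y]) = (t * word u) * word [y]"
      by (simp add: word_mult mult.assoc)
    then show ?case using R snoc by simp
  qed (simp add: 1 t)
qed

lemma Rad_ideal:
  assumes p: "\<And>i j. p i j \<noteq> 0" and t: "t \<in> Rad p"
  shows "s * t \<in> Rad p" "t * s \<in> Rad p"
proof -
  note z = pm.subspace_0[OF subspace_Rad] and a = pm.subspace_add[OF subspace_Rad]
    and c = pm.subspace_scale[OF subspace_Rad]
  show "s * t \<in> Rad p"
  proof (induction s rule: pm_induct)
    case (single u b)
    have "Poly_Mapping.single u b * t = scl b (word u * t)" by (simp add: scl_mult_left)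
    then show ?case by (simp add: c Rad_word_mult(1)[OF assms])
  qed (simp_all add: z a distrib_right)
  show "t * s \<in> Rad p"
  proof (induction s rule: pm_induct)
    case (single u b)
    have "t * Poly_Mapping.single u b = scl b (t * word u)" by (simp add: scl_mult_right)
    then show ?case by (simp add: c Rad_word_mult(2)[OF assms])
  qed (simp_all add: z a distrib_left)
qed

lemma fm_hom_part:
  fixes p :: "'x \<Rightarrow> 'x \<Rightarrow> 'k::field"
  shows "fm p u (hom_part n t) = (if length u = n then fm p u t else 0)"
proof (induction t rule: pm_induct)
  case zero
  have "hom_part n (0 :: 'x list \<Rightarrow>\<^sub>0 'k) = 0" by (intro poly_mapping_eqI) (simp add: lookup_hom_part)
  then show ?case by simp
next
  case (single v a)
  have *: "hom_part n (Poly_Mapping.single v a) = (if length v = n then Poly_Mapping.single v a else 0)"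
    by (intro poly_mapping_eqI) (auto simp: lookup_hom_part lookup_single when_def)
  show ?case
    using fm_homogeneous[of u v p] mset_eq_length[of u v]
    by (cases "mset u = mset v") (auto simp: * fm_single[of _ _ _ a])
qed (simp add: hom_part_add)

text \<open>\<open>P\<close> models the quotient by \<open>S\<close> inside the same type. It serves
  twice: to recognise tensors with a factor in the radical, and to realise cyclic modules.\<close>

lemma exists_projection:
  assumes "pm.subspace (S :: ('a \<Rightarrow>\<^sub>0 'k::field) set)"
  shows "\<exists>P. Vector_Spaces.linear scl scl P \<and> (\<forall>x. P x = 0 \<longleftrightarrow> x \<in> S) \<and> (\<forall>x. x - P x \<in> S)"
proof -
  interpret vector_space_pair "scl :: 'k \<Rightarrow> ('a \<Rightarrow>\<^sub>0 'k) \<Rightarrow> _" "scl :: 'k \<Rightarrow> ('a \<Rightarrow>\<^sub>0 'k) \<Rightarrow> _"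
    by unfold_locales
  obtain B where B: "B \<subseteq> S" "pm.independent B" "S \<subseteq> pm.span B"
    using pm.maximal_independent_subset[of S] by blast
  define B' where "B' = pm.extend_basis B"
  have B': "pm.independent B'" "B \<subseteq> B'" "pm.span B' = UNIV"
    using pm.extend_basis_superset[OF B(2)] pm.independent_extend_basis[OF B(2)]
      pm.span_extend_basis[OF B(2)] by (simp_all add: B'_def)
  define P where "P = construct B' (\<lambda>b. if b \<in> B then 0 else b)"
  have P: "Vector_Spaces.linear scl scl P" unfolding P_def by (rule linear_construct[OF B'(1)])
  interpret P: Vector_Spaces.linear scl scl P by (rule P)
  have Pb: "P b = (if b \<in> B then 0 else b)" if "b \<in> B'" for b
    unfolding P_def by (rule construct_basis[OF B'(1) that])
  have S0: "P x = 0" if "x \<in> S" for x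
  proof (rule P.eq_0_on_span[where b = B])
    show "x \<in> pm.span B" using that B by blast
  qed (use Pb B' in auto)
  have D: "x - P x \<in> S" for x
  proof (rule pm.span_induct_alt[where h = "\<lambda>x. x - P x \<in> S"])
    show "x \<in> pm.span B'" using B'(3) by blast
    show "0 - P 0 \<in> S" using assms by (simp add: pm.subspace_0)
  next
    fix c x y assume step: "x \<in> B'" "y - P y \<in> S"
    have "scl c x + y - P (scl c x + y) = scl c (x - P x) + (y - P y)"
      by (simp add: P.add P.scale pm.scale_right_diff_distrib)
    moreover have "x - P x \<in> S" using Pb[OF step(1)] B(1) assms by (auto simp: pm.subspace_0)
    ultimately show "scl c x + y - P (scl c x + y) \<in> S"
      by (simp only:) (intro pm.subspace_add pm.subspace_scale assms step)
  qed
  have "x \<in> S" if "P x = 0" for x using D[of x] that by simp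
  with P D S0 show ?thesis by blast
qed

lemma lext_mult_const:
  "lext (*) (\<lambda>v. f v * c) t = lext (*) f t * (c :: 'k::field)"
  "lext (*) (\<lambda>v. c * f v) t = c * lext (*) f t"
  by (simp_all add: lext_def sum_distrib_left sum_distrib_right mult_ac)

text \<open>The form is a Hopf pairing: the coproduct is dual to concatenation, with the factors in
  reversed order. Both sides obey the same recursion in the first letter of the word paired
  with.\<close>

lemma coprod_form:
  fixes p :: "'x \<Rightarrow> 'x \<Rightarrow> 'k::field" and d :: "'x \<Rightarrow> 'g::ab_group_add"
  assumes pdc: "\<And>i j. p i j = c j (d i)" and c0: "\<And>x. c x 0 = 1"
  shows "lext (*) (\<lambda>(a, b). fm p u (word a) * fm p u' (word b)) (coprod d c t) = fm p (u' @ u) t"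
proof -
  let ?f = "\<lambda>u u'. lext (*) (\<lambda>(a, b). fm p u (word a) * fm p u' (word b))"
  have wch: "wchar c a (wdeg d [y]) = (\<Prod>s\<leftarrow>a. p y s)" for a y
    by (simp add: wchar_def wdeg_def pdc)
  have w1: "wchar c a (wdeg d []) = 1" for a
    by (induction a) (auto simp: wchar_def wdeg_def c0)
  have bm: "braid_mult d c (Poly_Mapping.single ([y], []) 1 + Poly_Mapping.single ([], [y]) 1)
      (Poly_Mapping.single (a, b) \<kappa>)
    = Poly_Mapping.single (y # a, b) \<kappa> + Poly_Mapping.single (a, y # b) ((\<Prod>s\<leftarrow>a. p y s) * \<kappa>)"
    for y a b \<kappa>
    by (simp add: braid_mult_def tw_mult_add_left tw_mult_single wch w1 plus_list_def)
  \<comment> \<open>The braiding twists by the letters of \<open>a\<close>, \<open>dR_append\<close>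
    by those of \<open>u\<close>; under the pairing the two agree.\<close>
  have tw: "(\<Prod>s\<leftarrow>a. p y s) * fm p u (word a) = (\<Prod>s\<leftarrow>u. p y s) * fm p u (word a)" for a y u
    using fm_TW[of p u y "word a"] by (simp add: fm_single[of _ _ _ "prod_list _"])
  have step: "?f u u' (braid_mult d c (Poly_Mapping.single ([y], []) 1 + Poly_Mapping.single ([], [y]) 1) z)
     = lext (*) (\<lambda>v. ?f v u' z) (dR p y u) + (\<Prod>s\<leftarrow>u. p y s) * lext (*) (\<lambda>v'. ?f u v' z) (dR p y u')"
    for u u' y z
  proof (induction z rule: pm_induct)
    case zero
    show ?case by (simp add: braid_mult_def lext_def)
  next
    case (single ab \<kappa>)
    obtain a b where ab: "ab = (a, b)" by force
    have 1: "fm p u (word (y # a)) = lext (*) (\<lambda>v. fm p v (word a)) (dR p y u)"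
      using fm_mult_left[of p u y "word a"] by (simp add: word_mult)
    have 2: "fm p u' (word (y # b)) = lext (*) (\<lambda>v. fm p v (word b)) (dR p y u')"
      using fm_mult_left[of p u' y "word b"] by (simp add: word_mult)
    have "?f u u' (braid_mult d c (Poly_Mapping.single ([y], []) 1 + Poly_Mapping.single ([], [y]) 1)
        (Poly_Mapping.single ab \<kappa>))
      = \<kappa> * (fm p u (word (y # a)) * fm p u' (word b))
        + (\<Prod>s\<leftarrow>a. p y s) * fm p u (word a) * \<kappa> * fm p u' (word (y # b))"
      by (simp add: ab bm fld.lext_add mult_ac)
    moreover have "fm p u (word a) = 0 \<or> (\<Prod>s\<leftarrow>a. p y s) = (\<Prod>s\<leftarrow>u. p y s)"
      using tw[of y a u] by auto
    ultimately show ?case unfolding 1 2 by (auto simp: ab lext_mult_const mult_ac)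
  next
    case (add x y)
    have "lext (*) (\<lambda>v. f v + h v) t = lext (*) f t + lext (*) h t" for f h :: "'x list \<Rightarrow> 'k" and t
      by (simp add: lext_def sum.distrib distrib_left)
    with add show ?case by (simp add: fld.lext_add algebra_simps braid_mult_def tw_mult_add_right)
  qed
  have lw: "lext (*) f (word u' * s) = lext (*) (\<lambda>v. f (u' @ v)) s"
     "lext (*) f (s * word u') = lext (*) (\<lambda>v. f (v @ u')) s" for f :: "'x list \<Rightarrow> 'k" and u' s
    by (induction s rule: pm_induct)
      (auto simp: fld.lext_add distrib_left distrib_right word_mult_single single_mult_word)
  have W: "?f u u' (word_coprod d c x) = fm p (u' @ u) (word x)" for u u' x
  proof (induction x arbitrary: u u')
    case Nil
    then show ?case by (auto simp: fm_sym[of p _ "[]"] lookup_single when_def)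
  next
    case (Cons y x)
    have "fm p (u' @ u) (word (y # x)) = lext (*) (\<lambda>v. fm p v (word x)) (dR p y (u' @ u))"
      using fm_mult_left[of p "u' @ u" y "word x"] by (simp add: word_mult)
    then show ?case by (simp add: step Cons dR_append fld.lext_add fld.lext_scl lw)
  qed
  have "coprod d c s = lext scl (word_coprod d c) s" for s by (simp add: coprod_def lext_def)
  then show ?thesis
  proof (induction t rule: pm_induct)
    case (single v a)
    then show ?case by (simp add: fld.lext_scl W fm_single[of _ _ _ a])
  qed (simp_all add: pm.lext_add fld.lext_add)
qed

lemma lookup_pure_tensor:
  "Poly_Mapping.lookup (pure_tensor s t) (a, b) = Poly_Mapping.lookup s a * Poly_Mapping.lookup t b"
proof -
  have "Poly_Mapping.lookup (pure_tensor s t) (a, b)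
    = (\<Sum>a'\<in>Poly_Mapping.keys s. \<Sum>b'\<in>Poly_Mapping.keys t.
        (if b' = b then (if a' = a then Poly_Mapping.lookup s a * Poly_Mapping.lookup t b else 0) else 0))"
    unfolding pure_tensor_def lookup_sum
    by (intro sum.cong refl) (auto simp: lookup_single when_def)
  then show ?thesis by (cases "Poly_Mapping.lookup t b = 0") (auto simp: in_keys_iff)
qed

lemma lookup_lext: "Poly_Mapping.lookup (lext scl f t) w = lext (*) (\<lambda>u. Poly_Mapping.lookup (f u) w) t"
  by (simp add: lext_def lookup_sum)

text \<open>The substantial point is the coideal property. By \<open>coprod_form\<close>, the
  coproduct of a radical element pairs to zero with all pairs of words; hence \<open>P\<close>
  applied to both factors kills it, and that kernel is spanned by tensors with a factor in the
  radical. In degree one, pairing with \<open>[i]\<close> is the coefficient of \<open>[i]\<close>,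
  so the radical meets \<open>V\<close> in 0.\<close>

lemma nichols_cond_Rad:
  fixes p :: "'x \<Rightarrow> 'x \<Rightarrow> 'k::field" and d :: "'x \<Rightarrow> 'g::ab_group_add"
  assumes pdc: "\<And>i j. p i j = c j (d i)" and c0: "\<And>x. c x 0 = 1" and p: "\<And>i j. p i j \<noteq> 0"
  shows "nichols_cond d c (Rad p)"
  unfolding nichols_cond_def graded_ideal_def coideal_def
proof (intro conjI ballI allI subspace_Rad)
  fix t assume t: "t \<in> Rad p"
  show "s * t \<in> Rad p" "t * s \<in> Rad p" for s by (rule Rad_ideal[OF p t])+
  show "hom_part n t \<in> Rad p" for n using t by (simp add: Rad_iff fm_hom_part)
  show "Poly_Mapping.lookup t [] = 0" using t Rad_iff[of t p] fm.simps(1)[of p t] by metis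
  obtain P where P: "Vector_Spaces.linear scl scl P" "\<And>x. P x = 0 \<longleftrightarrow> x \<in> Rad p"
      "\<And>x. x - P x \<in> Rad p"
    using exists_projection[OF subspace_Rad[of p]] by blast
  have PL: "P (lext scl f s) = lext scl (\<lambda>x. P (f x)) s" for f :: "_ \<Rightarrow> 'x list \<Rightarrow>\<^sub>0 'k" and s
  proof -
    interpret P: Vector_Spaces.linear scl scl P by fact
    show ?thesis by (simp add: lext_def P.sum P.scale)
  qed
  define z where "z = coprod d c t"
  let ?S = "{pure_tensor s s' |s s'. s \<in> Rad p \<or> s' \<in> Rad p}"
  have fmL: "fm p u (lext scl f s) = lext (*) (\<lambda>x. fm p u (f x)) s" for u f and s :: "'y \<Rightarrow>\<^sub>0 'k"
    by (simp add: lext_def fm_sum)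
  have form0: "lext (*) (\<lambda>(a, b). fm p u (word a) * fm p u' (word b)) z = 0" for u u'
    unfolding z_def coprod_form[where p = p and c = c and d = d, OF pdc c0] using t by (simp add: Rad_iff)
  \<comment> \<open>Pairing the first factor with \<open>u\<close> leaves a vector orthogonal to all
    words, so \<open>P\<close> kills it.\<close>
  have X: "lext scl (\<lambda>(a, b). scl (fm p u (word a)) (P (word b))) z = 0" for u
  proof -
    have "lext scl (\<lambda>(a, b). scl (fm p u (word a)) (word b)) z \<in> Rad p"
      unfolding Rad_iff fmL using form0 by (simp add: case_prod_unfold del: scl_single)
    then have "P (lext scl (\<lambda>(a, b). scl (fm p u (word a)) (word b)) z) = 0" by (simp only: P(2))
    moreover have "P (scl a x) = scl a (P x)" for a x
      using P(1) by (simp add: linear_scl_iff pm.vector_space_axioms)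
    ultimately show ?thesis by (simp only: PL case_prod_unfold)
  qed
  \<comment> \<open>Taking the coordinate \<open>w\<close> in \<open>X\<close> shows that the
    corresponding contraction of the second factor is orthogonal to every \<open>u\<close>; so
    \<open>P\<close> kills it too.\<close>
  have Y: "lext scl (\<lambda>(a, b). scl (Poly_Mapping.lookup (P (word b)) w) (P (word a))) z = 0" for w
  proof -
    have "fm p u (lext scl (\<lambda>(a, b). scl (Poly_Mapping.lookup (P (word b)) w) (word a)) z) = 0" for u
    proof -
      have "Poly_Mapping.lookup (lext scl (\<lambda>(a, b). scl (fm p u (word a)) (P (word b))) z) w = 0"
        unfolding X by simp
      then show ?thesis by (simp add: fmL lookup_lext case_prod_unfold mult.commute del: scl_single)
    qed
    then have "lext scl (\<lambda>(a, b). scl (Poly_Mapping.lookup (P (word b)) w) (word a)) z \<in> Rad p"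
      by (simp add: Rad_iff)
    then have "P (lext scl (\<lambda>(a, b). scl (Poly_Mapping.lookup (P (word b)) w) (word a)) z) = 0"
      by (simp only: P(2))
    moreover have "P (scl a x) = scl a (P x)" for a x
      using P(1) by (simp add: linear_scl_iff pm.vector_space_axioms)
    ultimately show ?thesis by (simp only: PL case_prod_unfold)
  qed
  have Q: "lext scl (\<lambda>(a, b). pure_tensor (P (word a)) (P (word b))) z = 0"
  proof (rule poly_mapping_eqI)
    fix w show "Poly_Mapping.lookup (lext scl (\<lambda>(a, b). pure_tensor (P (word a)) (P (word b))) z) w
      = Poly_Mapping.lookup 0 w"
      using arg_cong[OF Y[of "snd w"], of "\<lambda>x. Poly_Mapping.lookup x (fst w)"]
      by (cases w) (simp add: lookup_lext case_prod_unfold lookup_pure_tensor mult.commute)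
  qed
  have "lext scl (\<lambda>(a, b). pure_tensor (word a) (word b)) s
      - lext scl (\<lambda>(a, b). pure_tensor (P (word a)) (P (word b))) s \<in> pm.span ?S" for s
  proof (induction s rule: pm_induct)
    case zero
    show ?case by (simp add: pm.span_zero)
  next
    case (single ab \<kappa>)
    obtain a b where ab: "ab = (a, b)" by force
    have E: "pure_tensor (word a) (word b) - pure_tensor (P (word a)) (P (word b))
       = pure_tensor (word a - P (word a)) (word b) + pure_tensor (P (word a)) (word b - P (word b))"
    proof (rule poly_mapping_eqI)
      show "Poly_Mapping.lookup (pure_tensor (word a) (word b) - pure_tensor (P (word a)) (P (word b))) w
       = Poly_Mapping.lookup (pure_tensor (word a - P (word a)) (word b)
         + pure_tensor (P (word a)) (word b - P (word b))) w" for w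
        by (cases w) (simp add: lookup_pure_tensor lookup_add lookup_minus algebra_simps)
    qed
    have "pure_tensor (word a - P (word a)) (word b) \<in> ?S"
      "pure_tensor (P (word a)) (word b - P (word b)) \<in> ?S"
      using P(3) by blast+
    then have "pure_tensor (word a) (word b) - pure_tensor (P (word a)) (P (word b)) \<in> pm.span ?S"
      unfolding E by (intro pm.span_add pm.span_base)
    from pm.span_scale[OF this, of \<kappa>] show ?case
      by (simp add: ab pm.scale_right_diff_distrib)
  next
    case (add x y)
    from pm.span_add[OF this] show ?case by (simp add: pm.lext_add algebra_simps)
  qed
  from this[of z] have "lext scl (\<lambda>(a, b). pure_tensor (word a) (word b)) z \<in> pm.span ?S"
    by (simp only: Q diff_0_right)
  moreover have "lext scl (\<lambda>(a, b). pure_tensor (word a) (word b)) s = s" for s :: "'x list \<times> 'x list \<Rightarrow>\<^sub>0 'k"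
  proof (induction s rule: pm_induct)
    case (single ab \<kappa>)
    show ?case
    proof (rule poly_mapping_eqI)
      show "Poly_Mapping.lookup (lext scl (\<lambda>(a, b). pure_tensor (word a) (word b)) (Poly_Mapping.single ab \<kappa>)) w
       = Poly_Mapping.lookup (Poly_Mapping.single ab \<kappa>) w" for w
        by (cases w; cases ab) (auto simp: lookup_pure_tensor lookup_single when_def)
    qed
  qed (simp_all add: pm.lext_add)
  ultimately show "coprod d c t \<in> pm.span ?S" by (simp add: z_def)
next
  show "Rad p \<inter> {t. \<forall>u\<in>Poly_Mapping.keys t. length u = 1} = {0}"
  proof (intro equalityI subsetI)
    fix t assume t: "t \<in> Rad p \<inter> {t. \<forall>u\<in>Poly_Mapping.keys t. length u = 1}"
    have "fm p [i] (word v) = (1 when v = [i])" for i and v :: "'x list"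
    proof (cases "v = [i]")
      case False
      then have "mset [i] \<noteq> mset v" by (metis mset_single_iff mset.simps)
      then have "fm p [i] (word v) = 0" by (rule fm_homogeneous)
      with False show ?thesis by (simp del: fm.simps)
    qed (simp add: lookup_add)
    then have "fm p [i] t = Poly_Mapping.lookup t [i]" for i
      using fm_expand[of p "[i]" t]
      by (simp add: lext_def in_keys_iff when_def if_distrib[where f = "(*) _"] del: fm.simps cong: if_cong)
    moreover have "fm p [i] t = 0" for i using t by (simp add: Rad_iff del: fm.simps)
    ultimately have "Poly_Mapping.lookup t [i] = 0" for i by simp
    moreover have "Poly_Mapping.lookup t u = 0" if "length u \<noteq> 1" for u
    proof (rule ccontr)
      assume "Poly_Mapping.lookup t u \<noteq> 0"
      then have "u \<in> Poly_Mapping.keys t" by (simp add: in_keys_iff)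
      with t that show False by blast
    qed
    ultimately have "Poly_Mapping.lookup t u = 0" for u
      by (cases "length u = 1") (auto simp: length_Suc_conv)
    then show "t \<in> {0}" by (auto intro: poly_mapping_eqI)
  qed (auto simp: pm.subspace_0[OF subspace_Rad])
qed

corollary Rad_subset_nichols_ideal:
  assumes "\<And>i j. p i j = c j (d i)" "\<And>x. c x 0 = 1" "\<And>i j. p i j \<noteq> 0"
  shows "Rad p \<subseteq> nichols_ideal d c"
  by (rule nichols_ideal_largest(2)[OF nichols_cond_Rad]) (use assms in auto)

lemma (in vector_space) lext_diff: "lext scale f (s - t) = lext scale f s - lext scale f t"
  using lext_add[of f "s - t" t] by simp

lemma (in vector_space) lext_sum: "lext scale F (sum f A) = (\<Sum>x\<in>A. lext scale F (f x))"
  by (induction A rule: infinite_finite_induct) (auto simp: lext_add)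

section \<open>The radical for the inverse transposed matrix\<close>

lemma dR_inverse:
  assumes "\<And>i j. p' i j = inverse (p j i)" "\<And>i j. p i j \<noteq> 0"
  shows "dR p' i x = scl ((\<Prod>s\<leftarrow>x. p' i s) / p' i i) (dL p i x)"
  by (induction x) (auto simp: assms lext_simps field_simps)

text \<open>Inverting and transposing the matrix exchanges \<open>dR\<close> and \<open>dL\<close>
  up to a scalar depending on the letters only. So the two forms agree up to reversing
  \<open>u\<close> and a factor depending on \<open>u\<close>. The braiding matrices of
  \<open>V\<close> and \<open>W\<close> are related in this way, which is why one radical serves
  both.\<close>

lemma Rad_subset_inverse:
  fixes p p' :: "'x \<Rightarrow> 'x \<Rightarrow> 'k::field"
  assumes p': "\<And>i j. p' i j = inverse (p j i)" and p: "\<And>i j. p i j \<noteq> 0"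
  shows "Rad p \<subseteq> Rad p'"
proof -
  have *: "\<exists>\<kappa>. \<forall>x. fm p' u (word x) = \<kappa> * fm p (rev u) (word x)" for u
  proof (induction u)
    case (Cons i u)
    then obtain \<kappa> where \<kappa>: "\<And>x. fm p' u (word x) = \<kappa> * fm p (rev u) (word x)" by blast
    let ?c = "\<lambda>x. (\<Prod>s\<leftarrow>x. p' i s) / p' i i"
    have "fm p' (i # u) (word x) = ?c (i # u) * \<kappa> * fm p (rev (i # u)) (word x)" for x
    proof -
      have "fm p' (i # u) (word x) = ?c x * fm p' u (dL p i x)"
        by (simp add: dR_inverse[of p' p, OF assms])
      also have "fm p' u (dL p i x) = lext (*) (\<lambda>v. \<kappa> * fm p (rev u) (word v)) (dL p i x)"
        by (subst fm_expand) (simp only: \<kappa>)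
      also have "\<dots> = \<kappa> * fm p (rev u) (dL p i x)"
        by (simp add: lext_mult_const(2) fm_expand[of p "rev u" "dL p i x"])
      also have "fm p (rev u) (dL p i x) = fm p (rev (i # u)) (word x)"
        by (simp add: fm_snoc[OF p])
      finally have 1: "fm p' (i # u) (word x) = ?c x * (\<kappa> * fm p (rev (i # u)) (word x))" .
      \<comment> \<open>The scalar is read off \<open>x\<close> but must be the same for all
        \<open>x\<close>; words with other letters pair to 0, and for the remaining ones it can be
        read off \<open>i # u\<close>.\<close>
      show ?thesis
      proof (cases "mset (rev (i # u)) = mset x")
        case True
        then have "mset (i # u) = mset x" by simp
          then have "mset (map (p' i) (i # u)) = mset (map (p' i) x)" by (simp only: mset_map)
        then have "?c x = ?c (i # u)" by (metis prod_mset_prod_list)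
        then show ?thesis unfolding 1 by (simp only: mult.assoc)
      next
        case False
        then show ?thesis unfolding 1 using fm_homogeneous[OF False, of p] by (simp only: mult_zero_right)
      qed
    qed
    then show ?case by blast
  qed (auto intro: exI[of _ 1])
  show ?thesis
  proof
    fix t assume t: "t \<in> Rad p"
    have "fm p' u t = 0" for u
    proof -
      obtain \<kappa> where \<kappa>: "\<And>x. fm p' u (word x) = \<kappa> * fm p (rev u) (word x)" using * by blast
      have "fm p' u t = lext (*) (\<lambda>v. \<kappa> * fm p (rev u) (word v)) t"
        by (subst fm_expand) (simp only: \<kappa>)
      also have "\<dots> = \<kappa> * fm p (rev u) t"
        by (simp add: lext_mult_const(2) fm_expand[of p "rev u" t])
      finally show ?thesis using t by (simp add: Rad_iff)
    qed
    then show "t \<in> Rad p'" by (simp add: Rad_iff)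
  qed
qed

section \<open>Quantum Serre elements: iterated braided commutators of \<open>i\<close> with
  \<open>j\<close>\<close>

primrec serre :: "('x \<Rightarrow> 'x \<Rightarrow> 'k::field) \<Rightarrow> 'x \<Rightarrow> 'x \<Rightarrow> nat \<Rightarrow> ('x list \<Rightarrow>\<^sub>0 'k)" where
  "serre p i j 0 = word [j]"
| "serre p i j (Suc n) = word [i] * serre p i j n - scl (p i i ^ n * p i j) (serre p i j n * word [i])"

lemma lookup_mult_Nil:
  "Poly_Mapping.lookup (word [y] * t) [] = (0::'k::comm_ring_1)"
  "Poly_Mapping.lookup (t * word [y]) [] = (0::'k::comm_ring_1)"
proof -
  have "[] \<notin> Poly_Mapping.keys (word [y] * t)" "[] \<notin> Poly_Mapping.keys (t * word [y])"
    using keys_mult[of "word [y]" t] keys_mult[of t "word [y]"] by (auto simp: plus_list_def)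
  then show "Poly_Mapping.lookup (word [y] * t) [] = 0" "Poly_Mapping.lookup (t * word [y]) [] = 0"
    by (simp_all add: in_keys_iff)
qed

lemma TW_mult_right: "TW p i (t * word [y]) = scl (p i y) (TW p i t * word [y])"
  by (induction t rule: pm_induct)
    (auto simp: lext_simps single_mult_word mult_ac)

lemma TW_serre: "TW p k (serre p i j n) = scl (p k i ^ n * p k j) (serre p i j n)"
  by (induction n)
    (simp_all add: pm.lext_diff pm.lext_scl TW_mult TW_mult_right scl_mult_left[symmetric]
      scl_mult_right[symmetric] pm.scale_right_diff_distrib mult_ac)

text \<open>The coefficient in the commutator is exactly the twist from \<open>TW_serre\<close>, so
  the derivation by \<open>i\<close> vanishes. The derivation by \<open>j\<close> collects one
  factor per commutator; as soon as one of these is 0, all derivations vanish and the element lies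
  in the radical.\<close>

lemma DR_serre:
  assumes "i \<noteq> j"
  shows "DR p k (serre p i j n) =
    (if k = j then scl (\<Prod>m<n. 1 - p i i ^ m * p i j * p j i) (word (replicate n i)) else 0)"
proof (induction n arbitrary: k)
  case (Suc n)
  have w: "word [i] * word (replicate n i) = (word (replicate n i) * word [i] :: _ \<Rightarrow>\<^sub>0 'b)"
    by (simp add: word_mult replicate_append_same)
  have i: "DR p i (serre p i j (Suc n)) = 0" using Suc assms
    by (simp add: pm.lext_diff pm.lext_scl DR_mult DR_mult_right TW_serre)
  have "DR p j (serre p i j (Suc n)) = scl (\<Prod>m<Suc n. 1 - p i i ^ m * p i j * p j i) (word (replicate (Suc n) i))"
  proof -
    let ?c = "\<Prod>m<n. 1 - p i i ^ m * p i j * p j i"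
    have "DR p j (serre p i j (Suc n)) =
       scl ?c (word [i] * word (replicate n i)) - scl (p i i ^ n * p i j * p j i * ?c) (word (replicate n i) * word [i])"
      using Suc assms by (simp add: pm.lext_diff pm.lext_scl DR_mult DR_mult_right
        scl_mult_left[symmetric] scl_mult_right[symmetric] mult_ac del: scl_single)
    also have "\<dots> = scl (?c - p i i ^ n * p i j * p j i * ?c) (word [i] * word (replicate n i))"
      unfolding w by (simp only: pm.scale_left_diff_distrib)
    also have "?c - p i i ^ n * p i j * p j i * ?c = (\<Prod>m<Suc n. 1 - p i i ^ m * p i j * p j i)"
      by (simp add: algebra_simps)
    finally show ?thesis by (simp add: word_mult)
  qed
  moreover have "DR p k (serre p i j (Suc n)) = 0" if "k \<noteq> i" "k \<noteq> j"
    using that Suc by (simp add: pm.lext_diff pm.lext_scl DR_mult DR_mult_right)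
  ultimately show ?case using i assms by (cases "k = i"; cases "k = j") (simp_all only: if_True if_False refl)
qed (use assms in auto)

lemma serre_in_Rad:
  assumes "i \<noteq> j" and "p i i ^ n * p i j * p j i = 1"
  shows "serre p i j (Suc n) \<in> Rad p"
proof -
  have "(\<Prod>m<Suc n. 1 - p i i ^ m * p i j * p j i) = 0" using assms by simp
  then have "DR p k (serre p i j (Suc n)) = 0" for k
    unfolding DR_serre[OF assms(1)] by (simp only: pm.scale_zero_left if_cancel)
  then have "fm p u (serre p i j (Suc n)) = 0" for u
    by (cases u) (simp_all add: lookup_minus lookup_mult_Nil del: serre.simps(2), simp add: lookup_minus lookup_mult_Nil)
  then show ?thesis by (simp add: Rad_iff)
qed

section \<open>The canonical element\<close>

abbreviation Wd :: "'x multiset \<Rightarrow> 'x list set" where "Wd \<equiv> permutations_of_multiset"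

lemma Wd_iff: "u \<in> Wd \<beta> \<longleftrightarrow> mset u = \<beta>"
  by (auto simp: permutations_of_multiset_def)

text \<open>For the Gram matrix G in degree \<open>\<beta>\<close> this is G \<theta> G = G. The
  form can be degenerate, so \<theta> is an inverse only modulo the radical.\<close>

definition gram_inverse :: "('x \<Rightarrow> 'x \<Rightarrow> 'k::field) \<Rightarrow> 'x multiset \<Rightarrow> ('x list \<Rightarrow> 'x list \<Rightarrow> 'k) \<Rightarrow> bool" where
  "gram_inverse p \<beta> \<theta> \<longleftrightarrow> (\<forall>x\<in>Wd \<beta>. \<forall>y\<in>Wd \<beta>.
     (\<Sum>(a, b)\<in>Wd \<beta> \<times> Wd \<beta>. fm p x (word a) * \<theta> a b * fm p b (word y)) = fm p x (word y))"

lemma gram_inverse_transpose: "gram_inverse p \<beta> \<theta> \<Longrightarrow> gram_inverse p \<beta> (\<lambda>a b. \<theta> b a)"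
proof -
  assume *: "gram_inverse p \<beta> \<theta>"
  show ?thesis unfolding gram_inverse_def
  proof (intro ballI)
    fix x y assume "x \<in> Wd \<beta>" "y \<in> Wd \<beta>"
    then have "(\<Sum>(a, b)\<in>Wd \<beta> \<times> Wd \<beta>. fm p y (word a) * \<theta> a b * fm p b (word x)) = fm p y (word x)"
      using * by (simp add: gram_inverse_def)
    moreover have "(\<Sum>(a, b)\<in>Wd \<beta> \<times> Wd \<beta>. fm p x (word a) * \<theta> b a * fm p b (word y)) =
       (\<Sum>(a, b)\<in>Wd \<beta> \<times> Wd \<beta>. fm p y (word a) * \<theta> a b * fm p b (word x))"
      by (subst sum.cartesian_product[symmetric], subst sum.swap, subst sum.cartesian_product)
        (auto intro!: sum.cong simp: fm_sym[of p x] fm_sym[of p y] mult_ac)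
    ultimately show "(\<Sum>(a, b)\<in>Wd \<beta> \<times> Wd \<beta>. fm p x (word a) * \<theta> b a * fm p b (word y)) = fm p x (word y)"
      by (simp add: fm_sym[of p x])
  qed
qed

text \<open>\<open>f\<close> is the Gram matrix as an endomorphism, and a linear right inverse
  \<open>h\<close> of \<open>f\<close> on its image satisfies f h f = f.\<close>

lemma gram_inverse_exists:
  fixes p :: "'x \<Rightarrow> 'x \<Rightarrow> 'k::field"
  shows "\<exists>\<theta>. gram_inverse p \<beta> \<theta>"
proof -
  interpret vector_space_pair "scl :: 'k \<Rightarrow> ('x list \<Rightarrow>\<^sub>0 'k) \<Rightarrow> _" "scl :: 'k \<Rightarrow> ('x list \<Rightarrow>\<^sub>0 'k) \<Rightarrow> _"
    by unfold_locales
  let ?W = "Wd \<beta>"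
  have fin: "finite ?W" by simp
  define f where "f = (\<lambda>x. \<Sum>v\<in>?W. scl (fm p v x) (word v))"
  have f: "Vector_Spaces.linear scl scl f"
    by (simp add: linear_scl_iff pm.vector_space_axioms f_def sum.distrib
      scale_left_distrib pm.scale_left_distrib pm.scale_sum_right del: scl_single)
  let ?V = "pm.span (word ` ?W) :: ('x list \<Rightarrow>\<^sub>0 'k) set"
  obtain h where h: "range h \<subseteq> ?V" "Vector_Spaces.linear scl scl h" "\<And>v. v \<in> f ` ?V \<Longrightarrow> f (h v) = v"
    using linear_exists_right_inverse_on[OF f pm.subspace_span] by blast
  interpret h: Vector_Spaces.linear scl scl h by fact
  have keys: "Poly_Mapping.keys t \<subseteq> ?W" if "t \<in> ?V" for t
    using that
  proof (induction rule: pm.span_induct_alt)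
    case (step c x y)
    then show ?case using Poly_Mapping.keys_add[of "scl c x" y] by (auto split: if_splits)
  qed auto
  define \<theta> where "\<theta> = (\<lambda>a b. Poly_Mapping.lookup (h (word a)) b)"
  have fmh: "fm p y (h (word a)) = (\<Sum>b\<in>?W. \<theta> a b * fm p y (word b))" for y a
    by (subst fm_expand, subst fld.lext_superset[OF fin keys]) (use h(1) in \<open>auto simp: \<theta>_def\<close>)
  have "(\<Sum>(a, b)\<in>?W \<times> ?W. fm p x (word a) * \<theta> a b * fm p b (word y)) = fm p x (word y)"
    if "x \<in> ?W" "y \<in> ?W" for x y
  proof -
    have lf: "fm p w (f s) = (\<Sum>v\<in>?W. fm p v s * fm p w (word v))" for w s
      by (simp add: f_def fm_sum del: scl_single)
    have co: "Poly_Mapping.lookup (f s) y = fm p y s" for s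
      using that fin by (simp add: f_def lookup_sum lookup_single when_def)
    have "f (h (f (word x))) = f (word x)" using that by (intro h(3) imageI pm.span_base)
    then have "fm p y (h (f (word x))) = fm p y (word x)" by (metis co)
    moreover have "h (f (word x)) = (\<Sum>a\<in>?W. scl (fm p a (word x)) (h (word a)))"
      by (simp add: f_def h.sum h.scale del: scl_single)
    ultimately have "(\<Sum>a\<in>?W. \<Sum>b\<in>?W. fm p a (word x) * (\<theta> a b * fm p y (word b))) = fm p y (word x)"
      by (simp add: fm_sum fmh sum_distrib_left)
    then show ?thesis
      by (simp add: sum.cartesian_product[symmetric] fm_sym[of p x] fm_sym[of p _ "y"] mult.assoc)
  qed
  then show ?thesis unfolding gram_inverse_def by blast
qed

definition theta :: "('x \<Rightarrow> 'x \<Rightarrow> 'k::field) \<Rightarrow> 'x multiset \<Rightarrow> 'x list \<Rightarrow> 'x list \<Rightarrow> 'k" where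
  "theta p \<beta> = (SOME \<theta>. gram_inverse p \<beta> \<theta>)"

lemma gram_inverse_theta: "gram_inverse p \<beta> (theta p \<beta>)"
  unfolding theta_def by (rule someI_ex[OF gram_inverse_exists])

context vector_space
begin

text \<open>Reproducing property: \<open>t\<close> and its expansion \<open>s\<close> through
  \<theta> differ by an element of the radical, which \<open>F\<close> does not see.\<close>

lemma lext_gram_inverse:
  assumes \<theta>: "gram_inverse p \<beta> \<theta>" and t: "Poly_Mapping.keys t \<subseteq> Wd \<beta>"
    and F: "\<And>r. r \<in> Rad p \<Longrightarrow> lext scale F r = 0"
  shows "lext scale F t = (\<Sum>(a, b)\<in>Wd \<beta> \<times> Wd \<beta>. scale (\<theta> a b * fm p b t) (F a))"
proof -
  let ?W = "Wd \<beta>"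
  define s where "s = (\<Sum>(a, b)\<in>?W \<times> ?W. Poly_Mapping.single a (\<theta> a b * fm p b t))"
  have fmt: "fm p y t = (\<Sum>x\<in>?W. Poly_Mapping.lookup t x * fm p y (word x))" for y
    by (subst fm_expand, subst fld.lext_superset[OF _ t]) auto
  have fms: "fm p y s = (\<Sum>(a, b)\<in>?W \<times> ?W. \<theta> a b * fm p b t * fm p y (word a))" for y
    by (simp add: s_def fm_sum case_prod_unfold fm_single[of _ _ _ "_ * _"])
  have "fm p y t = fm p y s" for y
  proof (cases "y \<in> ?W")
    case True
    have "fm p y t = (\<Sum>x\<in>?W. \<Sum>(a, b)\<in>?W \<times> ?W.
        Poly_Mapping.lookup t x * (fm p y (word a) * \<theta> a b * fm p b (word x)))"
      unfolding fmt using \<theta> True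
      by (intro sum.cong refl) (simp add: gram_inverse_def case_prod_unfold flip: sum_distrib_left)
    also have "\<dots> = fm p y s"
      unfolding fms fmt by (subst sum.swap) (auto intro!: sum.cong simp: sum_distrib_left sum_distrib_right mult_ac)
    finally show ?thesis .
  next
    case False
    then have z: "fm p y (word x) = 0" if "x \<in> ?W" for x
      using that by (intro fm_homogeneous) (auto simp: Wd_iff)
    have "fm p y t = 0" unfolding fmt using z by simp
    moreover have "fm p y s = 0" unfolding fms by (rule sum.neutral) (auto simp: z)
    ultimately show ?thesis by simp
  qed
  then have "t - s \<in> Rad p" by (simp add: Rad_iff)
  from F[OF this] have "lext scale F t = lext scale F s" by (simp add: lext_diff)
  also have "lext scale F s = (\<Sum>(a, b)\<in>?W \<times> ?W. scale (\<theta> a b * fm p b t) (F a))"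
    by (simp add: s_def case_prod_unfold lext_sum)
  finally show ?thesis .
qed

text \<open>For the canonical elements C and C' of the two degrees this reads (A \<otimes> 1) C = (1
  \<otimes> A') C', seen through a bilinear \<open>B\<close> that vanishes on the radical in each
  argument. Expand \<open>A a\<close> through \<theta>', exchange the sums, and contract \<theta>
  with the adjoint.\<close>

lemma canonical_adjoint:
  assumes \<theta>: "gram_inverse p \<beta> \<theta>" and \<theta>': "gram_inverse p \<beta>' \<theta>'"
    and A: "\<And>a. a \<in> Wd \<beta> \<Longrightarrow> Poly_Mapping.keys (A a) \<subseteq> Wd \<beta>'"
    and A': "\<And>b. b \<in> Wd \<beta>' \<Longrightarrow> Poly_Mapping.keys (A' b) \<subseteq> Wd \<beta>"
    and adj: "\<And>a b. fm p b (A a) = fm p a (A' b)"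
    and B1: "\<And>r b. r \<in> Rad p \<Longrightarrow> lext scale (\<lambda>a. B a b) r = 0"
    and B2: "\<And>r a. r \<in> Rad p \<Longrightarrow> lext scale (B a) r = 0"
  shows "(\<Sum>(a, b)\<in>Wd \<beta> \<times> Wd \<beta>. scale (\<theta> a b) (lext scale (\<lambda>a'. B a' b) (A a)))
    = (\<Sum>(a, b)\<in>Wd \<beta>' \<times> Wd \<beta>'. scale (\<theta>' a b) (lext scale (B a) (A' b)))"
proof -
  have "(\<Sum>(a, b)\<in>Wd \<beta> \<times> Wd \<beta>. scale (\<theta> a b) (lext scale (\<lambda>a'. B a' b) (A a)))
    = (\<Sum>(a, b)\<in>Wd \<beta> \<times> Wd \<beta>. \<Sum>(a', b')\<in>Wd \<beta>' \<times> Wd \<beta>'. scale (\<theta> a b * \<theta>' a' b' * fm p b' (A a)) (B a' b))"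
    by (intro sum.cong refl) (auto simp: lext_gram_inverse[OF \<theta>' A B1] scale_sum_right mult.assoc intro!: sum.cong)
  also have "\<dots> = (\<Sum>(a', b')\<in>Wd \<beta>' \<times> Wd \<beta>'. \<Sum>(a, b)\<in>Wd \<beta> \<times> Wd \<beta>. scale (\<theta> a b * \<theta>' a' b' * fm p b' (A a)) (B a' b))"
    unfolding case_prod_unfold by (rule sum.swap)
  also have "\<dots> = (\<Sum>(a, b)\<in>Wd \<beta>' \<times> Wd \<beta>'. scale (\<theta>' a b) (lext scale (B a) (A' b)))"
  proof (intro sum.cong refl)
    fix x assume "x \<in> Wd \<beta>' \<times> Wd \<beta>'"
    then obtain a' b' where x: "x = (a', b')" "b' \<in> Wd \<beta>'" by auto
    have "lext scale (B a') (A' b') = (\<Sum>(b, a)\<in>Wd \<beta> \<times> Wd \<beta>. scale (\<theta> a b * fm p a (A' b')) (B a' b))"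
      by (rule lext_gram_inverse[OF gram_inverse_transpose[OF \<theta>] A'[OF x(2)] B2])
    also have "\<dots> = (\<Sum>(a, b)\<in>Wd \<beta> \<times> Wd \<beta>. scale (\<theta> a b * fm p b' (A a)) (B a' b))"
      by (subst (1 2) sum.cartesian_product[symmetric], subst sum.swap) (simp add: adj)
    finally show "(case x of (a', b') \<Rightarrow> \<Sum>(a, b)\<in>Wd \<beta> \<times> Wd \<beta>. scale (\<theta> a b * \<theta>' a' b' * fm p b' (A a)) (B a' b))
      = (case x of (a, b) \<Rightarrow> scale (\<theta>' a b) (lext scale (B a) (A' b)))"
      by (simp add: x(1) scale_sum_right case_prod_unfold mult_ac)
  qed
  finally show ?thesis .
qed

text \<open>The adjoint pairs are \<open>dL\<close> with right and \<open>dR\<close> with left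
  multiplication, placed on either tensor factor. The second factor is reached by transposing
  \<open>theta\<close>.\<close>

lemma canonical:
  assumes p: "\<And>i j. p i j \<noteq> 0"
    and B1: "\<And>r b. r \<in> Rad p \<Longrightarrow> lext scale (\<lambda>a. B a b) r = 0"
    and B2: "\<And>r a. r \<in> Rad p \<Longrightarrow> lext scale (B a) r = 0"
  shows "(\<Sum>(a, b)\<in>Wd (add_mset i \<beta>) \<times> Wd (add_mset i \<beta>).
      scale (theta p (add_mset i \<beta>) a b) (lext scale (\<lambda>a'. B a' b) (dL p i a)))
    = (\<Sum>(a, b)\<in>Wd \<beta> \<times> Wd \<beta>. scale (theta p \<beta> a b) (B a (b @ [i])))" (is ?L1)
   and "(\<Sum>(a, b)\<in>Wd (add_mset i \<beta>) \<times> Wd (add_mset i \<beta>).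
      scale (theta p (add_mset i \<beta>) a b) (lext scale (\<lambda>a'. B a' b) (dR p i a)))
    = (\<Sum>(a, b)\<in>Wd \<beta> \<times> Wd \<beta>. scale (theta p \<beta> a b) (B a (i # b)))" (is ?R1)
   and "(\<Sum>(a, b)\<in>Wd (add_mset i \<beta>) \<times> Wd (add_mset i \<beta>).
      scale (theta p (add_mset i \<beta>) a b) (lext scale (B a) (dL p i b)))
    = (\<Sum>(a, b)\<in>Wd \<beta> \<times> Wd \<beta>. scale (theta p \<beta> a b) (B (a @ [i]) b))" (is ?L2)
   and "(\<Sum>(a, b)\<in>Wd (add_mset i \<beta>) \<times> Wd (add_mset i \<beta>).
      scale (theta p (add_mset i \<beta>) a b) (lext scale (B a) (dR p i b)))
    = (\<Sum>(a, b)\<in>Wd \<beta> \<times> Wd \<beta>. scale (theta p \<beta> a b) (B (i # a) b))" (is ?R2)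
proof -
  note ca = canonical_adjoint[where p = p and \<beta> = "add_mset i \<beta>" and \<beta>' = \<beta>]
  have kL: "Poly_Mapping.keys (dL p i a) \<subseteq> Wd \<beta>" "Poly_Mapping.keys (dR p i a) \<subseteq> Wd \<beta>"
    if "a \<in> Wd (add_mset i \<beta>)" for a
    using that by (auto simp: Wd_iff dest!: keys_dL keys_dR)
  have kA: "Poly_Mapping.keys (word (b @ [i]) :: _ \<Rightarrow>\<^sub>0 'a) \<subseteq> Wd (add_mset i \<beta>)"
    "Poly_Mapping.keys (word (i # b) :: _ \<Rightarrow>\<^sub>0 'a) \<subseteq> Wd (add_mset i \<beta>)" if "b \<in> Wd \<beta>" for b
    using that by (auto simp: Wd_iff)
  have adj: "fm p b (dL p i a) = fm p a (word (b @ [i]))" "fm p b (dR p i a) = fm p a (word (i # b))" for a b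
    using fm_sym[of p a "b @ [i]"] fm_sym[of p a "i # b"] by (simp_all add: fm_snoc[OF p])
  note th = gram_inverse_theta[of p]
  note tt = gram_inverse_transpose[OF gram_inverse_theta[of p]]
  show ?L1 using ca[OF th th kL(1) kA(1) adj(1) B1 B2] by simp
  show ?R1 using ca[OF th th kL(2) kA(2) adj(2) B1 B2] by simp
  have sw: "(\<Sum>(a, b)\<in>X \<times> X. f a b) = (\<Sum>(a, b)\<in>X \<times> X. f b a)" for X and f :: "'y \<Rightarrow> 'y \<Rightarrow> 'b"
    by (subst (1 2) sum.cartesian_product[symmetric], subst sum.swap) (rule refl)
  have "(\<Sum>(a, b)\<in>Wd (add_mset i \<beta>) \<times> Wd (add_mset i \<beta>).
      scale (theta p (add_mset i \<beta>) b a) (lext scale (\<lambda>a'. B b a') (dL p i a)))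
    = (\<Sum>(a, b)\<in>Wd \<beta> \<times> Wd \<beta>. scale (theta p \<beta> b a) (lext scale (\<lambda>b. B b a) (word (b @ [i]))))"
    by (rule ca[OF tt tt kL(1) kA(1) adj(1), where B = "\<lambda>a b. B b a"]) (auto simp: B1 B2)
  then show ?L2 by (subst (1 2) sw) simp
  have "(\<Sum>(a, b)\<in>Wd (add_mset i \<beta>) \<times> Wd (add_mset i \<beta>).
      scale (theta p (add_mset i \<beta>) b a) (lext scale (\<lambda>a'. B b a') (dR p i a)))
    = (\<Sum>(a, b)\<in>Wd \<beta> \<times> Wd \<beta>. scale (theta p \<beta> b a) (lext scale (\<lambda>b. B b a) (word (i # b))))"
    by (rule ca[OF tt tt kL(2) kA(2) adj(2), where B = "\<lambda>a b. B b a"]) (auto simp: B1 B2)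
  then show ?R2 by (subst (1 2) sw) simp
qed

end

section \<open>Representations on a vector space\<close>

text \<open>The braiding matrix of \<open>W\<close>: \<open>L i\<close> acts on \<open>w j\<close>
  by the inverse of \<open>chr D j (elL D i)\<close>, which equals \<open>q D j i\<close> in a
  reduced datum.\<close>

abbreviation pW :: "('g::ab_group_add, 'i::finite, 'k::field) yd_datum \<Rightarrow> 'i \<Rightarrow> 'i \<Rightarrow> 'k" where
  "pW D i j \<equiv> inverse (q D j i)"

abbreviation KL :: "('g::ab_group_add, 'i::finite, 'k::field) yd_datum \<Rightarrow> 'i \<Rightarrow> 'g" where
  "KL D i \<equiv> elK D i + elL D i"

text \<open>
  The operators \<open>g h\<close> of \<open>\<Gamma>\<close> need not be invertible: \<open>g 0\<close> is merely idempotent, so that a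
  quotient of the regular module can be realised on the whole type of which it is a complement.
\<close>

locale U_rep = vector_space scale
  for scale :: "'k::field \<Rightarrow> 'v::ab_group_add \<Rightarrow> 'v" (infixr "*s" 75) +
  fixes D :: "('g::ab_group_add, 'i::finite, 'k) yd_datum" and l :: "'i \<Rightarrow> 'k"
    and e w :: "'i \<Rightarrow> 'v \<Rightarrow> 'v" and g :: "'g \<Rightarrow> 'v \<Rightarrow> 'v"
  assumes rd: "reduced_datum D" and lp: "linking_parameter l"
    and e_add: "e i (x + y) = e i x + e i y" and e_scale: "e i (a *s x) = a *s e i x"
    and w_add: "w i (x + y) = w i x + w i y" and w_scale: "w i (a *s x) = a *s w i x"
    and g_add: "g h (x + y) = g h x + g h y" and g_scale: "g h (a *s x) = a *s g h x"
    and g_e: "g h (e i x) = chr D i h *s e i (g h x)"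
    and g_w: "g h (w i x) = inverse (chr D i h) *s w i (g h x)"
    and g_g: "g h (g h' x) = g (h + h') x"
    and g0_e: "g 0 (e i x) = e i x" and g0_w: "g 0 (w i x) = w i x"
    and link: "e i (w j x) = inverse (q D i j) *s w j (e i x)
      + (if i = j then l i *s (g (KL D i) x - g 0 x) else 0)"
    and nicV: "t \<in> nichols_ideal (elK D) (chr D) \<Longrightarrow> lext scale (\<lambda>u. foldr e u x) t = 0"
    and nicW: "t \<in> nichols_ideal (elL D) (\<lambda>i g. inverse (chr D i g)) \<Longrightarrow> lext scale (\<lambda>u. foldr w u x) t = 0"
begin

lemma chr_char: "character (chr D i)" using rd by (simp add: reduced_datum_def)

lemma chr_0 [simp]: "chr D i 0 = 1" and chr_add: "chr D i (h + h') = chr D i h * chr D i h'"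
  using chr_char[of i] by (simp_all add: character_def)

lemma chr_nz [simp]: "chr D i h \<noteq> 0"
  using chr_add[of i h "- h"] by auto

lemma q_nz [simp]: "q D i j \<noteq> 0" by (simp add: q_def)

lemma chr_K: "chr D j (elK D i) = q D i j" by (simp add: q_def)
lemma chr_L: "chr D j (elL D i) = q D j i" using rd by (simp add: q_def reduced_datum_def)
lemma chr_KL: "chr D j (KL D i) = q D i j * q D j i" by (simp add: chr_add chr_K chr_L)

lemma pW_nz: "pW D i j \<noteq> 0" by simp

lemma l_nz [simp]: "l i \<noteq> 0" using lp by (simp add: linking_parameter_def)

lemma e_0 [simp]: "e i 0 = 0" using e_scale[of i 0 0] by simp
lemma w_0 [simp]: "w i 0 = 0" using w_scale[of i 0 0] by simp
lemma g_0 [simp]: "g h 0 = 0" using g_scale[of h 0 0] by simp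
lemma e_diff: "e i (x - y) = e i x - e i y" using e_add[of i "x - y" y] by simp
lemma w_diff: "w i (x - y) = w i x - w i y" using w_add[of i "x - y" y] by simp
lemma g_diff: "g h (x - y) = g h x - g h y" using g_add[of h "x - y" y] by simp
lemma e_sum: "e i (sum f A) = (\<Sum>x\<in>A. e i (f x))"
  by (induction A rule: infinite_finite_induct) (auto simp: e_add)
lemma w_sum: "w i (sum f A) = (\<Sum>x\<in>A. w i (f x))"
  by (induction A rule: infinite_finite_induct) (auto simp: w_add)
lemma g_sum: "g h (sum f A) = (\<Sum>x\<in>A. g h (f x))"
  by (induction A rule: infinite_finite_induct) (auto simp: g_add)

lemma fe_linear: "foldr e u (x + y) = foldr e u x + foldr e u y" "foldr e u (a *s x) = a *s foldr e u x"
  "foldr e u 0 = 0"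
  by (induction u) (auto simp: e_add e_scale)
lemma fw_linear: "foldr w u (x + y) = foldr w u x + foldr w u y" "foldr w u (a *s x) = a *s foldr w u x"
  "foldr w u 0 = 0"
  by (induction u) (auto simp: w_add w_scale)
lemma fw_diff: "foldr w u (x - y) = foldr w u x - foldr w u y"
  by (induction u) (auto simp: w_diff)
abbreviation evE where "evE t x \<equiv> lext scale (\<lambda>u. foldr e u x) t"
abbreviation evW where "evW t x \<equiv> lext scale (\<lambda>u. foldr w u x) t"

lemma evE_mult: "evE (word [y] * t) x = e y (evE t x)"
  by (induction t rule: pm_induct)
    (simp_all add: distrib_left lext_add e_add word_mult_single e_scale)
lemma evW_mult: "evW (word [y] * t) x = w y (evW t x)"
  by (induction t rule: pm_induct)
    (simp_all add: distrib_left lext_add w_add word_mult_single w_scale)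

lemma radW: "r \<in> Rad (pW D) \<Longrightarrow> evW r x = 0"
proof (rule nicW)
  assume "r \<in> Rad (pW D)"
  moreover have "Rad (pW D) \<subseteq> nichols_ideal (elL D) (\<lambda>i g. inverse (chr D i g))"
    by (rule Rad_subset_nichols_ideal) (simp_all add: chr_L)
  ultimately show "r \<in> nichols_ideal (elL D) (\<lambda>i g. inverse (chr D i g))" by blast
qed

text \<open>\<open>q D\<close> is the inverse transpose of \<open>pW D\<close>, so the radical
  belonging to \<open>W\<close> also acts by zero through the \<open>e i\<close>.\<close>

lemma radE: "r \<in> Rad (pW D) \<Longrightarrow> evE r x = 0"
proof (rule nicV)
  assume "r \<in> Rad (pW D)"
  moreover have "Rad (pW D) \<subseteq> Rad (q D)" by (rule Rad_subset_inverse) simp_all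
  moreover have "Rad (q D) \<subseteq> nichols_ideal (elK D) (chr D)"
    by (rule Rad_subset_nichols_ideal) (simp_all add: chr_K)
  ultimately show "r \<in> nichols_ideal (elK D) (chr D)" by blast
qed

lemma g_fw: "g (KL D i) (foldr w a x) = (\<Prod>s\<leftarrow>a. inverse (q D i s * q D s i)) *s foldr w a (g (KL D i) x)"
  by (induction a) (simp_all add: g_w chr_KL w_scale mult_ac)

lemma g0_fw: "foldr w a (g 0 x) = g 0 (foldr w a x)"
  by (induction a) (simp_all add: g_w)

lemma g0_fe: "foldr e a (g 0 x) = g 0 (foldr e a x)"
  by (induction a) (simp_all add: g_e)

definition kap :: "'i \<Rightarrow> 'i list \<Rightarrow> 'k" where "kap i a = (\<Prod>s\<leftarrow>a. inverse (q D i s))"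
definition kap' :: "'i \<Rightarrow> 'i list \<Rightarrow> 'k" where "kap' i a = (\<Prod>s\<leftarrow>a. inverse (q D s i))"

lemma kap_simps [simp]: "kap i [] = 1" "kap i (s # a) = inverse (q D i s) * kap i a"
  "kap' i [] = 1" "kap' i (s # a) = inverse (q D s i) * kap' i a"
  by (simp_all add: kap_def kap'_def)

lemma prod_kap: "(\<Prod>s\<leftarrow>a. inverse (q D i s * q D s i)) = kap i a * kap' i a"
  by (induction a) simp_all

lemma prod_kap': "(\<Prod>s\<leftarrow>a. inverse (q D s i)) = kap' i a"
  by (simp add: kap'_def)

text \<open>Each letter \<open>i\<close> that \<open>e i\<close> meets leaves the difference of
  \<open>g (KL D i)\<close> and \<open>g 0\<close>. Moving the group element right through the
  remaining letters produces the weights of \<open>dR\<close>; the other term has only the weights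
  of the letters already passed, those of \<open>dL\<close>. The constant
  \<open>kap i a * q D i i\<close> is \<open>kap\<close> of \<open>a\<close> with one
  \<open>i\<close> deleted.\<close>

lemma e_word:
  "e i (foldr w a x) = kap i a *s foldr w a (e i x)
    + l i *s ((kap i a * q D i i) *s evW (dR (pW D) i a) (g (KL D i) x) - evW (dL (pW D) i a) (g 0 x))"
proof (induction a)
  case (Cons y a)
  let ?R = "evW (dR (pW D) i a) (g (KL D i) x)" and ?L = "evW (dL (pW D) i a) (g 0 x)"
  let ?d = "if i = y then 1 else 0 :: 'k"
  have R: "evW (dR (pW D) i (y # a)) (g (KL D i) x) = w y ?R + (?d * kap' i a) *s foldr w a (g (KL D i) x)"
    by (simp add: lext_add lext_scl evW_mult prod_kap' scale_left_distrib)
  have L: "evW (dL (pW D) i (y # a)) (g 0 x) = ?d *s foldr w a (g 0 x) + inverse (q D i y) *s w y ?L"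
    by (simp add: lext_add lext_scl evW_mult)
  have "e i (foldr w (y # a) x) = inverse (q D i y) *s w y (e i (foldr w a x))
      + (?d * l i) *s (g (KL D i) (foldr w a x) - g 0 (foldr w a x))"
    by (simp add: link)
  also have "g (KL D i) (foldr w a x) = (kap i a * kap' i a) *s foldr w a (g (KL D i) x)"
    unfolding g_fw prod_kap ..
  also have "g 0 (foldr w a x) = foldr w a (g 0 x)" by (rule g0_fw[symmetric])
  finally show ?case unfolding Cons R L
    by (cases "i = y") (simp_all add: w_add w_diff w_scale scale_right_distrib scale_right_diff_distrib mult_ac)
qed simp

text \<open>Mirror image of \<open>e_word\<close>: the group element is moved to the left, so
  \<open>dL\<close> and \<open>dR\<close> exchange roles.\<close>

lemma word_w:
  assumes x: "g 0 x = x"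
  shows "foldr e b (w j x) = kap' j b *s w j (foldr e b x)
    + l j *s ((kap' j b * q D j j) *s g (KL D j) (evE (dL (pW D) j b) x) - evE (dR (pW D) j b) x)"
proof (induction b)
  case (Cons y b)
  let ?R = "evE (dR (pW D) j b) x" and ?L = "evE (dL (pW D) j b) x"
  let ?d = "if y = j then 1 else 0 :: 'k"
  have R: "evE (dR (pW D) j (y # b)) x = e y ?R + (?d * kap' j b) *s foldr e b x"
    by (simp add: lext_add lext_scl evE_mult prod_kap' scale_left_distrib)
  have L: "evE (dL (pW D) j (y # b)) x = ?d *s foldr e b x + inverse (q D j y) *s e y ?L"
    by (simp add: lext_add lext_scl evE_mult)
  have eg: "e y (g (KL D j) ?L) = inverse (q D j y * q D y j) *s g (KL D j) (e y ?L)"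
  proof -
    have "inverse (q D j y * q D y j) * chr D y (KL D j) = 1" by (simp only: chr_KL) (simp add: field_simps)
    then show ?thesis by (simp only: g_e scale_scale scale_one)
  qed
  have "g 0 (foldr e b x) = foldr e b x" by (metis g0_fe x)
  then have "e y (w j (foldr e b x)) = inverse (q D y j) *s w j (e y (foldr e b x))
      + (?d * l j) *s (g (KL D j) (foldr e b x) - foldr e b x)"
    by (simp add: link)
  moreover have "q D j j * (a * inverse (q D j j)) = a"
    "q D j j * (a * (inverse (q D j j) * c)) = a * c" for a c by (simp_all add: field_simps)
  ultimately show ?case using eg unfolding foldr.simps o_apply Cons R L
    by (cases "y = j") (simp_all add: e_add e_diff e_scale g_add g_scale scale_right_distrib
      scale_right_diff_distrib mult_ac)
qed simp

text \<open>The hypothesis places the quantum Serre element of level one, a q-commutator, in the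
  radical.\<close>

lemma q_commute:
  assumes "i \<noteq> j" "q D i j * q D j i = 1"
  shows "e i (e j x) = q D i j *s e j (e i x)" "w i (w j x) = inverse (q D j i) *s w j (w i x)"
proof -
  have "inverse (q D j i) * inverse (q D i j) = 1" using assms(2) by (simp flip: inverse_mult_distrib add: mult.commute)
  then have "serre (pW D) i j (Suc 0) \<in> Rad (pW D)" by (intro serre_in_Rad assms) simp
  from radE[OF this, of x] radW[OF this, of x]
  have *: "e i (e j x) = inverse (q D j i) *s e j (e i x)" "w i (w j x) = inverse (q D j i) *s w j (w i x)"
    by (simp_all add: lext_diff lext_scl word_mult del: scl_single)
  have "inverse (q D j i) = q D i j" using assms(2) by (simp add: field_simps)
  with * show "e i (e j x) = q D i j *s e j (e i x)" "w i (w j x) = inverse (q D j i) *s w j (w i x)"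
    by simp_all
qed

section \<open>The Casimir operators\<close>

definition ms :: "'i set \<Rightarrow> nat \<Rightarrow> 'i multiset set" where
  "ms J N = {\<beta>. set_mset \<beta> \<subseteq> J \<and> size \<beta> < N}"

lemma finite_ms: "finite (ms J N)"
proof -
  have "ms J N \<subseteq> mset ` {xs. set xs \<subseteq> J \<and> length xs \<le> N}"
  proof
    fix \<beta> assume "\<beta> \<in> ms J N"
    moreover obtain xs where "mset xs = \<beta>" using ex_mset by blast
    ultimately show "\<beta> \<in> mset ` {xs. set xs \<subseteq> J \<and> length xs \<le> N}" by (auto simp: ms_def)
  qed
  then show ?thesis by (rule finite_subset) (intro finite_imageI finite_lists_length_le, simp)
qed

lemma sum_ms_Suc:
  assumes "i \<in> J" "\<And>\<beta>. i \<notin># \<beta> \<Longrightarrow> f \<beta> = 0"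
  shows "(\<Sum>\<beta>\<in>ms J (Suc N). f \<beta>) = (\<Sum>\<beta>\<in>ms J N. f (add_mset i \<beta>))"
proof -
  have "(\<Sum>\<beta>\<in>ms J N. f (add_mset i \<beta>)) = (\<Sum>\<beta>\<in>add_mset i ` ms J N. f \<beta>)"
    by (subst sum.reindex) (auto simp: inj_on_def)
  also have "\<dots> = (\<Sum>\<beta>\<in>ms J (Suc N). f \<beta>)"
  proof (rule sum.mono_neutral_left[OF finite_ms])
    show "add_mset i ` ms J N \<subseteq> ms J (Suc N)" using assms(1) by (auto simp: ms_def)
    show "\<forall>\<beta>\<in>ms J (Suc N) - add_mset i ` ms J N. f \<beta> = 0"
    proof
      fix \<beta> assume \<beta>: "\<beta> \<in> ms J (Suc N) - add_mset i ` ms J N"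
      have "i \<notin># \<beta>"
      proof
        assume "i \<in># \<beta>"
        then obtain \<beta>' where "\<beta> = add_mset i \<beta>'" by (metis mset_add)
        with \<beta> show False by (auto simp: ms_def)
      qed
      then show "f \<beta> = 0" by (rule assms(2))
    qed
  qed
  finally show ?thesis ..
qed

text \<open>The canonical element of degree \<open>\<beta>\<close>, with first factor acting through
  \<open>w\<close>, second through \<open>e\<close>. The insertion \<open>h\<close> expresses what
  is left after commuting with a generator.\<close>

definition Xop :: "('v \<Rightarrow> 'v) \<Rightarrow> 'i multiset \<Rightarrow> 'v \<Rightarrow> 'v" where
  "Xop h \<beta> x = (\<Sum>(a, b)\<in>Wd \<beta> \<times> Wd \<beta>. theta (pW D) \<beta> a b *s foldr w a (h (foldr e b x)))"

lemma Xop_cong: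
  "(\<And>b. b \<in> Wd \<beta> \<Longrightarrow> h (foldr e b x) = c *s h' (foldr e b x)) \<Longrightarrow> Xop h \<beta> x = c *s Xop h' \<beta> x"
  unfolding Xop_def scale_sum_right by (intro sum.cong) (auto simp: fw_linear mult_ac)

lemma canonical_we:
  assumes "\<And>x y. h (x + y) = h x + h y" "\<And>a x. h (a *s x) = a *s h x"
  shows "r \<in> Rad (pW D) \<Longrightarrow> lext scale (\<lambda>a. foldr w a (h (foldr e b x))) r = 0"
    "r \<in> Rad (pW D) \<Longrightarrow> lext scale (\<lambda>b. foldr w a (h (foldr e b x))) r = 0"
proof -
  have h0: "h 0 = 0" using assms(2)[of 0 0] by simp
  have "lext scale (\<lambda>b. foldr w a (h (foldr e b x))) t = foldr w a (h (evE t x))" for t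
    by (induction t rule: pm_induct) (simp_all add: lext_add fw_linear assms h0)
  then show "r \<in> Rad (pW D) \<Longrightarrow> lext scale (\<lambda>b. foldr w a (h (foldr e b x))) r = 0"
    by (simp add: radE h0 fw_linear)
qed (rule radW)

lemma canonical_Xop:
  fixes \<beta> i
  defines "W \<equiv> Wd (add_mset i \<beta>) \<times> Wd (add_mset i \<beta>)" and "\<theta> \<equiv> theta (pW D) (add_mset i \<beta>)"
  assumes h: "\<And>x y. h (x + y) = h x + h y" "\<And>a x. h (a *s x) = a *s h x"
  shows "(\<Sum>(a, b)\<in>W. \<theta> a b *s evW (dL (pW D) i a) (h (foldr e b x))) = Xop h \<beta> (e i x)"
    "(\<Sum>(a, b)\<in>W. \<theta> a b *s evW (dR (pW D) i a) (h (foldr e b x))) = Xop (\<lambda>x. h (e i x)) \<beta> x"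
    "(\<Sum>(a, b)\<in>W. \<theta> a b *s lext scale (\<lambda>b. foldr w a (h (foldr e b x))) (dL (pW D) i b))
      = Xop (\<lambda>x. w i (h x)) \<beta> x"
    "(\<Sum>(a, b)\<in>W. \<theta> a b *s lext scale (\<lambda>b. foldr w a (h (foldr e b x))) (dR (pW D) i b))
      = w i (Xop h \<beta> x)"
proof -
  note c = canonical[where p = "pW D" and B = "\<lambda>a b. foldr w a (h (foldr e b x))", OF pW_nz
    canonical_we(1)[where h = h and x = x, OF h] canonical_we(2)[where h = h and x = x, OF h]]
  show "(\<Sum>(a, b)\<in>W. \<theta> a b *s evW (dL (pW D) i a) (h (foldr e b x))) = Xop h \<beta> (e i x)"
    unfolding W_def \<theta>_def by (subst c(1)) (simp_all add: Xop_def)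
  show "(\<Sum>(a, b)\<in>W. \<theta> a b *s evW (dR (pW D) i a) (h (foldr e b x))) = Xop (\<lambda>x. h (e i x)) \<beta> x"
    unfolding W_def \<theta>_def by (subst c(2)) (simp_all add: Xop_def)
  show "(\<Sum>(a, b)\<in>W. \<theta> a b *s lext scale (\<lambda>b. foldr w a (h (foldr e b x))) (dL (pW D) i b))
      = Xop (\<lambda>x. w i (h x)) \<beta> x"
    unfolding W_def \<theta>_def by (subst c(3)) (simp_all add: Xop_def)
  show "(\<Sum>(a, b)\<in>W. \<theta> a b *s lext scale (\<lambda>b. foldr w a (h (foldr e b x))) (dR (pW D) i b))
      = w i (Xop h \<beta> x)"
    unfolding W_def \<theta>_def by (subst c(4)) (simp_all add: Xop_def w_sum case_prod_unfold w_scale)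
qed

definition kapm :: "'i \<Rightarrow> 'i multiset \<Rightarrow> 'k" where "kapm i \<beta> = (\<Prod>s\<in>#\<beta>. inverse (q D i s))"
definition kapm' :: "'i \<Rightarrow> 'i multiset \<Rightarrow> 'k" where "kapm' i \<beta> = (\<Prod>s\<in>#\<beta>. inverse (q D s i))"

lemma kap_kapm: "kap i a = kapm i (mset a)" "kap' i a = kapm' i (mset a)"
  by (induction a) (auto simp: kapm_def kapm'_def)

lemma dLR_notin: "i \<notin> set a \<Longrightarrow> dL p i a = 0" "i \<notin> set a \<Longrightarrow> dR p i a = 0"
  by (induction a) auto

text \<open>Neighbouring degrees are linked: \<open>e i\<close> gets inserted in degree
  \<open>add_mset i \<beta>\<close>, and together with the group element in degree
  \<open>\<beta>\<close>. In a weighted sum over all degrees these insertions can be made to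
  cancel.\<close>

lemma e_Xop:
  "e i (Xop (\<lambda>x. x) (add_mset i \<beta>) x) =
    kapm i (add_mset i \<beta>) *s Xop (e i) (add_mset i \<beta>) x
    + l i *s (kapm i \<beta> *s Xop (\<lambda>x. g (KL D i) (e i x)) \<beta> x - Xop (\<lambda>x. x) \<beta> (e i (g 0 x)))"
  "i \<notin># \<beta>' \<Longrightarrow> e i (Xop (\<lambda>x. x) \<beta>' x) = kapm i \<beta>' *s Xop (e i) \<beta>' x"
proof -
  let ?W = "Wd (add_mset i \<beta>) \<times> Wd (add_mset i \<beta>)" and ?\<theta> = "theta (pW D) (add_mset i \<beta>)"
  have 1: "e i (Xop (\<lambda>x. x) \<beta>' x) = kapm i \<beta>' *s Xop (e i) \<beta>' x + l i *s ((kapm i \<beta>' * q D i i) *s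
      (\<Sum>(a, b)\<in>Wd \<beta>' \<times> Wd \<beta>'. theta (pW D) \<beta>' a b *s evW (dR (pW D) i a) (g (KL D i) (foldr e b x)))
      - (\<Sum>(a, b)\<in>Wd \<beta>' \<times> Wd \<beta>'. theta (pW D) \<beta>' a b *s evW (dL (pW D) i a) (g 0 (foldr e b x))))" for \<beta>'
    unfolding Xop_def e_sum scale_sum_right sum_subtractf[symmetric] sum.distrib[symmetric]
    by (intro sum.cong refl) (auto simp: e_scale e_word kap_kapm Wd_iff scale_right_distrib
      scale_right_diff_distrib mult_ac)
  have R: "(\<Sum>(a, b)\<in>?W. ?\<theta> a b *s evW (dR (pW D) i a) (g (KL D i) (foldr e b x))) = Xop (\<lambda>x. g (KL D i) (e i x)) \<beta> x"
    by (rule canonical_Xop) (rule g_add g_scale)+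
  have L: "(\<Sum>(a, b)\<in>?W. ?\<theta> a b *s evW (dL (pW D) i a) (g 0 (foldr e b x))) = Xop (\<lambda>x. x) \<beta> (e i (g 0 x))"
    using canonical_Xop(1)[where h = "\<lambda>x. x" and i = i and \<beta> = \<beta> and x = "g 0 x"] by (simp add: g0_fe)
  have "kapm i (add_mset i \<beta>) * q D i i = kapm i \<beta>" by (simp add: kapm_def)
  then show "e i (Xop (\<lambda>x. x) (add_mset i \<beta>) x) =
    kapm i (add_mset i \<beta>) *s Xop (e i) (add_mset i \<beta>) x
    + l i *s (kapm i \<beta> *s Xop (\<lambda>x. g (KL D i) (e i x)) \<beta> x - Xop (\<lambda>x. x) \<beta> (e i (g 0 x)))"
    unfolding 1 R L by simp
  assume i: "i \<notin># \<beta>'"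
  have "dL (pW D) i a = 0" "dR (pW D) i a = 0" if "a \<in> Wd \<beta>'" for a
    using that i by (auto simp: Wd_iff intro: dLR_notin)
  then show "e i (Xop (\<lambda>x. x) \<beta>' x) = kapm i \<beta>' *s Xop (e i) \<beta>' x"
    unfolding 1 by (simp add: case_prod_unfold mem_Times_iff)
qed

lemma Xop_w:
  assumes x: "g 0 x = x"
  shows "Xop (\<lambda>x. x) (add_mset j \<beta>) (w j x) =
    kapm' j (add_mset j \<beta>) *s Xop (w j) (add_mset j \<beta>) x
    + l j *s (kapm' j \<beta> *s Xop (\<lambda>x. w j (g (KL D j) x)) \<beta> x - w j (Xop (\<lambda>x. x) \<beta> x))"
  "j \<notin># \<beta>' \<Longrightarrow> Xop (\<lambda>x. x) \<beta>' (w j x) = kapm' j \<beta>' *s Xop (w j) \<beta>' x"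
proof -
  let ?W = "Wd (add_mset j \<beta>) \<times> Wd (add_mset j \<beta>)" and ?\<theta> = "theta (pW D) (add_mset j \<beta>)"
  have ev: "foldr w a (g h (evE t x)) = lext scale (\<lambda>b. foldr w a (g h (foldr e b x))) t"
    "foldr w a (evE t x) = lext scale (\<lambda>b. foldr w a (foldr e b x)) t" for a h t
    by (induction t rule: pm_induct) (simp_all add: lext_add fw_linear g_add g_scale)
  have 1: "Xop (\<lambda>x. x) \<beta>' (w j x) = kapm' j \<beta>' *s Xop (w j) \<beta>' x + l j *s ((kapm' j \<beta>' * q D j j) *s
      (\<Sum>(a, b)\<in>Wd \<beta>' \<times> Wd \<beta>'. theta (pW D) \<beta>' a b *s lext scale (\<lambda>b. foldr w a (g (KL D j) (foldr e b x))) (dL (pW D) j b))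
      - (\<Sum>(a, b)\<in>Wd \<beta>' \<times> Wd \<beta>'. theta (pW D) \<beta>' a b *s lext scale (\<lambda>b. foldr w a (foldr e b x)) (dR (pW D) j b)))" for \<beta>'
    unfolding Xop_def scale_sum_right sum_subtractf[symmetric] sum.distrib[symmetric]
    by (intro sum.cong refl) (auto simp: fw_linear fw_diff word_w[OF x] kap_kapm Wd_iff scale_right_distrib
      scale_right_diff_distrib mult_ac simp flip: ev)
  have L: "(\<Sum>(a, b)\<in>?W. ?\<theta> a b *s lext scale (\<lambda>b. foldr w a (g (KL D j) (foldr e b x))) (dL (pW D) j b)) = Xop (\<lambda>x. w j (g (KL D j) x)) \<beta> x"
    by (rule canonical_Xop) (rule g_add g_scale)+
  have R: "(\<Sum>(a, b)\<in>?W. ?\<theta> a b *s lext scale (\<lambda>b. foldr w a (foldr e b x)) (dR (pW D) j b)) = w j (Xop (\<lambda>x. x) \<beta> x)"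
    by (rule canonical_Xop) (rule refl)+
  have "kapm' j (add_mset j \<beta>) * q D j j = kapm' j \<beta>" by (simp add: kapm'_def)
  then show "Xop (\<lambda>x. x) (add_mset j \<beta>) (w j x) =
    kapm' j (add_mset j \<beta>) *s Xop (w j) (add_mset j \<beta>) x
    + l j *s (kapm' j \<beta> *s Xop (\<lambda>x. w j (g (KL D j) x)) \<beta> x - w j (Xop (\<lambda>x. x) \<beta> x))"
    unfolding 1 R L by simp
  assume j: "j \<notin># \<beta>'"
  have "dL (pW D) j a = 0" "dR (pW D) j a = 0" if "a \<in> Wd \<beta>'" for a
    using that j by (auto simp: Wd_iff intro: dLR_notin)
  then show "Xop (\<lambda>x. x) \<beta>' (w j x) = kapm' j \<beta>' *s Xop (w j) \<beta>' x"
    unfolding 1 by (simp add: case_prod_unfold mem_Times_iff)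
qed

section \<open>Weights relative to a base character\<close>

definition tw :: "('g \<Rightarrow> 'k) \<Rightarrow> ('i \<Rightarrow> int) \<Rightarrow> 'g \<Rightarrow> 'k" where
  "tw \<chi> \<gamma> = (\<lambda>h. \<chi> h * (\<Prod>i\<in>UNIV. chr D i h powi \<gamma> i))"

text \<open>The zero vector has every character as a weight, so that vectors of one weight form a
  subspace; \<open>wt_unique\<close> therefore asks for a nonzero vector.\<close>

definition wt :: "('g \<Rightarrow> 'k) \<Rightarrow> 'v \<Rightarrow> bool" where
  "wt \<mu> x \<longleftrightarrow> character \<mu> \<and> (\<forall>h. g h x = \<mu> h *s x)"

abbreviation cnt :: "'i multiset \<Rightarrow> 'i \<Rightarrow> int" where "cnt \<beta> \<equiv> (\<lambda>i. int (count \<beta> i))"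

lemma tw_tw: "tw (tw \<chi> a) b = tw \<chi> (\<lambda>i. a i + b i)"
  by (rule ext) (simp add: tw_def power_int_add prod.distrib mult.assoc)

lemma tw_0 [simp]: "tw \<chi> (\<lambda>i. 0) = \<chi>" by (simp add: tw_def)

lemma prod_delta_powi:
  "(\<Prod>j\<in>UNIV. (c j :: 'k) powi (if j = (i::'i) then n else 0)) = c i powi n"
proof -
  have "(\<Prod>j\<in>UNIV. c j powi (if j = i then n else 0)) = (\<Prod>j\<in>UNIV. if j = i then c j powi n else 1)"
    by (intro prod.cong) auto
  then show ?thesis by simp
qed

lemma tw_delta: "tw \<chi> (\<lambda>j. if j = i then n else 0) h = \<chi> h * chr D i h powi n"
  by (simp add: tw_def prod_delta_powi)

lemma character_tw: "character \<chi> \<Longrightarrow> character (tw \<chi> \<gamma>)"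
  by (simp add: character_def tw_def chr_add power_int_mult_distrib prod.distrib mult_ac)

lemma upd_eq: "\<gamma>(i := \<gamma> i + n) = (\<lambda>j. \<gamma> j + (if j = i then n else (0::int)))" by auto

lemma tw_upd: "tw \<chi> (\<gamma>(i := \<gamma> i + n)) h = chr D i h powi n * tw \<chi> \<gamma> h"
  unfolding upd_eq tw_tw[symmetric] tw_delta by simp

lemma wt_scale: "wt \<mu> x \<Longrightarrow> wt \<mu> (a *s x)" by (simp add: wt_def g_scale scale_left_commute)
lemma wt_add: "wt \<mu> x \<Longrightarrow> wt \<mu> y \<Longrightarrow> wt \<mu> (x + y)" by (simp add: wt_def g_add scale_right_distrib)
lemma wt_diff: "wt \<mu> x \<Longrightarrow> wt \<mu> y \<Longrightarrow> wt \<mu> (x - y)" by (simp add: wt_def g_diff scale_right_diff_distrib)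
lemma wt_zero: "character \<mu> \<Longrightarrow> wt \<mu> 0" by (simp add: wt_def)
lemma wt_sum: "character \<mu> \<Longrightarrow> (\<And>x. x \<in> A \<Longrightarrow> wt \<mu> (f x)) \<Longrightarrow> wt \<mu> (sum f A)"
  by (induction A rule: infinite_finite_induct) (auto intro: wt_add wt_zero)
lemma wt_g0: "wt \<mu> x \<Longrightarrow> g 0 x = x" by (simp add: wt_def character_def)
lemma wt_character: "wt \<mu> x \<Longrightarrow> character \<mu>" by (simp add: wt_def)

lemma wt_unique: "wt \<mu> x \<Longrightarrow> wt \<nu> x \<Longrightarrow> x \<noteq> 0 \<Longrightarrow> \<mu> = \<nu>"
  by (auto simp: wt_def intro!: ext)

lemma wt_e: "wt (tw \<chi> \<gamma>) x \<Longrightarrow> wt (tw \<chi> (\<gamma>(i := \<gamma> i + 1))) (e i x)"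
proof -
  assume *: "wt (tw \<chi> \<gamma>) x"
  have "character (tw (tw \<chi> \<gamma>) (\<lambda>j. if j = i then 1 else 0))" 
    using wt_character[OF *] by (rule character_tw)
  with * show ?thesis
    by (simp add: wt_def tw_upd g_e e_scale tw_tw upd_eq[symmetric] mult_ac)
qed

lemma wt_w: "wt (tw \<chi> \<gamma>) x \<Longrightarrow> wt (tw \<chi> (\<gamma>(i := \<gamma> i - 1))) (w i x)"
proof -
  assume *: "wt (tw \<chi> \<gamma>) x"
  have "character (tw (tw \<chi> \<gamma>) (\<lambda>j. if j = i then - 1 else 0))" 
    using wt_character[OF *] by (rule character_tw)
  with * show ?thesis using tw_upd[of \<chi> \<gamma> i "-1"] upd_eq[of \<gamma> i "-1"]
    by (simp add: wt_def g_w w_scale tw_tw mult_ac)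
qed

lemma wt_fe: "wt (tw \<chi> \<gamma>) x \<Longrightarrow> wt (tw \<chi> (\<lambda>i. \<gamma> i + cnt (mset b) i)) (foldr e b x)"
proof (induction b)
  case (Cons s b)
  have "(\<lambda>i. \<gamma> i + cnt (mset (s # b)) i) = (\<lambda>i. \<gamma> i + cnt (mset b) i)(s := (\<gamma> s + cnt (mset b) s) + 1)" by auto
  then show ?case using wt_e[OF Cons.IH[OF Cons.prems], of s] by simp
qed simp

lemma wt_fw: "wt (tw \<chi> \<gamma>) x \<Longrightarrow> wt (tw \<chi> (\<lambda>i. \<gamma> i - cnt (mset b) i)) (foldr w b x)"
proof (induction b)
  case (Cons s b)
  have "(\<lambda>i. \<gamma> i - cnt (mset (s # b)) i) = (\<lambda>i. \<gamma> i - cnt (mset b) i)(s := (\<gamma> s - cnt (mset b) s) - 1)" by auto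
  then show ?case using wt_w[OF Cons.IH[OF Cons.prems], of s] by simp
qed simp

text \<open>The braiding does not interact across the boundary of \<open>J\<close>; a connected
  component of the Cartan matrix has this property.\<close>

definition closedJ :: "'i set \<Rightarrow> bool" where
  "closedJ J \<longleftrightarrow> (\<forall>i j. i \<in> J \<longrightarrow> j \<notin> J \<longrightarrow> q D i j * q D j i = 1)"

text \<open>
  The recursion for \<open>G\<close> is what the commutation of the operators \<open>Cas\<close> below with \<open>e i\<close> and \<open>w i\<close>
  amounts to. In \<open>Cas\<close>, the argument \<open>\<gamma>\<close> records the weight of the vector relative to \<open>\<chi>\<close>, and
  \<open>N\<close> truncates a sum that is finite only on vectors killed by all long words in the \<open>e i\<close>.
\<close>

definition Gprop :: "('g \<Rightarrow> 'k) \<Rightarrow> 'i set \<Rightarrow> (('i \<Rightarrow> int) \<Rightarrow> 'k) \<Rightarrow> bool" where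
  "Gprop \<chi> J G \<longleftrightarrow>
    (\<forall>\<gamma> i. i \<in> J \<longrightarrow> G (\<gamma>(i := \<gamma> i + 1)) * tw \<chi> (\<gamma>(i := \<gamma> i + 1)) (KL D i) = G \<gamma>) \<and>
    (\<forall>\<gamma> i. i \<notin> J \<longrightarrow> G (\<gamma>(i := \<gamma> i + 1)) = G \<gamma>)"

text \<open>Absorbs the factor \<open>l i\<close> by which \<open>e_Xop\<close> and
  \<open>Xop_w\<close> pass between degrees; the sign makes the insertions cancel.\<close>

definition lam :: "'i multiset \<Rightarrow> 'k" where "lam \<beta> = (\<Prod>i\<in>#\<beta>. - inverse (l i))"

definition Cas :: "'i set \<Rightarrow> (('i \<Rightarrow> int) \<Rightarrow> 'k) \<Rightarrow> ('i \<Rightarrow> int) \<Rightarrow> nat \<Rightarrow> 'v \<Rightarrow> 'v" where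
  "Cas J G \<gamma> N x = (\<Sum>\<beta>\<in>ms J N. (lam \<beta> * G (\<lambda>i. \<gamma> i + cnt \<beta> i)) *s Xop (\<lambda>x. x) \<beta> x)"

lemma Xop_linear:
  assumes "\<And>x y. h (x + y) = h x + h y" "\<And>a x. h (a *s x) = a *s h x"
  shows "Xop h \<beta> (x + y) = Xop h \<beta> x + Xop h \<beta> y" "Xop h \<beta> (a *s x) = a *s Xop h \<beta> x"
  by (simp_all add: Xop_def fe_linear fw_linear assms scale_right_distrib sum.distrib case_prod_unfold
      scale_sum_right scale_left_commute del: scale_scale)

lemma Cas_linear:
  "Cas J G \<gamma> N (x + y) = Cas J G \<gamma> N x + Cas J G \<gamma> N y" "Cas J G \<gamma> N (a *s x) = a *s Cas J G \<gamma> N x"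
  by (simp_all add: Cas_def Xop_linear scale_right_distrib sum.distrib scale_sum_right scale_left_commute del: scale_scale)

lemma wt_Cas: "wt (tw \<chi> \<gamma>) x \<Longrightarrow> wt (tw \<chi> \<gamma>) (Cas J G \<gamma>' N x)"
proof -
  assume *: "wt (tw \<chi> \<gamma>) x"
  note c = wt_character[OF *]
  have "wt (tw \<chi> \<gamma>) (foldr w a (foldr e b x))" if "a \<in> Wd \<beta>" "b \<in> Wd \<beta>" for a b \<beta>
    using wt_fw[OF wt_fe[OF *, of b], of a] that by (simp add: Wd_iff)
  then show ?thesis unfolding Cas_def Xop_def
    by (intro wt_sum c wt_scale) (auto intro!: wt_scale)
qed

lemma Xop_zero: "(\<And>b. b \<in> Wd \<beta> \<Longrightarrow> h (foldr e b x) = 0) \<Longrightarrow> Xop h \<beta> x = 0"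
  unfolding Xop_def by (intro sum.neutral) (auto simp: fw_linear)

lemma sum_ms_drop:
  assumes "\<And>\<beta>. size \<beta> = N \<Longrightarrow> f \<beta> = 0"
  shows "(\<Sum>\<beta>\<in>ms J (Suc N). f \<beta>) = (\<Sum>\<beta>\<in>ms J N. f \<beta>)"
  using assms by (intro sum.mono_neutral_right finite_ms) (auto simp: ms_def less_Suc_eq)

text \<open>Telescoping over the degree: \<open>Gprop\<close> makes the insertion with the group
  element coming from degree \<open>add_mset i \<beta>\<close> cancel the plain insertion in degree
  \<open>\<beta>\<close>. Only plain insertions of size \<open>N\<close> remain; they apply words of
  length \<open>N + 1\<close> to \<open>x\<close> and vanish.\<close>

lemma e_Cas:
  assumes G: "Gprop \<chi> J G" and i: "i \<in> J" and x: "wt (tw \<chi> \<gamma>) x"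
    and N: "\<And>b. length b \<ge> Suc N \<Longrightarrow> foldr e b x = 0"
  shows "e i (Cas J G \<gamma> (Suc N) x) = Cas J G (\<gamma>(i := \<gamma> i + 1)) N (e i x)"
proof -
  let ?\<gamma> = "\<lambda>\<beta> i. \<gamma> i + cnt \<beta> i" and ?\<gamma>' = "\<lambda>\<beta> j. (\<gamma>(i := \<gamma> i + 1)) j + cnt \<beta> j"
  define Z where "Z = (\<lambda>\<beta>. (lam \<beta> * G (?\<gamma> \<beta>)) *s e i (Xop (\<lambda>x. x) \<beta> x)
    - (lam \<beta> * G (?\<gamma> \<beta>) * kapm i \<beta>) *s Xop (e i) \<beta> x)"
  have Z0: "Z \<beta> = 0" if "i \<notin># \<beta>" for \<beta> using e_Xop(2)[OF that] by (simp add: Z_def)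
  have Z1: "Z (add_mset i \<beta>) = (lam \<beta> * G (?\<gamma>' \<beta>)) *s Xop (\<lambda>x. x) \<beta> (e i x)
      - (lam \<beta> * G (?\<gamma> \<beta>) * kapm i \<beta>) *s Xop (e i) \<beta> x" for \<beta>
  proof -
    have \<gamma>: "?\<gamma> (add_mset i \<beta>) = ?\<gamma>' \<beta>" "?\<gamma>' \<beta> = (?\<gamma> \<beta>)(i := ?\<gamma> \<beta> i + 1)" by auto
    let ?c = "tw \<chi> (?\<gamma>' \<beta>) (KL D i)"
    have Gc: "G (?\<gamma>' \<beta>) * ?c = G (?\<gamma> \<beta>)" using G i unfolding Gprop_def \<gamma>(2) by blast
    have "Xop (\<lambda>x. g (KL D i) (e i x)) \<beta> x = ?c *s Xop (e i) \<beta> x"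
    proof (rule Xop_cong)
      fix b assume "b \<in> Wd \<beta>"
      then have "wt (tw \<chi> (?\<gamma> \<beta>)) (foldr e b x)" using wt_fe[OF x, of b] by (simp add: Wd_iff)
      from wt_e[OF this, of i] show "g (KL D i) (e i (foldr e b x)) = ?c *s e i (foldr e b x)"
        unfolding wt_def \<gamma>(2) by blast
    qed
    moreover have "lam (add_mset i \<beta>) * l i = - lam \<beta>" by (simp add: lam_def)
    then have la: "lam (add_mset i \<beta>) * c * l i * d = - (lam \<beta> * c * d)" for c d
      by (metis (no_types, opaque_lifting) minus_mult_left mult.assoc mult.commute)
    ultimately have "Z (add_mset i \<beta>) = (lam (add_mset i \<beta>) * G (?\<gamma>' \<beta>) * l i) *s
        (kapm i \<beta> *s ?c *s Xop (e i) \<beta> x - Xop (\<lambda>x. x) \<beta> (e i x))"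
      unfolding Z_def \<gamma>(1) e_Xop(1) wt_g0[OF x] by (simp add: scale_right_distrib)
    also have "\<dots> = (lam (add_mset i \<beta>) * G (?\<gamma>' \<beta>) * l i * (kapm i \<beta> * ?c)) *s Xop (e i) \<beta> x
        - (lam (add_mset i \<beta>) * G (?\<gamma>' \<beta>) * l i * 1) *s Xop (\<lambda>x. x) \<beta> (e i x)"
      by (simp add: scale_right_diff_distrib mult.assoc)
    also have "\<dots> = (lam \<beta> * G (?\<gamma>' \<beta>)) *s Xop (\<lambda>x. x) \<beta> (e i x)
      - (lam \<beta> * (G (?\<gamma>' \<beta>) * ?c) * kapm i \<beta>) *s Xop (e i) \<beta> x"
      unfolding la by (simp add: mult_ac)
    finally show ?thesis unfolding Gc .
  qed
  have "e i (Cas J G \<gamma> (Suc N) x) = (\<Sum>\<beta>\<in>ms J (Suc N). Z \<beta>)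
      + (\<Sum>\<beta>\<in>ms J (Suc N). (lam \<beta> * G (?\<gamma> \<beta>) * kapm i \<beta>) *s Xop (e i) \<beta> x)"
    unfolding Cas_def e_sum sum.distrib[symmetric] by (intro sum.cong) (simp_all add: Z_def e_scale)
  also have "(\<Sum>\<beta>\<in>ms J (Suc N). (lam \<beta> * G (?\<gamma> \<beta>) * kapm i \<beta>) *s Xop (e i) \<beta> x)
      = (\<Sum>\<beta>\<in>ms J N. (lam \<beta> * G (?\<gamma> \<beta>) * kapm i \<beta>) *s Xop (e i) \<beta> x)"
  proof (rule sum_ms_drop)
    fix \<beta> :: "'i multiset" assume "size \<beta> = N"
    then have "Xop (e i) \<beta> x = 0"
      using N[of "i # _"] by (intro Xop_zero) (auto simp: Wd_iff)
    then show "(lam \<beta> * G (?\<gamma> \<beta>) * kapm i \<beta>) *s Xop (e i) \<beta> x = 0" by simp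
  qed
  also have "(\<Sum>\<beta>\<in>ms J (Suc N). Z \<beta>) = (\<Sum>\<beta>\<in>ms J N. Z (add_mset i \<beta>))"
    by (rule sum_ms_Suc[OF i Z0])
  finally show ?thesis unfolding Z1 Cas_def by (simp add: sum_subtractf)
qed

text \<open>The same telescoping, but here the insertion stands to the left of the word in
  \<open>e\<close>. The remaining terms apply words of length only \<open>N\<close> to
  \<open>x\<close>, hence the sharper hypothesis.\<close>

lemma w_Cas:
  assumes G: "Gprop \<chi> J G" and j: "j \<in> J" and x: "wt (tw \<chi> \<gamma>) x"
    and N: "\<And>b. length b \<ge> N \<Longrightarrow> foldr e b x = 0"
  shows "Cas J G (\<gamma>(j := \<gamma> j - 1)) (Suc N) (w j x) = w j (Cas J G \<gamma> N x)"
proof -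
  let ?\<gamma> = "\<lambda>\<beta> i. \<gamma> i + cnt \<beta> i" and ?\<gamma>' = "\<lambda>\<beta> i. (\<gamma>(j := \<gamma> j - 1)) i + cnt \<beta> i"
  define Z where "Z = (\<lambda>\<beta>. (lam \<beta> * G (?\<gamma>' \<beta>)) *s Xop (\<lambda>x. x) \<beta> (w j x)
    - (lam \<beta> * G (?\<gamma>' \<beta>) * kapm' j \<beta>) *s Xop (w j) \<beta> x)"
  have Z0: "Z \<beta> = 0" if "j \<notin># \<beta>" for \<beta> using Xop_w(2)[OF wt_g0[OF x] that] by (simp add: Z_def)
  have Z1: "Z (add_mset j \<beta>) = (lam \<beta> * G (?\<gamma> \<beta>)) *s w j (Xop (\<lambda>x. x) \<beta> x)
      - (lam \<beta> * G (?\<gamma>' \<beta>) * kapm' j \<beta>) *s Xop (w j) \<beta> x" for \<beta>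
  proof -
    have \<gamma>: "?\<gamma>' (add_mset j \<beta>) = ?\<gamma> \<beta>" "?\<gamma> \<beta> = (?\<gamma>' \<beta>)(j := ?\<gamma>' \<beta> j + 1)" by auto
    let ?c = "tw \<chi> (?\<gamma> \<beta>) (KL D j)"
    have "G ((?\<gamma>' \<beta>)(j := ?\<gamma>' \<beta> j + 1)) * tw \<chi> ((?\<gamma>' \<beta>)(j := ?\<gamma>' \<beta> j + 1)) (KL D j) = G (?\<gamma>' \<beta>)"
      using G j unfolding Gprop_def by blast
    then have Gc: "G (?\<gamma> \<beta>) * ?c = G (?\<gamma>' \<beta>)" by (simp only: \<gamma>(2)[symmetric])
    have "Xop (\<lambda>x. w j (g (KL D j) x)) \<beta> x = ?c *s Xop (w j) \<beta> x"
    proof (rule Xop_cong)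
      fix b assume "b \<in> Wd \<beta>"
      then have "wt (tw \<chi> (?\<gamma> \<beta>)) (foldr e b x)" using wt_fe[OF x, of b] by (simp add: Wd_iff)
      then show "w j (g (KL D j) (foldr e b x)) = ?c *s w j (foldr e b x)"
        by (simp add: wt_def w_scale)
    qed
    moreover have "lam (add_mset j \<beta>) * l j = - lam \<beta>" by (simp add: lam_def)
    then have la: "lam (add_mset j \<beta>) * c * l j * d = - (lam \<beta> * c * d)" for c d
      by (metis (no_types, opaque_lifting) minus_mult_left mult.assoc mult.commute)
    ultimately have "Z (add_mset j \<beta>) = (lam (add_mset j \<beta>) * G (?\<gamma> \<beta>) * l j) *s
        (kapm' j \<beta> *s ?c *s Xop (w j) \<beta> x - w j (Xop (\<lambda>x. x) \<beta> x))"
      unfolding Z_def \<gamma>(1) Xop_w(1)[OF wt_g0[OF x]] by (simp add: scale_right_distrib)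
    also have "\<dots> = (lam (add_mset j \<beta>) * G (?\<gamma> \<beta>) * l j * (kapm' j \<beta> * ?c)) *s Xop (w j) \<beta> x
        - (lam (add_mset j \<beta>) * G (?\<gamma> \<beta>) * l j * 1) *s w j (Xop (\<lambda>x. x) \<beta> x)"
      by (simp add: scale_right_diff_distrib mult.assoc)
    also have "\<dots> = (lam \<beta> * G (?\<gamma> \<beta>)) *s w j (Xop (\<lambda>x. x) \<beta> x)
      - (lam \<beta> * (G (?\<gamma> \<beta>) * ?c) * kapm' j \<beta>) *s Xop (w j) \<beta> x"
      unfolding la by (simp add: mult_ac)
    finally show ?thesis unfolding Gc .
  qed
  have "Cas J G (\<gamma>(j := \<gamma> j - 1)) (Suc N) (w j x) = (\<Sum>\<beta>\<in>ms J (Suc N). Z \<beta>)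
      + (\<Sum>\<beta>\<in>ms J (Suc N). (lam \<beta> * G (?\<gamma>' \<beta>) * kapm' j \<beta>) *s Xop (w j) \<beta> x)"
    unfolding Cas_def sum.distrib[symmetric] by (intro sum.cong) (simp_all add: Z_def)
  also have "(\<Sum>\<beta>\<in>ms J (Suc N). (lam \<beta> * G (?\<gamma>' \<beta>) * kapm' j \<beta>) *s Xop (w j) \<beta> x)
      = (\<Sum>\<beta>\<in>ms J N. (lam \<beta> * G (?\<gamma>' \<beta>) * kapm' j \<beta>) *s Xop (w j) \<beta> x)"
  proof (rule sum_ms_drop)
    fix \<beta> :: "'i multiset" assume "size \<beta> = N"
    then have "Xop (w j) \<beta> x = 0"
      using N by (intro Xop_zero) (auto simp: Wd_iff)
    then show "(lam \<beta> * G (?\<gamma>' \<beta>) * kapm' j \<beta>) *s Xop (w j) \<beta> x = 0" by simp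
  qed
  also have "(\<Sum>\<beta>\<in>ms J (Suc N). Z \<beta>) = (\<Sum>\<beta>\<in>ms J N. Z (add_mset j \<beta>))"
    by (rule sum_ms_Suc[OF j Z0])
  finally show ?thesis unfolding Z1 Cas_def by (simp add: sum_subtractf w_sum w_scale)
qed

lemma e_fe_commute:
  assumes "\<And>s. s \<in> set b \<Longrightarrow> i \<noteq> s \<and> q D i s * q D s i = 1"
  shows "foldr e b (e i x) = kap i b *s e i (foldr e b x)"
  using assms
proof (induction b)
  case (Cons s b)
  have "e s (e i y) = inverse (q D i s) *s e i (e s y)" for y
    using q_commute(1)[of i s y] Cons.prems by simp
  with Cons show ?case by (simp add: e_scale mult_ac)
qed simp

lemma w_fw_commute:
  assumes "\<And>s. s \<in> set b \<Longrightarrow> i \<noteq> s \<and> q D i s * q D s i = 1"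
  shows "w i (foldr w b x) = kap' i b *s foldr w b (w i x)"
  using assms
proof (induction b)
  case (Cons s b)
  have "w i (w s y) = inverse (q D s i) *s w s (w i y)" for y
    using q_commute(2)[of i s y] Cons.prems by simp
  with Cons show ?case by (simp add: w_scale mult_ac)
qed simp

text \<open>Across the boundary of \<open>J\<close> no linking term arises and equal-type generators
  q-commute; the scalar picked up from the \<open>w\<close> word equals that from the
  \<open>e\<close> word.\<close>

lemma Cas_commute_outside:
  assumes J: "closedJ J" and G: "Gprop \<chi> J G" and i: "i \<notin> J" and x: "wt (tw \<chi> \<gamma>) x"
  shows "e i (Cas J G \<gamma> N x) = Cas J G (\<gamma>(i := \<gamma> i + 1)) N (e i x)"
    and "Cas J G (\<gamma>(i := \<gamma> i - 1)) N (w i x) = w i (Cas J G \<gamma> N x)"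
proof -
  have com: "i \<noteq> s \<and> q D i s * q D s i = 1" if "b \<in> Wd \<beta>" "\<beta> \<in> ms J N" "s \<in> set b" for b s \<beta>
  proof -
    have "s \<in> J" using that by (auto simp: Wd_iff ms_def)
    moreover from this have "q D s i * q D i s = 1" using J i by (simp add: closedJ_def)
    ultimately show ?thesis using i by (auto simp: mult.commute)
  qed
  have ni: "i \<notin># \<beta>" if "\<beta> \<in> ms J N" for \<beta> using that i by (auto simp: ms_def)
  have GE: "G (\<lambda>j. (\<gamma>(i := \<gamma> i + 1)) j + cnt \<beta> j) = G (\<lambda>j. \<gamma> j + cnt \<beta> j)" for \<gamma> \<beta>
  proof -
    have eq: "(\<lambda>j. (\<gamma>(i := \<gamma> i + 1)) j + cnt \<beta> j) = (\<lambda>j. \<gamma> j + cnt \<beta> j)(i := \<gamma> i + cnt \<beta> i + 1)" by auto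
    have "G (\<delta>(i := \<delta> i + 1)) = G \<delta>" for \<delta> using G i unfolding Gprop_def by blast
    from this[of "\<lambda>j. \<gamma> j + cnt \<beta> j"] show ?thesis unfolding eq .
  qed
  have "e i (Xop (\<lambda>x. x) \<beta> x) = Xop (\<lambda>x. x) \<beta> (e i x)" if \<beta>: "\<beta> \<in> ms J N" for \<beta>
  proof -
    have "Xop (\<lambda>x. x) \<beta> (e i x) = kapm i \<beta> *s Xop (e i) \<beta> x"
      unfolding Xop_def scale_sum_right
      by (intro sum.cong refl) (auto simp: e_fe_commute[OF com[OF _ \<beta>]] fw_linear mult.commute kap_kapm Wd_iff)
    then show ?thesis using e_Xop(2)[OF ni[OF \<beta>]] by simp
  qed
  then show "e i (Cas J G \<gamma> N x) = Cas J G (\<gamma>(i := \<gamma> i + 1)) N (e i x)"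
    unfolding Cas_def GE by (simp add: e_sum e_scale)
  have "w i (Xop (\<lambda>x. x) \<beta> x) = Xop (\<lambda>x. x) \<beta> (w i x)" if \<beta>: "\<beta> \<in> ms J N" for \<beta>
  proof -
    have "w i (Xop (\<lambda>x. x) \<beta> x) = kapm' i \<beta> *s Xop (w i) \<beta> x"
      unfolding Xop_def scale_sum_right w_sum
      by (intro sum.cong refl) (auto simp: w_fw_commute[OF com[OF _ \<beta>]] w_scale mult.commute kap_kapm Wd_iff)
    then show ?thesis using Xop_w(2)[OF wt_g0[OF x] ni[OF \<beta>]] by simp
  qed
  then show "Cas J G (\<gamma>(i := \<gamma> i - 1)) N (w i x) = w i (Cas J G \<gamma> N x)"
    using GE[of "\<gamma>(i := \<gamma> i - 1)"] unfolding Cas_def by (simp add: w_sum w_scale)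
qed

definition prim :: "'v \<Rightarrow> bool" where "prim x \<longleftrightarrow> (\<forall>i. e i x = 0)"

lemma Xop_empty: "Xop h {#} x = h x"
proof -
  have "theta (pW D) {#} [] [] = 1"
    using gram_inverse_theta[of "pW D" "{#}"] by (simp add: gram_inverse_def)
  then show ?thesis by (simp add: Xop_def)
qed

lemma prim_fe: "prim x \<Longrightarrow> b \<noteq> [] \<Longrightarrow> foldr e b x = 0"
  by (cases b rule: rev_cases) (auto simp: prim_def fe_linear)

text \<open>Only the empty degree survives, and \<open>Suc\<close> keeps it below the
  truncation.\<close>

lemma Cas_prim:
  assumes "prim x" shows "Cas J G \<gamma> (Suc N) x = G \<gamma> *s x"
proof -
  have "(\<Sum>\<beta>\<in>ms J (Suc N). (lam \<beta> * G (\<lambda>i. \<gamma> i + cnt \<beta> i)) *s Xop (\<lambda>x. x) \<beta> x)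
     = (\<Sum>\<beta>\<in>{{#}}. (lam \<beta> * G (\<lambda>i. \<gamma> i + cnt \<beta> i)) *s Xop (\<lambda>x. x) \<beta> x)"
  proof (rule sum.mono_neutral_right[OF finite_ms])
    show "\<forall>\<beta>\<in>ms J (Suc N) - {{#}}. (lam \<beta> * G (\<lambda>i. \<gamma> i + cnt \<beta> i)) *s Xop (\<lambda>x. x) \<beta> x = 0"
    proof
      fix \<beta> assume "\<beta> \<in> ms J (Suc N) - {{#}}"
      then have "Xop (\<lambda>x. x) \<beta> x = 0" by (intro Xop_zero prim_fe[OF assms]) (auto simp: Wd_iff)
      then show "(lam \<beta> * G (\<lambda>i. \<gamma> i + cnt \<beta> i)) *s Xop (\<lambda>x. x) \<beta> x = 0" by simp
    qed
  qed (auto simp: ms_def)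
  then show ?thesis by (simp add: Cas_def Xop_empty lam_def)
qed

lemma lext_in_span: "lext scale F t \<in> span (F ` Poly_Mapping.keys t)"
  unfolding lext_def by (intro span_sum span_scale span_base) auto

lemma e_hw:
  assumes x: "prim x" "wt \<mu> x"
  shows "e i (foldr w u x) \<in> span {foldr w u' x | u'. add_mset i (mset u') = mset u}"
proof -
  let ?S = "{foldr w u' x | u'. add_mset i (mset u') = mset u}"
  have gx: "g h x = \<mu> h *s x" for h using x by (simp add: wt_def)
  have sc: "lext scale (\<lambda>u. foldr w u (c *s x)) t = c *s evW t x" for c t
    by (simp add: lext_def fw_linear scale_sum_right scale_left_commute del: scale_scale)
  have "(\<lambda>u. foldr w u x) ` Poly_Mapping.keys (dL (pW D) i u) \<subseteq> ?S"
    "(\<lambda>u. foldr w u x) ` Poly_Mapping.keys (dR (pW D) i u) \<subseteq> ?S"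
    using keys_dL keys_dR by fast+
  from subsetD[OF span_mono[OF this(1)] lext_in_span] subsetD[OF span_mono[OF this(2)] lext_in_span]
  have LR: "evW (dL (pW D) i u) x \<in> span ?S" "evW (dR (pW D) i u) x \<in> span ?S" by simp_all
  have "e i x = 0" using x by (simp add: prim_def)
  then have eq: "e i (foldr w u x) = l i *s ((kap i u * q D i i) *s \<mu> (KL D i) *s evW (dR (pW D) i u) x
      - \<mu> 0 *s evW (dL (pW D) i u) x)"
    unfolding e_word gx sc by (simp only: fw_linear scale_zero_right add_0_left)
  show ?thesis unfolding eq by (intro span_scale span_diff LR)
qed

text \<open>Each \<open>e i\<close> shortens the word by one letter. The induction runs over spans
  because \<open>e_hw\<close> yields linear combinations.\<close>

lemma hw_kill:
  assumes x: "prim x" "wt \<mu> x" and "length u < length b"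
  shows "foldr e b (foldr w u x) = 0"
proof -
  have "foldr e b y = 0" if "y \<in> span {foldr w u x | u. length u < length b}" for y
    using that
  proof (induction b arbitrary: y rule: rev_induct)
    case (snoc i b)
    have "e i y \<in> span {foldr w u x | u. length u < length b}"
      using snoc.prems
    proof (induction rule: span_induct_alt)
      case (step c y z)
      then obtain u where u: "y = foldr w u x" "length u < Suc (length b)" by auto
      have "{foldr w u' x | u'. add_mset i (mset u') = mset u} \<subseteq> {foldr w u x | u. length u < length b}"
      proof clarify
        fix u' assume "add_mset i (mset u') = mset u"
        then have "Suc (length u') = length u" by (metis size_add_mset size_mset)
        then show "\<exists>u. foldr w u' x = foldr w u x \<and> length u < length b" using u by auto
      qed
      from subsetD[OF span_mono[OF this] e_hw[OF x]] have "e i y \<in> span {foldr w u x | u. length u < length b}"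
        unfolding u(1) .
      then show ?case using step by (auto simp: e_add e_scale intro: span_add span_scale)
    qed (simp add: span_zero)
    then show ?case using snoc.IH by simp
  qed simp
  then show ?thesis using assms(3) by (blast intro: span_base)
qed

text \<open>The operator passes through the \<open>w\<close> down to the primitive generator and
  acts there by the value of \<open>G\<close> at the generator's weight. Each letter in
  \<open>J\<close> costs one step of truncation, so \<open>N\<close> must exceed the length of
  \<open>u\<close>.\<close>

lemma Cas_hw:
  assumes J: "closedJ J" and G: "Gprop \<chi> J G" and x: "prim x" "wt (tw \<chi> \<gamma>) x" and "length u < N"
  shows "Cas J G (\<lambda>i. \<gamma> i - cnt (mset u) i) N (foldr w u x) = G \<gamma> *s foldr w u x"
  using assms(5)
proof (induction u arbitrary: N)
  case Nil
  then show ?case using Cas_prim[OF x(1)] by (cases N) auto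
next
  case (Cons j u)
  then obtain N' where N: "N = Suc N'" "length u < N'" by (cases N) auto
  let ?\<gamma> = "\<lambda>i. \<gamma> i - cnt (mset u) i"
  have u: "wt (tw \<chi> ?\<gamma>) (foldr w u x)" by (rule wt_fw[OF x(2)])
  have \<gamma>: "(\<lambda>i. \<gamma> i - cnt (mset (j # u)) i) = ?\<gamma>(j := ?\<gamma> j - 1)" by auto
  show ?case
  proof (cases "j \<in> J")
    case True
    have "Cas J G (?\<gamma>(j := ?\<gamma> j - 1)) (Suc N') (w j (foldr w u x)) = w j (Cas J G ?\<gamma> N' (foldr w u x))"
      by (rule w_Cas[OF G True u]) (use hw_kill[OF x] N in auto)
    then show ?thesis using Cons.IH[OF N(2)] unfolding \<gamma> N(1) by (simp add: w_scale)
  next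
    case False
    show ?thesis using Cas_commute_outside(2)[OF J G False u, of N] Cons.IH[of N] Cons.prems
      unfolding \<gamma> by (simp add: w_scale)
  qed
qed

end

section \<open>Comparison of Casimir eigenvalues\<close>

lemma prod_power_int: "(\<Prod>j\<in>J. f j) powi n = (\<Prod>j\<in>J. (f j :: 'k::field) powi n)"
  by (induction J rule: infinite_finite_induct) (auto simp: power_int_mult_distrib)

lemma prod_powi_if:
  assumes "finite J" "k \<in> J"
  shows "(\<Prod>i\<in>J. (f i :: 'k::field) powi (if i = k then n i else 0)) = f k powi n k"
proof -
  have "(\<Prod>i\<in>J. f i powi (if i = k then n i else 0)) = (\<Prod>i\<in>J. if i = k then f k powi n k else 1)"
    by (intro prod.cong) auto
  then show ?thesis using assms by simp
qed

context U_rep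
begin

lemma character_nz: "character (\<mu> :: 'g \<Rightarrow> 'k) \<Longrightarrow> \<mu> h \<noteq> 0"
proof
  assume "character \<mu>" "\<mu> h = 0"
  then have "\<mu> (h + - h) = 0" unfolding character_def by (metis mult_zero_left)
  then show False using \<open>character \<mu>\<close> by (simp add: character_def)
qed

text \<open>Multiplicative analogue of the quadratic Casimir eigenvalue. The linear factor
  \<open>q D i i\<close> plays the part of the shift by \<rho>: \<open>Hf_upd\<close> evaluates at
  the shifted weight and so requires \<open>q D k k\<close> twice, of which the quadratic part
  supplies only one.\<close>

definition Hf :: "('g \<Rightarrow> 'k) \<Rightarrow> 'i set \<Rightarrow> ('i \<Rightarrow> int) \<Rightarrow> 'k" where
  "Hf \<chi> J \<gamma> = (\<Prod>i\<in>J. (\<chi> (KL D i) * q D i i) powi \<gamma> i) * (\<Prod>i\<in>J. \<Prod>j\<in>J. q D i j powi (\<gamma> i * \<gamma> j))"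

lemma tw_KL:
  assumes J: "closedJ J" and k: "k \<in> J"
  shows "tw \<chi> \<gamma> (KL D k) = \<chi> (KL D k) * (\<Prod>j\<in>J. (q D k j * q D j k) powi \<gamma> j)"
proof -
  have "(\<Prod>j\<in>UNIV. chr D j (KL D k) powi \<gamma> j) = (\<Prod>j\<in>J. (q D k j * q D j k) powi \<gamma> j)"
    unfolding chr_KL
    using J k by (intro prod.mono_neutral_right) (auto simp: closedJ_def)
  then show ?thesis by (simp add: tw_def)
qed

lemma Hf_upd:
  assumes J: "closedJ J" and k: "k \<in> J" and \<chi>: "character \<chi>"
  shows "Hf \<chi> J (\<gamma>(k := \<gamma> k + 1)) = Hf \<chi> J \<gamma> * tw \<chi> (\<gamma>(k := \<gamma> k + 1)) (KL D k)"
proof -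
  let ?\<gamma> = "\<gamma>(k := \<gamma> k + 1)"
  have fin: "finite J" by simp
  have c: "\<chi> (KL D i) * q D i i \<noteq> 0" for i using character_nz[OF \<chi>] by simp
  have \<gamma>: "?\<gamma> i = \<gamma> i + (if i = k then 1 else 0)" for i by simp
  have \<gamma>\<gamma>: "?\<gamma> i * ?\<gamma> j = \<gamma> i * \<gamma> j + (if i = k then \<gamma> j else 0) + (if j = k then \<gamma> i else 0)
      + (if i = k then if j = k then 1 else 0 else 0)" for i j
    by (simp add: algebra_simps)
  have 1: "(\<Prod>i\<in>J. (\<chi> (KL D i) * q D i i) powi ?\<gamma> i)
      = (\<Prod>i\<in>J. (\<chi> (KL D i) * q D i i) powi \<gamma> i) * (\<chi> (KL D k) * q D k k)"
    unfolding \<gamma> using prod_powi_if[OF fin k, of "\<lambda>i. \<chi> (KL D i) * q D i i" "\<lambda>_. 1"] c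
    by (simp add: power_int_add prod.distrib del: power_int_mult_distrib)
  have a1: "(\<Prod>i\<in>J. \<Prod>j\<in>J. q D i j powi (if i = k then \<gamma> j else 0)) = (\<Prod>j\<in>J. q D k j powi \<gamma> j)"
    by (subst prod.swap) (simp add: prod_powi_if[OF fin k])
  have a2: "(\<Prod>i\<in>J. \<Prod>j\<in>J. q D i j powi (if j = k then \<gamma> i else 0)) = (\<Prod>i\<in>J. q D i k powi \<gamma> i)"
    by (simp add: prod_powi_if[OF fin k])
  have a3: "(\<Prod>i\<in>J. \<Prod>j\<in>J. q D i j powi (if i = k then if j = k then 1 else 0 else 0)) = q D k k"
    by (subst prod.swap) (simp add: prod_powi_if[OF fin k])
  have 2: "(\<Prod>i\<in>J. \<Prod>j\<in>J. q D i j powi (?\<gamma> i * ?\<gamma> j)) = (\<Prod>i\<in>J. \<Prod>j\<in>J. q D i j powi (\<gamma> i * \<gamma> j))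
      * (\<Prod>j\<in>J. q D k j powi \<gamma> j) * (\<Prod>j\<in>J. q D j k powi \<gamma> j) * q D k k"
    unfolding \<gamma>\<gamma> by (simp only: power_int_add q_nz simp_thms disj_not1 not_False_eq_True prod.distrib a1 a2 a3)
  have 3: "tw \<chi> ?\<gamma> (KL D k) = \<chi> (KL D k) * ((\<Prod>j\<in>J. (q D k j * q D j k) powi \<gamma> j) * (q D k k * q D k k))"
    unfolding tw_KL[OF J k] \<gamma> using prod_powi_if[OF fin k, of "\<lambda>j. q D k j * q D j k" "\<lambda>_. 1"]
    by (simp add: power_int_add prod.distrib)
  show ?thesis unfolding Hf_def 1 2 3
    by (simp add: power_int_mult_distrib prod.distrib mult_ac)
qed

lemma Hf_nz: "character \<chi> \<Longrightarrow> Hf \<chi> J \<gamma> \<noteq> 0"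
  using character_nz by (auto simp: Hf_def)

lemma Gprop_Hf:
  assumes J: "closedJ J" and \<chi>: "character \<chi>"
  shows "Gprop \<chi> J (\<lambda>\<gamma>. inverse (Hf \<chi> J \<gamma>))"
  unfolding Gprop_def
proof (intro conjI allI impI)
  fix \<gamma> :: "'i \<Rightarrow> int" and i assume i: "i \<in> J"
  have "tw \<chi> (\<gamma>(i := \<gamma> i + 1)) (KL D i) \<noteq> 0" by (intro character_nz character_tw \<chi>)
  then show "inverse (Hf \<chi> J (\<gamma>(i := \<gamma> i + 1))) * tw \<chi> (\<gamma>(i := \<gamma> i + 1)) (KL D i) = inverse (Hf \<chi> J \<gamma>)"
    unfolding Hf_upd[OF J i \<chi>] using Hf_nz[OF \<chi>] by (simp add: field_simps)
next
  fix \<gamma> :: "'i \<Rightarrow> int" and i assume i: "i \<notin> J"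
  have "(\<gamma>(i := \<gamma> i + 1)) j = \<gamma> j" if "j \<in> J" for j using i that by auto
  then show "inverse (Hf \<chi> J (\<gamma>(i := \<gamma> i + 1))) = inverse (Hf \<chi> J \<gamma>)"
    unfolding Hf_def by (simp cong: prod.cong)
qed

text \<open>Squaring symmetrises \<open>q D i j\<close> to \<open>q D i j * q D j i\<close>, the
  value of a character at \<open>KL\<close>. The square thus depends on the two weights only through
  their values there, which dominance turns into powers of \<open>q D i i\<close>.\<close>

lemma Hf_square:
  assumes J: "closedJ J"
  shows "Hf \<chi> J \<gamma> * Hf \<chi> J \<gamma> = (\<Prod>i\<in>J. (\<chi> (KL D i) * tw \<chi> \<gamma> (KL D i) * q D i i * q D i i) powi \<gamma> i)"
proof -
  have sw: "(\<Prod>i\<in>J. \<Prod>j\<in>J. q D j i powi (\<gamma> j * \<gamma> i)) = (\<Prod>i\<in>J. \<Prod>j\<in>J. q D i j powi (\<gamma> i * \<gamma> j))"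
    by (rule prod.swap)
  have "(\<chi> (KL D i) * tw \<chi> \<gamma> (KL D i) * q D i i * q D i i) powi \<gamma> i
      = (\<chi> (KL D i) * q D i i) powi \<gamma> i * (\<chi> (KL D i) * q D i i) powi \<gamma> i
        * (\<Prod>j\<in>J. q D i j powi (\<gamma> i * \<gamma> j)) * (\<Prod>j\<in>J. q D j i powi (\<gamma> j * \<gamma> i))" if "i \<in> J" for i
    unfolding tw_KL[OF J that]
    by (simp add: power_int_mult_distrib prod_power_int prod.distrib power_int_mult[symmetric] mult_ac)
  then have "(\<Prod>i\<in>J. (\<chi> (KL D i) * tw \<chi> \<gamma> (KL D i) * q D i i * q D i i) powi \<gamma> i)
    = (\<Prod>i\<in>J. (\<chi> (KL D i) * q D i i) powi \<gamma> i * (\<chi> (KL D i) * q D i i) powi \<gamma> i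
        * (\<Prod>j\<in>J. q D i j powi (\<gamma> i * \<gamma> j)) * (\<Prod>j\<in>J. q D j i powi (\<gamma> j * \<gamma> i)))"
    by (intro prod.cong refl)
  also have "\<dots> = Hf \<chi> J \<gamma> * Hf \<chi> J \<gamma>"
    unfolding prod.distrib[of _ _ J] sw Hf_def by (simp only: mult_ac)
  finally show ?thesis ..
qed

text \<open>Along an edge, reading the Cartan condition in both directions equates negative powers
  of the two diagonal entries.\<close>

lemma component_powers:
  assumes ct: "cartan_type D" and j: "(i, j) \<in> {(i, j). cartan D i j \<noteq> 0}\<^sup>*"
  shows "\<exists>A B. A > 0 \<and> B > 0 \<and> q D j j ^ A = q D i i ^ B"
  using j
proof (induction rule: rtrancl_induct)
  case (step j k)
  then obtain A B where AB: "A > 0" "B > 0" "q D j j ^ A = q D i i ^ B" by blast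
  show ?case
  proof (cases "j = k")
    case False
    have gcm: "generalized_cartan_matrix (cartan D)"
      and c: "\<And>i j. q D i j * q D j i = q D i i powi cartan D i j" using ct by (auto simp: cartan_type_def)
    have "cartan D j k \<noteq> 0" "cartan D k j \<noteq> 0" "cartan D j k \<le> 0" "cartan D k j \<le> 0"
      using gcm step(2) False by (auto simp: generalized_cartan_matrix_def)
    moreover define a b where "a = nat (- cartan D j k)" "b = nat (- cartan D k j)"
    ultimately have ab: "cartan D j k = - int a" "cartan D k j = - int b" "a > 0" "b > 0" by auto
    have "q D j j powi cartan D j k = q D k k powi cartan D k j"
      using c[of j k] c[of k j] by (simp add: mult.commute)
    then have "q D j j ^ a = q D k k ^ b" by (simp add: ab power_int_minus)
    then have "q D k k ^ (b * A) = q D i i ^ (B * a)"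
      by (metis AB(3) mult.commute power_mult)
    then show ?thesis using AB ab by (intro exI[of _ "b * A"] exI[of _ "B * a"]) simp
  qed (use AB in blast)
qed (auto intro: exI[of _ 1])

text \<open>A common power rewrites the relation as a single power of \<open>q D i i\<close>.
  Genericity makes the total exponent 0, and as a sum of natural numbers it cannot cancel.\<close>

lemma component_independent:
  assumes ct: "cartan_type D" and gen: "generic D"
    and J: "J = {j. (i, j) \<in> {(i, j). cartan D i j \<noteq> 0}\<^sup>*}" and one: "(\<Prod>j\<in>J. q D j j ^ n j) = 1"
  shows "n i = 0"
proof -
  have "\<forall>j\<in>J. \<exists>A B. A > 0 \<and> B > 0 \<and> q D j j ^ A = q D i i ^ B"
    using component_powers[OF ct] J by blast
  then obtain A B where AB: "\<And>j. j \<in> J \<Longrightarrow> A j > 0 \<and> B j > 0 \<and> q D j j ^ A j = q D i i ^ (B j :: nat)"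
    by metis
  \<comment> \<open>The cofactor of \<open>A j\<close> in the product of all \<open>A k\<close>:
    raising to the full product makes \<open>q D j j\<close> occur through
    \<open>q D j j ^ A j\<close>.\<close>
  define P where "P = (\<lambda>j. \<Prod>k\<in>J - {j}. A k :: nat)"
  have fin: "finite J" by simp
  have P: "A j * P j = (\<Prod>k\<in>J. A k)" if "j \<in> J" for j
    unfolding P_def using prod.remove[OF fin that, of A] by simp
  have "1 = (\<Prod>j\<in>J. q D j j ^ n j) ^ (\<Prod>k\<in>J. A k)" using one by simp
  also have "\<dots> = (\<Prod>j\<in>J. (q D j j ^ n j) ^ (\<Prod>k\<in>J. A k))" by (rule prod_power_distrib)
  also have "\<dots> = (\<Prod>j\<in>J. q D i i ^ (B j * (n j * P j)))"
  proof (rule prod.cong)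
    fix j assume j: "j \<in> J"
    have "(q D j j ^ n j) ^ (\<Prod>k\<in>J. A k) = (q D j j ^ A j) ^ (n j * P j)"
      unfolding P[OF j, symmetric] by (simp add: power_mult[symmetric] mult_ac)
    then show "(q D j j ^ n j) ^ (\<Prod>k\<in>J. A k) = q D i i ^ (B j * (n j * P j))"
      using AB[OF j] by (simp add: power_mult)
  qed simp
  also have "\<dots> = q D i i ^ (\<Sum>j\<in>J. B j * (n j * P j))" by (rule power_sum[symmetric])
  finally have "q D i i ^ (\<Sum>j\<in>J. B j * (n j * P j)) = 1" ..
  then have "(\<Sum>j\<in>J. B j * (n j * P j)) = 0"
    using gen unfolding generic_def by (metis less_one not_le)
  moreover have i: "i \<in> J" using J by simp
  ultimately have "B i * (n i * P i) = 0" using fin by simp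
  moreover have "P i > 0" unfolding P_def using AB by (intro prod_pos) auto
  ultimately show ?thesis using AB[OF i] by simp
qed

text \<open>\<open>J\<close> is the component of a letter \<open>i\<close> of
  \<open>\<beta>\<close>. Equal eigenvalues would give a relation among powers of the
  \<open>q D j j\<close> with exponents \<open>(m j + m' j + 2) * count \<beta> j\<close>, and the 2
  keeps the exponent at \<open>i\<close> positive even for trivial weights. The sign of
  \<open>\<gamma>\<close> only inverts the relation: minus is used for simplicity, plus for
  lifting.\<close>

lemma separating_Casimir:
  assumes ct: "cartan_type D" and gen: "generic D" and \<chi>: "character \<chi>"
    and m: "\<And>i. \<chi> (KL D i) = q D i i ^ m i" and m': "\<And>i. tw \<chi> \<gamma> (KL D i) = q D i i ^ m' i"
    and \<gamma>: "\<gamma> = cnt \<beta> \<or> \<gamma> = (\<lambda>i. - cnt \<beta> i)" and \<beta>: "\<beta> \<noteq> {#}"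
  shows "\<exists>J G. closedJ J \<and> Gprop \<chi> J G \<and> G \<gamma> \<noteq> G (\<lambda>i. 0)"
proof -
  obtain i where i: "i \<in># \<beta>" using \<beta> by blast
  define R where "R = {(i, j). cartan D i j \<noteq> 0}"
  define J where "J = {j. (i, j) \<in> R\<^sup>*}"
  have gcm: "generalized_cartan_matrix (cartan D)"
    and c: "\<And>i j. q D i j * q D j i = q D i i powi cartan D i j" using ct by (auto simp: cartan_type_def)
  have J: "closedJ J" unfolding closedJ_def
  proof (intro allI impI)
    fix j k assume jk: "j \<in> J" "k \<notin> J"
    have "cartan D j k = 0"
    proof (rule ccontr)
      assume "cartan D j k \<noteq> 0"
      then have "(j, k) \<in> R" by (simp add: R_def)
      with jk(1) have "(i, k) \<in> R\<^sup>*" unfolding J_def by (auto intro: rtrancl_into_rtrancl)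
      with jk(2) show False by (simp add: J_def)
    qed
    then show "q D j k * q D k j = 1" by (simp add: c)
  qed
  have "Hf \<chi> J \<gamma> \<noteq> 1"
  proof
    assume 1: "Hf \<chi> J \<gamma> = 1"
    define d where "d = (\<lambda>j. m j + m' j + 2)"
    have "\<chi> (KL D j) * tw \<chi> \<gamma> (KL D j) * q D j j * q D j j = q D j j ^ d j" for j
      by (simp add: m m' d_def power_add power2_eq_square mult_ac)
    then have "(\<Prod>j\<in>J. (q D j j ^ d j) powi \<gamma> j) = 1"
      using Hf_square[OF J, of \<chi> \<gamma>] 1 by simp
    then have "(\<Prod>j\<in>J. q D j j ^ (d j * count \<beta> j)) = 1"
      using \<gamma> prod_inversef[of "\<lambda>j. q D j j ^ (d j * count \<beta> j)" J]
      by (auto simp: power_int_minus power_mult comp_def inverse_eq_1_iff)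
    then have "(\<Prod>j\<in>J. q D j j ^ ((m j + m' j + 2) * count \<beta> j)) = 1" by (simp only: d_def)
    from component_independent[OF ct gen J_def[unfolded R_def] this] i show False
      by (auto simp flip: count_greater_zero_iff)
  qed
  moreover have "Hf \<chi> J (\<lambda>i. 0) = 1" by (simp add: Hf_def)
  ultimately show ?thesis
    using J Gprop_Hf[OF J \<chi>] by (intro exI[of _ J] exI[of _ "\<lambda>\<gamma>. inverse (Hf \<chi> J \<gamma>)"]) (simp add: inverse_eq_1_iff)
qed

section \<open>Primitive vectors\<close>

definition subm :: "'v set \<Rightarrow> bool" where
  "subm Z \<longleftrightarrow> subspace Z \<and> (\<forall>x\<in>Z. \<forall>i h. e i x \<in> Z \<and> w i x \<in> Z \<and> g h x \<in> Z)"

text \<open>The rank one computation, done modulo \<open>Z\<close> so that it covers primitive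
  vectors as well as vectors primitive modulo \<open>PV\<close>. At the first power of
  \<open>w i\<close> that lies in \<open>Z\<close> the coefficient must vanish, and genericity
  leaves \<open>p ^ N * \<mu> (KL D i) = 1\<close> as the only reason.\<close>

lemma dominant_weight:
  assumes gen: "generic D" and Z: "subm Z" and x: "wt \<mu> x" "x \<notin> Z" "e i x \<in> Z"
    and n: "(w i ^^ n) x \<in> Z"
  shows "\<exists>N. \<mu> (KL D i) = q D i i ^ N \<and> (w i ^^ Suc N) x \<in> Z"
proof -
  define p where "p = inverse (q D i i)"
  let ?M = "\<mu> (KL D i)" and ?y = "\<lambda>k. (w i ^^ k) x"
  have sZ: "subspace Z" and wZ: "\<And>y. y \<in> Z \<Longrightarrow> w i y \<in> Z" and eZ: "\<And>y. y \<in> Z \<Longrightarrow> e i y \<in> Z"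
    using Z by (auto simp: subm_def)
  have qn: "q D i i ^ Suc n \<noteq> 1" for n
    using gen[unfolded generic_def, rule_format, of "Suc n" i] by simp
  have p: "p \<noteq> 0" "p \<noteq> 1" "p ^ Suc n \<noteq> 1" for n
    using qn[of 0] qn[of n] by (simp_all add: p_def power_inverse inverse_eq_1_iff del: power_Suc)
  have gy: "g (KL D i) (?y k) = (p ^ (2 * k) * ?M) *s ?y k" for k
  proof (induction k)
    case 0
    then show ?case using x by (simp add: wt_def)
  next
    case (Suc k)
    have "inverse (chr D i (KL D i)) = p ^ 2" by (simp add: chr_KL p_def power2_eq_square)
    with Suc show ?case by (simp add: g_w w_scale power_add power2_eq_square mult_ac)
  qed
  have g0: "g 0 (?y k) = ?y k" for k using wt_g0[OF x(1)] by (cases k) (simp_all add: g0_w)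
  \<comment> \<open>The coefficient is a product of two q-numbers; the factor
    \<open>(1 - p) * p\<close> states this without division.\<close>
  have key: "\<exists>c. e i (?y (Suc k)) - (l i * c) *s ?y k \<in> Z
      \<and> c * (1 - p) * p = (1 - p ^ Suc k) * (p ^ Suc k * ?M - p)" for k
  proof (induction k)
    case 0
    have "e i (?y (Suc 0)) - (l i * (?M - 1)) *s ?y 0 = p *s w i (e i x)"
      using gy[of 0] g0[of 0] by (simp add: link p_def algebra_simps)
    also have "\<dots> \<in> Z" using sZ wZ x(3) by (simp add: subspace_scale)
    finally show ?case by (intro exI[of _ "?M - 1"]) (simp add: algebra_simps)
  next
    case (Suc k)
    then obtain c where c: "e i (?y (Suc k)) - (l i * c) *s ?y k \<in> Z"
      "c * (1 - p) * p = (1 - p ^ Suc k) * (p ^ Suc k * ?M - p)" by blast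
    \<comment> \<open>One more \<open>w i\<close> multiplies the old coefficient by \<open>p\<close>
      and adds the eigenvalue of the group element on \<open>?y (Suc k)\<close>, less 1.\<close>
    define c' where "c' = p * c + p ^ (2 * Suc k) * ?M - 1"
    have "e i (?y (Suc (Suc k))) = p *s w i (e i (?y (Suc k))) + l i *s ((p ^ (2 * Suc k) * ?M) *s ?y (Suc k) - ?y (Suc k))"
      using gy[of "Suc k"] g0[of "Suc k"] link[of i i "?y (Suc k)"] by (simp add: p_def)
    then have "e i (?y (Suc (Suc k))) - (l i * c') *s ?y (Suc k)
      = p *s w i (e i (?y (Suc k))) - (p * (l i * c)) *s ?y (Suc k)"
      by (simp add: c'_def algebra_simps)
    also have "\<dots> = p *s w i (e i (?y (Suc k)) - (l i * c) *s ?y k)"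
      by (simp add: w_diff w_scale scale_right_diff_distrib)
    also have "\<dots> \<in> Z" using c(1) wZ sZ by (blast intro: subspace_scale)
    finally have 1: "e i (?y (Suc (Suc k))) - (l i * c') *s ?y (Suc k) \<in> Z" .
    have sq: "p ^ (2 * Suc k) = p ^ Suc k * p ^ Suc k" by (simp only: mult_2 power_add)
    have "c' * (1 - p) * p = p * (c * (1 - p) * p) + (p ^ (2 * Suc k) * ?M - 1) * (1 - p) * p"
      by (simp add: c'_def algebra_simps)
    also have "\<dots> = (1 - p ^ Suc (Suc k)) * (p ^ Suc (Suc k) * ?M - p)"
      unfolding c(2) sq by (simp add: algebra_simps)
    finally show ?case using 1 by blast
  qed
  define m where "m = (LEAST m. ?y m \<in> Z)"
  have m: "?y m \<in> Z" unfolding m_def using n by (rule LeastI)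
  obtain N where N: "m = Suc N" using m x(2) by (cases m) auto
  have yN: "?y N \<notin> Z" using N not_less_Least[of N "\<lambda>m. ?y m \<in> Z"] unfolding m_def by simp
  obtain c where c: "e i (?y (Suc N)) - (l i * c) *s ?y N \<in> Z"
      "c * (1 - p) * p = (1 - p ^ Suc N) * (p ^ Suc N * ?M - p)" using key by blast
  have "e i (?y (Suc N)) \<in> Z" using eZ m N by blast
  from subspace_diff[OF sZ this c(1)] have lc: "(l i * c) *s ?y N \<in> Z" by simp
  have "l i * c = 0"
  proof (rule ccontr)
    assume nz: "l i * c \<noteq> 0"
    from subspace_scale[OF sZ lc, of "inverse (l i * c)"] nz have "?y N \<in> Z"
      by (simp del: mult_eq_0_iff inverse_mult_distrib)
    with yN show False ..
  qed
  then have "c = 0" by simp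
  with c(2) p have "p ^ Suc N * ?M = p" by simp
  then have "p ^ N * ?M = 1" using p(1) by simp
  then have "?M = q D i i ^ N" by (simp add: p_def field_simps)
  with m N show ?thesis by blast
qed

text \<open>For \<open>h\<close> separating two weights, \<open>g h - \<nu> h\<close> removes the
  component at \<open>\<nu>\<close> and rescales the one at \<open>\<mu>\<close> by a nonzero
  factor.\<close>

lemma weight_components:
  assumes K: "subspace K" "\<And>h x. x \<in> K \<Longrightarrow> g h x \<in> K"
    and "finite F" "\<And>\<mu>. \<mu> \<in> F \<Longrightarrow> wt \<mu> (f \<mu>)" "(\<Sum>\<mu>\<in>F. f \<mu>) \<in> K" "\<mu> \<in> F"
  shows "f \<mu> \<in> K"
  using assms(3-)
proof (induction F arbitrary: f \<mu> rule: finite_induct)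
  case (insert \<nu> F)
  have F: "f \<mu> \<in> K" if \<mu>: "\<mu> \<in> F" for \<mu>
  proof -
    have "\<mu> \<noteq> \<nu>" using insert \<mu> by auto
    then obtain h where h: "\<mu> h \<noteq> \<nu> h" by auto
    have "g h (\<Sum>\<mu>\<in>insert \<nu> F. f \<mu>) - \<nu> h *s (\<Sum>\<mu>\<in>insert \<nu> F. f \<mu>) \<in> K"
      using insert.prems K by (intro subspace_diff subspace_scale) auto
    also have "g h (\<Sum>\<mu>\<in>insert \<nu> F. f \<mu>) - \<nu> h *s (\<Sum>\<mu>\<in>insert \<nu> F. f \<mu>)
        = (\<Sum>\<mu>\<in>insert \<nu> F. (\<mu> h - \<nu> h) *s f \<mu>)"
      unfolding g_sum scale_sum_right sum_subtractf[symmetric]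
      using insert.prems(1) by (intro sum.cong refl) (auto simp: wt_def scale_left_diff_distrib)
    also have "\<dots> = (\<Sum>\<mu>\<in>F. (\<mu> h - \<nu> h) *s f \<mu>)" using insert(1,2) by simp
    finally have "(\<Sum>\<mu>\<in>F. (\<mu> h - \<nu> h) *s f \<mu>) \<in> K" .
    from insert.IH[OF _ this \<mu>] have "(\<mu> h - \<nu> h) *s f \<mu> \<in> K"
      using insert.prems(1) by (auto intro: wt_scale)
    from subspace_scale[OF K(1) this, of "inverse (\<mu> h - \<nu> h)"] h show ?thesis by simp
  qed
  show ?case
  proof (cases "\<mu> = \<nu>")
    case True
    have "(\<Sum>\<mu>\<in>insert \<nu> F. f \<mu>) - (\<Sum>\<mu>\<in>F. f \<mu>) \<in> K"
      by (rule subspace_diff[OF K(1) insert.prems(2) subspace_sum[OF K(1) F]])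
    then show ?thesis using insert(1,2) True by simp
  qed (use F insert.prems in auto)
qed simp

lemma weight_decomposition:
  assumes S: "\<And>s. s \<in> S \<Longrightarrow> \<exists>\<mu>. wt \<mu> s" and x: "x \<in> span S"
  shows "\<exists>F f. finite F \<and> x = (\<Sum>\<mu>\<in>F. f \<mu>) \<and> (\<forall>\<mu>\<in>F. wt \<mu> (f \<mu>) \<and> f \<mu> \<in> span {s\<in>S. wt \<mu> s})"
proof -
  have "\<exists>F f. finite F \<and> x = (\<Sum>\<mu>\<in>F. f \<mu>) \<and> (\<forall>\<mu>. f \<mu> \<in> span {s\<in>S. wt \<mu> s}) \<and> (\<forall>\<mu>\<in>F. character \<mu>) \<and> (\<forall>\<mu>. \<mu> \<notin> F \<longrightarrow> f \<mu> = 0)"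
    using x
  proof (induction rule: span_induct_alt)
    case base
    show ?case by (rule exI[of _ "{}"], rule exI[of _ "\<lambda>_. 0"]) (simp add: span_zero)
  next
    case (step c x y)
    then obtain F f where F: "finite F" "y = (\<Sum>\<mu>\<in>F. f \<mu>)" "\<forall>\<mu>. f \<mu> \<in> span {s\<in>S. wt \<mu> s}"
      "\<forall>\<mu>\<in>F. character \<mu>" "\<forall>\<mu>. \<mu> \<notin> F \<longrightarrow> f \<mu> = 0" by blast
    obtain \<nu> where \<nu>: "wt \<nu> x" using S[OF step(1)] by blast
    let ?f = "f(\<nu> := c *s x + f \<nu>)"
    have "c *s x + y = (\<Sum>\<mu>\<in>insert \<nu> F. ?f \<mu>)"
    proof -
      have "(\<Sum>\<mu>\<in>insert \<nu> F. ?f \<mu>) = ?f \<nu> + (\<Sum>\<mu>\<in>F - {\<nu>}. ?f \<mu>)"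
        using F(1) by (metis sum.insert_remove)
      also have "(\<Sum>\<mu>\<in>F - {\<nu>}. ?f \<mu>) = (\<Sum>\<mu>\<in>F - {\<nu>}. f \<mu>)" by (intro sum.cong) auto
      finally have 1: "(\<Sum>\<mu>\<in>insert \<nu> F. ?f \<mu>) = ?f \<nu> + (\<Sum>\<mu>\<in>F - {\<nu>}. f \<mu>)" .
      have "f \<nu> + (\<Sum>\<mu>\<in>F - {\<nu>}. f \<mu>) = y"
        using F(1,2,5) by (cases "\<nu> \<in> F") (simp_all add: sum.remove[symmetric])
      with 1 show ?thesis by (simp add: add.assoc)
    qed
    moreover have "?f \<mu> \<in> span {s\<in>S. wt \<mu> s}" for \<mu>
    proof (cases "\<mu> = \<nu>")
      case True
      have "x \<in> {s\<in>S. wt \<nu> s}" using \<nu> step(1) by simp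
      with F(3) show ?thesis unfolding True fun_upd_same by (intro span_add span_scale) (blast intro: span_base)+
    qed (use F(3) in simp)
    ultimately show ?case using F(1,4,5) wt_character[OF \<nu>]
      by (intro exI[of _ "insert \<nu> F"] exI[of _ ?f]) auto
  qed
  then obtain F f where F: "finite F" "x = (\<Sum>\<mu>\<in>F. f \<mu>)" "\<forall>\<mu>. f \<mu> \<in> span {s\<in>S. wt \<mu> s}"
      "\<forall>\<mu>\<in>F. character \<mu>" by blast
  have "wt \<mu> y" if "character \<mu>" "y \<in> span {s\<in>S. wt \<mu> s}" for \<mu> y
    using that(2) by (induction rule: span_induct_alt) (auto intro: wt_add wt_scale wt_zero that)
  with F show ?thesis by blast
qed

lemma weight_extract:
  assumes S: "\<And>s. s \<in> S \<Longrightarrow> \<exists>\<mu>. wt \<mu> s" and x: "x \<in> span S" "wt \<mu> x"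
  shows "x \<in> span {s\<in>S. wt \<mu> s}"
proof -
  obtain F f where F: "finite F" "x = (\<Sum>\<mu>\<in>F. f \<mu>)" "\<forall>\<mu>\<in>F. wt \<mu> (f \<mu>) \<and> f \<mu> \<in> span {s\<in>S. wt \<mu> s}"
    using weight_decomposition[OF S x(1)] by blast
  \<comment> \<open>The weight \<open>\<mu>\<close> may be missing from \<open>F\<close>; its
    component is then 0.\<close>
  define f0 where "f0 = (\<lambda>\<nu>. if \<nu> \<in> F then f \<nu> else 0)"
  let ?f = "\<lambda>\<nu>. f0 \<nu> - (if \<nu> = \<mu> then x else 0)"
  have "x = (\<Sum>\<nu>\<in>insert \<mu> F. f0 \<nu>)"
    unfolding F(2) f0_def using F(1) by (intro sum.mono_neutral_cong_left) auto
  then have s: "(\<Sum>\<nu>\<in>insert \<mu> F. ?f \<nu>) = 0" using F(1) by (simp add: sum_subtractf)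
  have c: "character \<mu>" using wt_character[OF x(2)] .
  have "?f \<mu> \<in> {0}"
  proof (rule weight_components[where F = "insert \<mu> F" and f = ?f])
    fix \<nu> assume "\<nu> \<in> insert \<mu> F"
    then have cn: "character \<nu>" using c F(3) wt_character by blast
    show "wt \<nu> (?f \<nu>)"
    proof (rule wt_diff)
      show "wt \<nu> (f0 \<nu>)" using F(3) cn by (simp add: f0_def wt_zero)
      show "wt \<nu> (if \<nu> = \<mu> then x else 0)" using x(2) cn by (simp add: wt_zero)
    qed
  qed (use F s in \<open>auto simp: subspace_single_0\<close>)
  then have "x = f0 \<mu>" by simp
  then show ?thesis using F(3) by (auto simp: f0_def span_zero split: if_splits)
qed

lemma subm_zero: "subm {0}" by (simp add: subm_def subspace_single_0)

lemma subm_span: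
  assumes "\<And>s i. s \<in> S \<Longrightarrow> e i s \<in> span S" "\<And>s i. s \<in> S \<Longrightarrow> w i s \<in> span S"
    "\<And>s h. s \<in> S \<Longrightarrow> g h s \<in> span S"
  shows "subm (span S)"
proof -
  have "f x \<in> span S" if "x \<in> span S" "\<And>x y. f (x + y) = f x + f y" "\<And>a x. f (a *s x) = a *s f x"
    "\<And>s. s \<in> S \<Longrightarrow> f s \<in> span S" for f x
    using that(1)
  proof (induction rule: span_induct_alt)
    case base
    then show ?case using that(3)[of 0 0] by (simp add: span_zero)
  next
    case (step c x y)
    show ?case unfolding that(2,3) by (intro span_add span_scale that(4) step)
  qed
  then show ?thesis unfolding subm_def
    by (auto simp: assms e_add e_scale w_add w_scale g_add g_scale)
qed

definition hw :: "'v \<Rightarrow> 'v set" where "hw x = span (range (\<lambda>u. foldr w u x))"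

lemma wt_hw: "wt \<mu> x \<Longrightarrow> wt (tw \<mu> (\<lambda>i. - cnt (mset u) i)) (foldr w u x)"
  using wt_fw[of \<mu> "\<lambda>_. 0" x u] by simp

lemma subm_hw:
  assumes x: "prim x" "wt \<mu> x" shows "subm (hw x)"
  unfolding hw_def
proof (rule subm_span, goal_cases)
  case (1 s i)
  then obtain u where s: "s = foldr w u x" by auto
  have "{foldr w u' x | u'. add_mset i (mset u') = mset u} \<subseteq> range (\<lambda>u. foldr w u x)" by auto
  from subsetD[OF span_mono[OF this] e_hw[OF x]] show ?case unfolding s .
next
  case (2 s i)
  then obtain u where s: "s = foldr w u x" by auto
  have "w i s = foldr w (i # u) x" by (simp add: s)
  then show ?case by (metis span_base rangeI)
next
  case (3 s h)
  then obtain u where s: "s = foldr w u x" by auto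
  then show ?case using wt_hw[OF x(2), of u] 3 by (auto simp: wt_def intro: span_scale span_base)
qed

lemma hw_locally_nilpotent:
  assumes x: "prim x" "wt \<mu> x" and "y \<in> hw x"
  shows "\<exists>N. \<forall>b. length b \<ge> N \<longrightarrow> foldr e b y = 0"
  using assms(3) unfolding hw_def
proof (induction rule: span_induct_alt)
  case base
  show ?case by (simp add: fe_linear)
next
  case (step c y z)
  then obtain N where N: "\<And>b. length b \<ge> N \<Longrightarrow> foldr e b z = 0" by blast
  obtain u where u: "y = foldr w u x" using step by auto
  have "foldr e b (c *s y + z) = 0" if "length b \<ge> max N (Suc (length u))" for b
    using that N[of b] hw_kill[OF x, of u b] by (simp add: fe_linear u)
  then show ?case by blast
qed

lemma tw_inj:
  assumes reg: "regular D" and \<chi>: "character \<chi>" and eq: "tw \<chi> a = tw \<chi> b"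
  shows "a = b"
proof -
  have "(\<Prod>i\<in>UNIV. chr D i h powi (a i - b i)) = 1" for h
  proof -
    have "(\<Prod>i\<in>UNIV. chr D i h powi a i) = (\<Prod>i\<in>UNIV. chr D i h powi b i)"
      using fun_cong[OF eq, of h] character_nz[OF \<chi>, of h] by (simp add: tw_def)
    moreover have "(\<Prod>i\<in>UNIV. chr D i h powi b i) \<noteq> 0" by simp
    ultimately show ?thesis by (simp add: power_int_diff prod_dividef)
  qed
  then have "\<forall>i. a i - b i = 0" using reg[unfolded regular_def, rule_format, of "\<lambda>i. a i - b i"] by simp
  then show ?thesis by auto
qed

lemma dominant_prim:
  assumes "generic D" "prim x" "wt \<mu> x" "x \<noteq> 0" and "\<And>i. \<exists>n. (w i ^^ n) x = 0"
  shows "\<exists>m. \<forall>i. \<mu> (KL D i) = q D i i ^ m i \<and> (w i ^^ Suc (m i)) x = 0"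
proof -
  have "\<exists>N. \<mu> (KL D i) = q D i i ^ N \<and> (w i ^^ Suc N) x = 0" for i
  proof -
    obtain n where "(w i ^^ n) x = 0" using assms(5) by blast
    then show ?thesis using dominant_weight[OF assms(1) subm_zero assms(3), of i n] assms(2,4)
      by (simp add: prim_def)
  qed
  then show ?thesis by metis
qed

text \<open>A longest word in \<open>e\<close> not killing a weight vector of \<open>K\<close>
  yields a primitive \<open>z\<close> in \<open>K\<close>. By regularity, \<open>z\<close> is a
  combination of words in \<open>w\<close> with one multiset of letters \<open>\<alpha>\<close>. If
  \<open>\<alpha>\<close> is nonempty, the Casimir acts on \<open>z\<close> both by the scalar of
  \<open>x\<close> and by that of a primitive vector of the weight of \<open>z\<close>, against
  separation. So \<open>z\<close> is a multiple of \<open>x\<close>.\<close>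

theorem integrable_hw_simple:
  assumes gen: "generic D" and reg: "regular D" and ct: "cartan_type D"
    and x: "prim x" "wt \<chi> x" and nil: "\<And>i y. y \<in> hw x \<Longrightarrow> \<exists>n. (w i ^^ n) y = 0"
    and K: "subm K" "K \<subseteq> hw x" and k: "k \<in> K" "k \<noteq> 0"
  shows "x \<in> K"
proof -
  let ?S = "range (\<lambda>u. foldr w u x)"
  have sK: "subspace K" and eK: "\<And>y i. y \<in> K \<Longrightarrow> e i y \<in> K" and gK: "\<And>y h. y \<in> K \<Longrightarrow> g h y \<in> K"
    using K by (auto simp: subm_def)
  have wS: "\<exists>\<mu>. wt \<mu> s" if "s \<in> ?S" for s using that wt_hw[OF x(2)] by blast
  have "k \<in> span ?S" using k K by (auto simp: hw_def)
  from weight_decomposition[OF wS this] obtain F f where F: "finite F" "k = (\<Sum>\<mu>\<in>F. f \<mu>)"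
    "\<forall>\<mu>\<in>F. wt \<mu> (f \<mu>)" by blast
  have fK: "f \<mu> \<in> K" if "\<mu> \<in> F" for \<mu>
    by (rule weight_components[OF sK gK F(1) _ _ that]) (use F k in auto)
  obtain \<mu> where \<mu>: "\<mu> \<in> F" "f \<mu> \<noteq> 0" using k(2) F(2) by (metis sum.neutral)
  define y where "y = f \<mu>"
  have y: "y \<in> K" "y \<noteq> 0" "wt \<mu> y" using \<mu> fK F by (auto simp: y_def)
  obtain N where N: "\<And>b. length b \<ge> N \<Longrightarrow> foldr e b y = 0"
    using hw_locally_nilpotent[OF x] y(1) K(2) by blast
  have "\<forall>b. foldr e b y \<noteq> 0 \<longrightarrow> length b < N" using N by (metis not_le)
  then obtain b where b: "foldr e b y \<noteq> 0" "\<And>b'. foldr e b' y \<noteq> 0 \<Longrightarrow> length b' \<le> length b"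
    using ex_has_greatest_nat[of "\<lambda>b. foldr e b y \<noteq> 0" "[]" length N] y(2) by auto
  define z where "z = foldr e b y"
  define \<nu> where "\<nu> = tw \<mu> (\<lambda>i. 0 + cnt (mset b) i)"
  have z0: "z \<noteq> 0" using b by (simp add: z_def)
  have zp: "prim z" unfolding prim_def z_def using b(2)[of "_ # b"] by force
  have "foldr e b y \<in> K" for b using y(1) eK by (induction b) auto
  then have zK: "z \<in> K" by (simp add: z_def)
  have z\<nu>: "wt \<nu> z" unfolding \<nu>_def z_def by (rule wt_fe) (simp add: y)
  \<comment> \<open>Words that vanish on \<open>x\<close> are dropped: zero has every weight, so
    their letters could not be recovered from it.\<close>
  have "z \<in> span (?S - {0})" using zK K(2) by (auto simp: hw_def)
  from weight_extract[OF _ this z\<nu>] wS have zs: "z \<in> span {s \<in> ?S - {0}. wt \<nu> s}" by blast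
  have "{s \<in> ?S - {0}. wt \<nu> s} \<noteq> {}"
  proof
    assume "{s \<in> ?S - {0}. wt \<nu> s} = {}"
    with zs have "z \<in> span {}" by (simp only:)
    with z0 show False by simp
  qed
  then obtain u0 where u0: "foldr w u0 x \<noteq> 0" "wt \<nu> (foldr w u0 x)" by blast
  define \<alpha> where "\<alpha> = mset u0"
  have \<nu>: "\<nu> = tw \<chi> (\<lambda>i. - cnt \<alpha> i)" 
    unfolding \<alpha>_def by (rule wt_unique[OF u0(2) wt_hw[OF x(2)] u0(1)])
  have "mset u = \<alpha>" if "foldr w u x \<noteq> 0" "wt \<nu> (foldr w u x)" for u
  proof -
    have "tw \<chi> (\<lambda>i. - cnt \<alpha> i) = tw \<chi> (\<lambda>i. - cnt (mset u) i)"
      unfolding \<nu>[symmetric] by (rule wt_unique[OF that(2) wt_hw[OF x(2)] that(1)])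
    from tw_inj[OF reg wt_character[OF x(2)] this] show ?thesis
      by (intro multiset_eqI) (metis neg_equal_iff_equal of_nat_eq_iff)
  qed
  then have "{s \<in> ?S - {0}. wt \<nu> s} \<subseteq> {foldr w u x | u. mset u = \<alpha>}" by blast
  with zs have z\<alpha>: "z \<in> span {foldr w u x | u. mset u = \<alpha>}" using span_mono by blast
  have "\<alpha> = {#}"
  proof (rule ccontr)
    assume \<alpha>: "\<alpha> \<noteq> {#}"
    have x0: "x \<noteq> 0" using u0(1) fw_linear(3) by metis
    have "x \<in> hw x" unfolding hw_def by (rule span_base) (metis foldr.simps(1) id_apply rangeI)
    then obtain m where m: "\<And>i. \<chi> (KL D i) = q D i i ^ m i"
      using dominant_prim[OF gen x x0] nil by blast
    obtain m' where m': "\<And>i. tw \<chi> (\<lambda>i. - cnt \<alpha> i) (KL D i) = q D i i ^ m' i"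
      using dominant_prim[OF gen zp z\<nu> z0] nil zK K(2) unfolding \<nu> by blast
    obtain J G where JG: "closedJ J" "Gprop \<chi> J G" "G (\<lambda>i. - cnt \<alpha> i) \<noteq> G (\<lambda>i. 0)"
      using separating_Casimir[OF ct gen wt_character[OF x(2)] m m' _ \<alpha>] by blast
    have "Cas J G (\<lambda>i. 0 - cnt \<alpha> i) (Suc (size \<alpha>)) z = G (\<lambda>i. 0) *s z"
      using z\<alpha>
    proof (induction rule: span_induct_alt)
      case base
      show ?case using Cas_linear(2)[of _ _ _ _ 0 0] by simp
    next
      case (step c y y')
      then obtain u where u: "y = foldr w u x" "mset u = \<alpha>" by blast
      have "length u < Suc (size \<alpha>)" unfolding u(2)[symmetric] by simp
      from Cas_hw[OF JG(1,2) x(1) _ this, of "\<lambda>i. 0"] x(2) u step(2)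
      show ?case by (simp add: Cas_linear scale_right_distrib scale_left_commute)
    qed
    moreover have "Cas J G (\<lambda>i. 0 - cnt \<alpha> i) (Suc (size \<alpha>)) z = G (\<lambda>i. 0 - cnt \<alpha> i) *s z"
      by (rule Cas_prim[OF zp])
    ultimately show False using JG(3) z0 by simp
  qed
  then have "z \<in> span {x}" using z\<alpha> by simp
  then obtain c where c: "z = c *s x" by (auto simp: span_singleton)
  with z0 have "x = inverse c *s z" by auto
  then show ?thesis using subspace_scale[OF sK zK] by metis
qed

section \<open>Complete reducibility\<close>

definition PV :: "'v set" where "PV = span {foldr w u x | u x \<mu>. prim x \<and> wt \<mu> x}"

lemma subm_PV: "subm PV"
  unfolding PV_def
proof (rule subm_span, goal_cases)
  case (1 s i)
  then obtain u x \<mu> where s: "s = foldr w u x" "prim x" "wt \<mu> x" by auto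
  have "range (\<lambda>u. foldr w u x) \<subseteq> {foldr w u x | u x \<mu>. prim x \<and> wt \<mu> x}" using s by auto
  from span_mono[OF this] subm_hw[OF s(2,3)] s(1) show ?case
    unfolding hw_def subm_def by (meson rangeI span_base subsetD)
next
  case (2 s i)
  then obtain u x \<mu> where s: "s = foldr w u x" "prim x" "wt \<mu> x" by auto
  then have "w i s = foldr w (i # u) x" by simp
  with s show ?case by (intro span_base) blast
next
  case (3 s h)
  then obtain u x \<mu> where s: "s = foldr w u x" "prim x" "wt \<mu> x" by auto
  have "g h s = tw \<mu> (\<lambda>i. - cnt (mset u) i) h *s s" using wt_hw[OF s(3), of u] by (simp add: wt_def s(1))
  then show ?case by (simp only:) (intro span_scale span_base 3)
qed

lemma span_finite_subset: "y \<in> span B \<Longrightarrow> \<exists>F. finite F \<and> F \<subseteq> B \<and> y \<in> span F"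
proof (induction rule: span_induct_alt)
  case base
  show ?case by (intro exI[of _ "{}"]) simp
next
  case (step c x y)
  then obtain F where F: "finite F" "F \<subseteq> B" "y \<in> span F" by blast
  have "c *s x + y \<in> span (insert x F)"
    using span_mono[of F "insert x F"] F by (intro span_add span_scale) (auto intro: span_base)
  then show ?case using F step by (intro exI[of _ "insert x F"]) auto
qed

text \<open>If \<open>z\<close> has weight \<open>\<chi>\<close> shifted by \<open>\<beta>\<close>,
  these vectors have the weight of \<open>e i v\<close> for \<open>v\<close> of weight
  \<open>\<chi>\<close>.\<close>

definition gens :: "('v \<times> 'i multiset) set \<Rightarrow> 'i \<Rightarrow> 'v set" where
  "gens S i = {foldr w u z | u z \<beta>. (z, \<beta>) \<in> S \<and> add_mset i (mset u) = \<beta>}"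

lemma gens_in_PV:
  assumes "\<And>z \<beta>. (z, \<beta>) \<in> S \<Longrightarrow> prim z \<and> wt (tw \<chi> (cnt \<beta>)) z"
  shows "span (gens S i) \<subseteq> PV"
  unfolding PV_def gens_def using assms by (intro span_mono) blast

text \<open>
  By induction on \<open>S\<close>: a Casimir operator that separates \<open>\<chi>\<close> from the weight of the new element
  \<open>(z, \<beta>)\<close>, minus its eigenvalue there, maps \<open>v\<close> to a vector to which the induction hypothesis
  applies. On the other hand the operator acts on \<open>v\<close> as a different scalar modulo \<open>PV\<close>.
\<close>

lemma lift_primitive:
  assumes gen: "generic D" and ct: "cartan_type D" and \<chi>: "character \<chi>"
    and m: "\<And>i. \<chi> (KL D i) = q D i i ^ m i"
    and nilw: "\<And>i y. \<exists>n. (w i ^^ n) y = 0"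
    and nile: "\<And>y. \<exists>N. \<forall>b. length b \<ge> N \<longrightarrow> foldr e b y = 0"
    and S: "finite S" "\<And>z \<beta>. (z, \<beta>) \<in> S \<Longrightarrow> prim z \<and> wt (tw \<chi> (cnt \<beta>)) z"
    and v: "wt \<chi> v" "\<And>i. e i v \<in> span (gens S i)"
  shows "v \<in> PV"
  using S v
proof (induction S arbitrary: v rule: finite_induct)
  case empty
  then have "prim v" by (simp add: prim_def gens_def)
  moreover have "v = foldr w [] v" by simp
  ultimately show ?case using empty unfolding PV_def by (intro span_base) blast
next
  case (insert p S)
  obtain x \<beta> where p: "p = (x, \<beta>)" by force
  have x: "prim x" "wt (tw \<chi> (cnt \<beta>)) x" using insert.prems(1)[of x \<beta>] p by auto
  have SS: "prim z \<and> wt (tw \<chi> (cnt \<beta>)) z" if "(z, \<beta>) \<in> S" for z \<beta> using insert.prems(1) that by blast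
  show ?case
  proof (cases "x = 0 \<or> \<beta> = {#}")
    case True
    \<comment> \<open>A zero \<open>x\<close> contributes only 0, and an empty
      \<open>\<beta>\<close> no word at all, since \<open>\<beta>\<close> must contain
      \<open>i\<close>.\<close>
    have "gens (insert p S) i \<subseteq> insert 0 (gens S i)" for i
      using True by (auto simp: gens_def p fw_linear)
    then have "span (gens (insert p S) i) \<subseteq> span (gens S i)" for i
      by (metis span_insert_0 span_mono)
    then show ?thesis using insert.prems(2,3) SS by (intro insert.IH) blast+
  next
    case False
    then obtain m' where m': "\<And>i. tw \<chi> (cnt \<beta>) (KL D i) = q D i i ^ m' i"
      using dominant_prim[OF gen x] nilw by blast
    obtain J G where JG: "closedJ J" "Gprop \<chi> J G" "G (cnt \<beta>) \<noteq> G (\<lambda>i. 0)"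
      using separating_Casimir[OF ct gen \<chi> m m', of \<beta>] False by blast
    obtain N0 where N0: "\<And>b. length b \<ge> N0 \<Longrightarrow> foldr e b v = 0" using nile by blast
    \<comment> \<open>Large enough for both truncations: words in \<open>e\<close> longer than
      \<open>N\<close> kill \<open>v\<close>, and the words in \<open>w\<close> that occur in the
      generators are shorter than \<open>N\<close>.\<close>
    define N where "N = N0 + (\<Sum>(z, \<beta>)\<in>insert p S. size \<beta>)"
    have N: "size \<beta>' \<le> N" if "(z, \<beta>') \<in> insert p S" for z \<beta>'
    proof -
      have "(\<lambda>(z, \<beta>). size \<beta>) (z, \<beta>') \<le> (\<Sum>(z, \<beta>)\<in>insert p S. size \<beta>)"
        using that insert(1) by (intro member_le_sum) auto
      then show ?thesis by (simp add: N_def)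
    qed
    have ev: "Cas J G (\<lambda>j. if j = i then 1 else 0) N' (foldr w u z) = G (cnt \<beta>') *s foldr w u z"
      if "(z, \<beta>') \<in> insert p S" "add_mset i (mset u) = \<beta>'" "N' \<ge> N" for i N' u z \<beta>'
    proof -
      have \<gamma>: "(\<lambda>j. if j = i then 1 else 0) = (\<lambda>j. cnt \<beta>' j - cnt (mset u) j)"
        using that(2) by (intro ext) auto
      have "length u < size \<beta>'" unfolding that(2)[symmetric] by simp
      then have "length u < N'" using N[OF that(1)] that(3) by linarith
      then show ?thesis unfolding \<gamma> using insert.prems(1)[OF that(1)] by (intro Cas_hw[OF JG(1,2)]) auto
    qed
    define v' where "v' = Cas J G (\<lambda>i. 0) (Suc N) v - G (cnt \<beta>) *s v"
    have "wt \<chi> (Cas J G (\<lambda>i. 0) (Suc N) v)" using wt_Cas[of \<chi> "\<lambda>i. 0"] insert.prems(2) by simp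
    then have v'wt: "wt \<chi> v'" unfolding v'_def by (intro wt_diff wt_scale insert.prems(2))
    have step: "Cas J G (\<lambda>j. if j = i then 1 else 0) N' y - G (cnt \<beta>) *s y \<in> span (gens S i)"
      if "y \<in> span (gens (insert p S) i)" "N' \<ge> N" for y i N'
      using that(1)
    proof (induction rule: span_induct_alt)
      case base
      show ?case using Cas_linear(2)[of _ _ _ _ 0 0] by (simp add: span_zero)
    next
      case (step c y y')
      let ?C = "Cas J G (\<lambda>j. if j = i then 1 else 0) N'"
      obtain u z \<beta>' where y: "y = foldr w u z" "(z, \<beta>') \<in> insert p S" "add_mset i (mset u) = \<beta>'"
        using step(1) unfolding gens_def by blast
      have "?C y - G (cnt \<beta>) *s y = (G (cnt \<beta>') - G (cnt \<beta>)) *s y"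
        using ev[OF y(2,3) that(2)] by (simp add: y(1) scale_left_diff_distrib)
      also have "\<dots> \<in> span (gens S i)"
      proof (cases "(z, \<beta>') \<in> S")
        case True
        then have "y \<in> gens S i" unfolding gens_def using y by blast
        then show ?thesis by (intro span_scale span_base)
      qed (use y p in \<open>auto simp: span_zero\<close>)
      finally have "c *s (?C y - G (cnt \<beta>) *s y) + (?C y' - G (cnt \<beta>) *s y') \<in> span (gens S i)"
        using step(2) by (intro span_add span_scale)
      also have "c *s (?C y - G (cnt \<beta>) *s y) + (?C y' - G (cnt \<beta>) *s y')
          = ?C (c *s y + y') - G (cnt \<beta>) *s (c *s y + y')"
        by (simp add: Cas_linear scale_right_diff_distrib scale_right_distrib scale_left_commute algebra_simps)
      finally show ?case .
    qed
    have "e i v' \<in> span (gens S i)" for i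
    proof -
      have v0: "wt (tw \<chi> (\<lambda>i. 0)) v" using insert.prems(2) by simp
      have d: "(\<lambda>i. 0)(i := 0 + 1) = (\<lambda>j. if j = i then 1 else (0::int))" by auto
      \<comment> \<open>Passing \<open>e i\<close> lowers the truncation only for \<open>i\<close>
        in \<open>J\<close>; \<open>step\<close> holds at every level from \<open>N\<close> on and
        covers both cases.\<close>
      have "\<exists>N'\<ge>N. e i (Cas J G (\<lambda>i. 0) (Suc N) v) = Cas J G (\<lambda>j. if j = i then 1 else 0) N' (e i v)"
      proof (cases "i \<in> J")
        case True
        have "e i (Cas J G (\<lambda>i. 0) (Suc N) v) = Cas J G ((\<lambda>i. 0)(i := 0 + 1)) N (e i v)"
          by (rule e_Cas[OF JG(2) True v0]) (use N0 N_def in auto)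
        then show ?thesis unfolding d by blast
      next
        case False
        have "e i (Cas J G (\<lambda>i. 0) (Suc N) v) = Cas J G ((\<lambda>i. 0)(i := 0 + 1)) (Suc N) (e i v)"
          by (rule Cas_commute_outside(1)[OF JG(1,2) False v0])
        then show ?thesis unfolding d by (intro exI[of _ "Suc N"]) simp
      qed
      then show ?thesis unfolding v'_def using step[OF insert.prems(3)] by (auto simp: e_diff e_scale)
    qed
    then have "v' \<in> PV" using insert.IH[of v'] SS v'wt by blast
    moreover have "Cas J G (\<lambda>i. 0) (Suc N) v - G (\<lambda>i. 0) *s v \<in> PV"
    proof -
      have sP: "subspace PV" and wP: "\<And>y i. y \<in> PV \<Longrightarrow> w i y \<in> PV" and eP: "\<And>y i. y \<in> PV \<Longrightarrow> e i y \<in> PV"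
        using subm_PV by (auto simp: subm_def)
      have evP: "e i v \<in> PV" for i
        using insert.prems(3) gens_in_PV[OF insert.prems(1)] by blast
      have feP: "foldr e b y \<in> PV" if "y \<in> PV" for b y using that eP by (induction b) auto
      have fwP: "foldr w b y \<in> PV" if "y \<in> PV" for b y using that wP by (induction b) auto
      \<comment> \<open>Every nonempty degree first applies some \<open>e i\<close> to
        \<open>v\<close> and so lands in \<open>PV\<close>; the empty degree gives the
        scalar.\<close>
      have "Cas J G (\<lambda>i. 0) (Suc N) v = G (\<lambda>i. 0) *s v
          + (\<Sum>\<beta>\<in>ms J (Suc N) - {{#}}. (lam \<beta> * G (\<lambda>i. 0 + cnt \<beta> i)) *s Xop (\<lambda>x. x) \<beta> v)"
        unfolding Cas_def by (subst sum.remove[OF finite_ms, of "{#}"]) (auto simp: ms_def Xop_empty lam_def)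
      moreover have "Xop (\<lambda>x. x) \<beta> v \<in> PV" if "\<beta> \<noteq> {#}" for \<beta>
      proof -
        have "foldr e b v \<in> PV" if "b \<in> Wd \<beta>" for b
          using that \<open>\<beta> \<noteq> {#}\<close> by (cases b rule: rev_cases) (auto simp: Wd_iff intro: feP evP)
        then show ?thesis unfolding Xop_def
          by (intro subspace_sum[OF sP]) (auto intro: subspace_scale[OF sP] fwP)
      qed
      ultimately show ?thesis by (auto intro!: subspace_sum[OF sP] subspace_scale[OF sP])
    qed
    moreover have sP: "subspace PV" using subm_PV by (simp add: subm_def)
    ultimately have "v' - (Cas J G (\<lambda>i. 0) (Suc N) v - G (\<lambda>i. 0) *s v) \<in> PV"
      using subspace_diff by blast
    also have "v' - (Cas J G (\<lambda>i. 0) (Suc N) v - G (\<lambda>i. 0) *s v) = (G (\<lambda>i. 0) - G (cnt \<beta>)) *s v"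
      by (simp add: v'_def scale_left_diff_distrib)
    finally have "inverse (G (\<lambda>i. 0) - G (cnt \<beta>)) *s ((G (\<lambda>i. 0) - G (cnt \<beta>)) *s v) \<in> PV"
      by (rule subspace_scale[OF sP])
    then show ?thesis using JG(3) by simp
  qed
qed

text \<open>Provides the finite set that \<open>lift_primitive\<close> inducts on. The weight of
  \<open>e i v\<close> fixes the weight of the primitive generator under each nonvanishing
  word.\<close>

lemma wt_in_PV_gens:
  assumes v: "wt \<mu> v" and ev: "e i v \<in> PV"
  shows "\<exists>S. finite S \<and> (\<forall>z \<beta>. (z, \<beta>) \<in> S \<longrightarrow> prim z \<and> wt (tw \<mu> (cnt \<beta>)) z) \<and> e i v \<in> span (gens S i)"
proof -
  let ?G = "{foldr w u x | u x \<mu>. prim x \<and> wt \<mu> x}"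
  have "(\<lambda>i. 0)(i := 0 + 1) = (\<lambda>j. if j = i then 1 else (0::int))" by auto
  with wt_e[of \<mu> "\<lambda>i. 0" v i] v have ew: "wt (tw \<mu> (\<lambda>j. if j = i then 1 else 0)) (e i v)" by simp
  have "\<exists>\<nu>. wt \<nu> s" if "s \<in> ?G - {0}" for s using that wt_hw by blast
  moreover have "e i v \<in> span (?G - {0})" using ev by (simp add: PV_def)
  moreover define T where "T = {s \<in> ?G - {0}. wt (tw \<mu> (\<lambda>j. if j = i then 1 else 0)) s}"
  ultimately have "e i v \<in> span T"
    unfolding T_def by (intro weight_extract ew)
  then obtain F where F': "finite F" "F \<subseteq> T" "e i v \<in> span F" using span_finite_subset by blast
  note F = F'[unfolded T_def]
  have "\<forall>s\<in>F. \<exists>u x. s = foldr w u x \<and> prim x \<and> wt (tw \<mu> (cnt (add_mset i (mset u)))) x"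
  proof
    fix s assume "s \<in> F"
    then obtain u x \<nu> where s: "s = foldr w u x" "prim x" "wt \<nu> x" "s \<noteq> 0"
      "wt (tw \<mu> (\<lambda>j. if j = i then 1 else 0)) s" using F(2) by blast
    have "tw \<nu> (\<lambda>i. - cnt (mset u) i) = tw \<mu> (\<lambda>j. if j = i then 1 else 0)"
      using wt_unique[OF wt_hw[OF s(3)] _ s(4)[unfolded s(1)]] s(5) unfolding s(1) by blast
    then have "tw (tw \<nu> (\<lambda>i. - cnt (mset u) i)) (cnt (mset u))
      = tw (tw \<mu> (\<lambda>j. if j = i then 1 else 0)) (cnt (mset u))" by simp
    moreover have "(\<lambda>j. (if j = i then 1 else 0) + cnt (mset u) j) = cnt (add_mset i (mset u))" by auto
    ultimately have "\<nu> = tw \<mu> (cnt (add_mset i (mset u)))" unfolding tw_tw by simp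
    with s show "\<exists>u x. s = foldr w u x \<and> prim x \<and> wt (tw \<mu> (cnt (add_mset i (mset u)))) x" by blast
  qed
  then obtain U X where UX: "\<And>s. s \<in> F \<Longrightarrow> s = foldr w (U s) (X s) \<and> prim (X s)
      \<and> wt (tw \<mu> (cnt (add_mset i (mset (U s))))) (X s)" by metis
  let ?S = "(\<lambda>s. (X s, add_mset i (mset (U s)))) ` F"
  have "F \<subseteq> gens ?S i" unfolding gens_def using UX by blast
  then have "e i v \<in> span (gens ?S i)" using F(3) span_mono by blast
  then show ?thesis using F(1) UX by (intro exI[of _ ?S]) auto
qed

text \<open>Induction on the length from which words in \<open>e\<close> kill \<open>v\<close>; it
  drops for \<open>e i v\<close>. If \<open>v\<close> were outside \<open>PV\<close>, the rank one
  computation modulo \<open>PV\<close> would make its weight dominant, and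
  \<open>lift_primitive\<close> would apply.\<close>

theorem integrable_generated_by_primitive:
  assumes gen: "generic D" and ct: "cartan_type D"
    and nilw: "\<And>i y. \<exists>n. (w i ^^ n) y = 0"
    and nile: "\<And>y. \<exists>N. \<forall>b. length b \<ge> N \<longrightarrow> foldr e b y = 0"
    and v: "wt \<mu> v"
  shows "v \<in> PV"
proof -
  obtain N where "\<And>b. length b \<ge> N \<Longrightarrow> foldr e b v = 0" using nile by blast
  then show ?thesis using v
  proof (induction N arbitrary: v \<mu>)
    case 0
    then have "v = 0" using 0(1)[of "[]"] by simp
    then show ?case by (simp add: PV_def span_zero)
  next
    case (Suc N)
    have ev: "e i v \<in> PV" for i
    proof (rule Suc.IH)
      show "foldr e b (e i v) = 0" if "N \<le> length b" for b
        using Suc.prems(1)[of "b @ [i]"] that by simp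
      show "wt (tw \<mu> ((\<lambda>i. 0)(i := 0 + 1))) (e i v)" using Suc.prems(2) by (intro wt_e) simp
    qed
    show ?case
    proof (rule ccontr)
      assume nv: "v \<notin> PV"
      have "\<exists>N. \<mu> (KL D i) = q D i i ^ N" for i
      proof -
        obtain n where "(w i ^^ n) v = 0" using nilw by blast
        then have "(w i ^^ n) v \<in> PV" by (simp add: PV_def span_zero)
        from dominant_weight[OF gen subm_PV Suc.prems(2) nv ev this] show ?thesis by blast
      qed
      then obtain m where m: "\<And>i. \<mu> (KL D i) = q D i i ^ m i" by metis
      have "\<forall>i. \<exists>S. finite S \<and> (\<forall>z \<beta>. (z, \<beta>) \<in> S \<longrightarrow> prim z \<and> wt (tw \<mu> (cnt \<beta>)) z) \<and> e i v \<in> span (gens S i)"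
        using wt_in_PV_gens[OF Suc.prems(2) ev] by blast
      then obtain S where S: "\<And>i. finite (S i)" "\<And>i z \<beta>. (z, \<beta>) \<in> S i \<Longrightarrow> prim z \<and> wt (tw \<mu> (cnt \<beta>)) z"
        "\<And>i. e i v \<in> span (gens (S i) i)" by metis
      have "gens (S i) i \<subseteq> gens (\<Union>(range S)) i" for i unfolding gens_def by blast
      then have eS: "e i v \<in> span (gens (\<Union>(range S)) i)" for i using S(3) span_mono by blast
      have "v \<in> PV"
      proof (rule lift_primitive[where S = "\<Union>(range S)", OF gen ct wt_character[OF Suc.prems(2)] m nilw nile])
        show "finite (\<Union>(range S))" using S(1) by simp
        show "prim z \<and> wt (tw \<mu> (cnt \<beta>)) z" if "(z, \<beta>) \<in> \<Union>(range S)" for z \<beta>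
          using that S(2) by blast
      qed (fact Suc.prems(2) eS)+
      with nv show False ..
    qed
  qed
qed

section \<open>Quantum Serre relations and local nilpotency of highest weight modules\<close>

lemma evW_mult_right: "evW (t * word [y]) x = evW t (w y x)"
  by (induction t rule: pm_induct) (simp_all add: distrib_right lext_add single_mult_word)

lemma serre_vanishes:
  assumes ct: "cartan_type D" and ij: "i \<noteq> j"
  shows "\<exists>n. \<forall>x. evW (serre (pW D) i j n) x = 0"
proof -
  have "generalized_cartan_matrix (cartan D)" and c: "q D i j * q D j i = q D i i powi cartan D i j"
    using ct by (auto simp: cartan_type_def)
  then have "cartan D i j \<le> 0" using ij by (auto simp: generalized_cartan_matrix_def)
  then obtain a where a: "cartan D i j = - int a" by (metis nonneg_int_cases neg_0_le_iff_le minus_minus)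
  have "q D i i ^ a * (q D i j * q D j i) = 1" unfolding c a by (simp add: power_int_minus)
  then have "inverse (q D i i ^ a * (q D i j * q D j i)) = 1" by simp
  then have "pW D i i ^ a * pW D i j * pW D j i = 1"
    by (simp add: power_inverse mult_ac)
  then have "serre (pW D) i j (Suc a) \<in> Rad (pW D)" by (rule serre_in_Rad[OF ij])
  then show ?thesis using radW by blast
qed

text \<open>A \<open>w i\<close> in front of the Serre element of level \<open>k\<close> either
  raises the level or moves on to \<open>y\<close>. Level \<open>M\<close> is zero and
  \<open>y\<close> absorbs at most \<open>m\<close> of them, so \<open>N + k \<ge> m + M\<close>
  suffices; level 0 is \<open>w j\<close>.\<close>

lemma w_nilpotent_step:
  assumes ct: "cartan_type D" and y: "(w i ^^ m) y = 0"
  shows "\<exists>n. (w i ^^ n) (w j y) = 0"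
proof (cases "i = j")
  case True
  have "(w i ^^ m) (w i y) = w i ((w i ^^ m) y)" by (simp add: funpow_swap1)
  then show ?thesis using y True by auto
next
  case False
  let ?Z = "\<lambda>k. evW (serre (pW D) i j k)"
  obtain M where M: "\<And>x. ?Z M x = 0" using serre_vanishes[OF ct False] by blast
  define c where "c = (\<lambda>k. pW D i i ^ k * pW D i j)"
  have Zs: "?Z (Suc k) x = w i (?Z k x) - c k *s ?Z k (w i x)" for k x
    by (simp add: lext_diff lext_scl evW_mult evW_mult_right c_def)
  have w0: "(w i ^^ N) 0 = 0" for N by (induction N) auto
  have wlin: "(w i ^^ N) (x + x') = (w i ^^ N) x + (w i ^^ N) x'" "(w i ^^ N) (b *s x) = b *s (w i ^^ N) x"
    for N b x x' by (induction N) (auto simp: w_add w_scale)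
  have Z0: "?Z k 0 = 0" for k by (simp add: lext_def fw_linear)
  have ZM: "?Z k x = 0" if "k \<ge> M" for k x using that
    by (induction arbitrary: x rule: dec_induct) (simp_all add: M Zs del: serre.simps)
  have "(w i ^^ N) (?Z k y) = 0" if "(w i ^^ m) y = 0" "N + k \<ge> m + M" for N k m y
    using that
  proof (induction N arbitrary: k m y)
    case 0
    then show ?case using ZM by (simp del: serre.simps)
  next
    case (Suc N)
    show ?case
    proof (cases m)
      case 0
      then show ?thesis using Suc.prems by (simp add: Z0 w0 del: serre.simps)
    next
      case (Suc m')
      have "(w i ^^ m') (w i y) = 0" using Suc.prems(1) Suc by (simp add: funpow_swap1)
      then have 1: "(w i ^^ N) (?Z k (w i y)) = 0"
        by (rule Suc.IH) (use Suc.prems(2) Suc in simp)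
      have 2: "(w i ^^ N) (?Z (Suc k) y) = 0"
        by (rule Suc.IH[OF Suc.prems(1)]) (use Suc.prems(2) in simp)
      have "(w i ^^ Suc N) (?Z k y) = (w i ^^ N) (?Z (Suc k) y + c k *s ?Z k (w i y))"
        unfolding Zs by (simp add: funpow_swap1 del: serre.simps)
      then show ?thesis by (simp only: wlin 1 2 scale_zero_right add_0_left)
    qed
  qed
  from this[of m y "m + M" 0] y show ?thesis by auto
qed

text \<open>Needed for \<open>L(\<chi>)\<close>, whose relations only let powers of
  \<open>w i\<close> kill the generator.\<close>

lemma hw_w_nilpotent:
  assumes ct: "cartan_type D" and x: "\<And>i. \<exists>n. (w i ^^ n) x = 0" and y: "y \<in> hw x"
  shows "\<exists>n. (w i ^^ n) y = 0"
proof -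
  have w0: "(w i ^^ N) 0 = 0" for N by (induction N) auto
  have up: "(w i ^^ N) z = 0" if "(w i ^^ n) z = 0" "n \<le> N" for n N z
  proof -
    have "(w i ^^ N) z = (w i ^^ (N - n)) ((w i ^^ n) z)"
      using that(2) by (simp flip: funpow_add[unfolded comp_def, THEN fun_cong] add: comp_def)
    then show ?thesis using that(1) w0 by simp
  qed
  have wlin: "(w i ^^ N) (x + x') = (w i ^^ N) x + (w i ^^ N) x'" "(w i ^^ N) (b *s x) = b *s (w i ^^ N) x"
    for N b x x' by (induction N) (auto simp: w_add w_scale)
  have fw: "\<exists>n. (w i ^^ n) (foldr w u x) = 0" for u
    by (induction u) (use x w_nilpotent_step[OF ct] in auto)
  show ?thesis using y unfolding hw_def
  proof (induction rule: span_induct_alt)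
    case base
    show ?case using w0 by blast
  next
    case (step c s z)
    then obtain n m where "(w i ^^ n) s = 0" "(w i ^^ m) z = 0" using fw by blast
    then have "(w i ^^ (n + m)) (c *s s + z) = 0" using up[of n s "n + m"] up[of m z "n + m"]
      by (simp add: wlin)
    then show ?case by blast
  qed
qed

end

section \<open>Representations on quotients of the regular module\<close>

abbreviation amult :: "('g::ab_group_add, 'i::finite, 'k::field) yd_datum \<Rightarrow>
    ('g, 'i, 'k) smash \<Rightarrow> ('g, 'i, 'k) smash \<Rightarrow> ('g, 'i, 'k) smash" where
  "amult D x y \<equiv> x \<otimes>\<^bsub>smash_alg D\<^esub> y"

abbreviation sone :: "('g::ab_group_add, 'i::finite, 'k::field) smash" where
  "sone \<equiv> Poly_Mapping.single ([], 0) 1"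

lemma amult_eq: "amult D = tw_mult (\<lambda>(u, g) (u', g'). wchar (chr_VW D) u' g)"
  by (simp add: smash_alg_def fun_eq_iff)

lemma smash_simps [simp]: "carrier (smash_alg D) = UNIV" "\<one>\<^bsub>smash_alg D\<^esub> = sone"
  "\<zero>\<^bsub>smash_alg D\<^esub> = 0" "x \<oplus>\<^bsub>smash_alg D\<^esub> y = x + y"
  by (simp_all add: smash_alg_def)

lemma amult_single:
  "amult D (Poly_Mapping.single (u, g) a) (Poly_Mapping.single (u', g') b)
    = Poly_Mapping.single (u @ u', g + g') (wchar (chr_VW D) u' g * a * b)"
  by (simp add: amult_eq tw_mult_single plus_list_def)

lemma amult_linear:
  "amult D (x + x') y = amult D x y + amult D x' y" "amult D x (y + y') = amult D x y + amult D x y'"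
  "amult D 0 y = 0" "amult D x 0 = 0"
  by (simp_all add: amult_eq tw_mult_add_left tw_mult_add_right)

lemma amult_scl: "amult D (scl a x) y = scl a (amult D x y)" "amult D x (scl a y) = scl a (amult D x y)"
proof -
  have *: "amult D (scl a (Poly_Mapping.single s b)) (Poly_Mapping.single t c)
      = scl a (amult D (Poly_Mapping.single s b) (Poly_Mapping.single t c))"
    "amult D (Poly_Mapping.single s b) (scl a (Poly_Mapping.single t c))
      = scl a (amult D (Poly_Mapping.single s b) (Poly_Mapping.single t c))" for s t b c
    by (cases s; cases t; simp add: amult_single mult_ac)+
  have 1: "amult D (scl a (Poly_Mapping.single s b)) y = scl a (amult D (Poly_Mapping.single s b) y)"
    "amult D (Poly_Mapping.single s b) (scl a y) = scl a (amult D (Poly_Mapping.single s b) y)" for s b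
    by (induction y rule: pm_induct) (simp_all only: * amult_linear pm.scale_right_distrib pm.scale_zero_right)
  show "amult D (scl a x) y = scl a (amult D x y)"
    by (induction x rule: pm_induct) (simp_all only: 1 amult_linear pm.scale_right_distrib pm.scale_zero_right)
  show "amult D x (scl a y) = scl a (amult D x y)"
    by (induction x rule: pm_induct) (simp_all only: 1 amult_linear pm.scale_right_distrib pm.scale_zero_right)
qed

lemma amult_diff: "amult D (x - x') y = amult D x y - amult D x' y" "amult D x (y - y') = amult D x y - amult D x y'"
  using amult_linear(1)[of D "x - x'" x' y] by (simp, use amult_linear(2)[of D x "y - y'" y'] in simp)

text \<open>The quotient of the smash product by a left ideal containing the relations of
  \<open>U\<close>, with \<open>P\<close> choosing representatives. Both \<open>L(\<chi>)\<close>
  and the submodule generated by a vector have this form.\<close>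

locale left_ideal_rep =
  fixes D :: "('g::ab_group_add, 'i::finite, 'k::field) yd_datum" and l :: "'i \<Rightarrow> 'k"
    and J :: "('g, 'i, 'k) smash set" and P :: "('g, 'i, 'k) smash \<Rightarrow> ('g, 'i, 'k) smash"
  assumes rd: "reduced_datum D" and lp: "linking_parameter l"
    and J_left: "\<And>x s. x \<in> J \<Longrightarrow> amult D s x \<in> J" and U_J: "U_ideal D l \<subseteq> J"
    and lin: "Vector_Spaces.linear scl scl P"
    and P0: "\<And>x. P x = 0 \<longleftrightarrow> x \<in> J" and PJ: "\<And>x. x - P x \<in> J"
begin

definition "eJ i x = P (amult D (vgen i) x)"
definition "wJ i x = P (amult D (wgen i) x)"
definition "gJ h x = P (amult D (grp h) x)"

sublocale smash: ring "smash_alg D"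
  using rd by (intro ring_smash_alg) (simp add: reduced_datum_def)

sublocale I: ideal "U_ideal D l" "smash_alg D" by (rule ring_U_alg[OF rd])

lemma P_add: "P (x + y) = P x + P y" and P_scl: "P (scl a x) = scl a (P x)"
  using lin by (simp_all add: linear_scl_iff pm.vector_space_axioms)

lemma P_zero [simp]: "P 0 = 0" using P_scl[of 0 0] by simp

lemma P_diff: "P (x - y) = P x - P y" using P_add[of "x - y" y] by simp

lemma P_amult_P: "P (amult D s (P x)) = P (amult D s x)"
proof -
  have "P (amult D s (x - P x)) = 0" using J_left[OF PJ] P0 by blast
  then show ?thesis by (simp add: amult_diff P_diff)
qed

lemma P_U_ideal: "x \<in> U_ideal D l \<Longrightarrow> P (amult D x y) = 0"
proof -
  assume "x \<in> U_ideal D l"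
  then have "amult D x y \<in> U_ideal D l" by (intro I.I_r_closed) auto
  then show ?thesis using U_J P0 by blast
qed

lemma amult_assoc: "amult D (amult D x y) z = amult D x (amult D y z)"
  by (rule smash.m_assoc) auto

lemma wch: "wchar (chr_VW D) [] h = 1" "wchar (chr_VW D) (x # u) 0 = wchar (chr_VW D) u 0"
  "wchar (chr_VW D) [x] h = chr_VW D x h" "wchar (chr_VW D) u 0 = 1"
proof -
  have "chr_VW D x 0 = 1" for x
    using rd by (auto simp: chr_VW_def reduced_datum_def character_def split: sum.splits)
  then show "wchar (chr_VW D) (x # u) 0 = wchar (chr_VW D) u 0" "wchar (chr_VW D) u 0 = 1"
    by (simp_all add: wchar_def) (induction u, auto)
qed (simp_all add: wchar_def)

lemma chr_VW_simps: "chr_VW D (Inl i) h = chr D i h" "chr_VW D (Inr i) h = inverse (chr D i h)"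
  by (simp_all add: chr_VW_def)

lemma gens_commute:
  "amult D (grp h) (vgen i) = scl (chr D i h) (amult D (vgen i) (grp h))"
  "amult D (grp h) (wgen i) = scl (inverse (chr D i h)) (amult D (wgen i) (grp h))"
  "amult D (grp h) (grp h') = grp (h + h')"
  by (simp_all add: grp_def vgen_def wgen_def amult_single wch chr_VW_simps)

text \<open>The empty word is excluded because it acts as the identity and not as
  \<open>P\<close>.\<close>

lemma foldr_eJ:
  assumes "u \<noteq> []" shows "foldr eJ u x = P (amult D (Poly_Mapping.single (map Inl u, 0) 1) x)"
  using assms
proof (induction u)
  case (Cons i u)
  have "amult D (vgen i) (Poly_Mapping.single (map Inl u, 0) 1) = Poly_Mapping.single (map Inl (i # u), 0) 1"
    by (simp add: vgen_def amult_single wch)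
  with Cons show ?case
    by (cases u) (simp_all add: eJ_def P_amult_P amult_assoc[symmetric] vgen_def)
qed simp

lemma foldr_wJ:
  assumes "u \<noteq> []" shows "foldr wJ u x = P (amult D (Poly_Mapping.single (map Inr u, 0) 1) x)"
  using assms
proof (induction u)
  case (Cons i u)
  have "amult D (wgen i) (Poly_Mapping.single (map Inr u, 0) 1) = Poly_Mapping.single (map Inr (i # u), 0) 1"
    by (simp add: wgen_def amult_single wch)
  with Cons show ?case
    by (cases u) (simp_all add: wJ_def P_amult_P amult_assoc[symmetric] wgen_def)
qed simp

text \<open>Elements of a Nichols ideal have no constant term, so the exception at the empty word
  does no harm.\<close>

lemma lext_P_push:
  fixes t :: "'i list \<Rightarrow>\<^sub>0 'k"
  assumes "Poly_Mapping.lookup t [] = 0"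
    and "\<And>u. u \<noteq> [] \<Longrightarrow> F u = P (amult D (Poly_Mapping.single (f u) 1) x)"
  shows "lext scl F t = P (amult D (push f t) x)"
proof -
  have "lext scl F t = lext scl (\<lambda>u. P (amult D (Poly_Mapping.single (f u) 1) x)) t"
    by (intro pm.lext_cong assms(2)) (use assms(1) in \<open>auto simp: in_keys_iff\<close>)
  also have "\<dots> = (\<Sum>u\<in>Poly_Mapping.keys t. P (amult D (Poly_Mapping.single (f u) (Poly_Mapping.lookup t u)) x))"
    unfolding lext_def by (intro sum.cong refl) (simp flip: P_scl amult_scl)
  also have "\<dots> = P (amult D (push f t) x)"
  proof -
    have "P (amult D (sum h A) x) = (\<Sum>u\<in>A. P (amult D (h u) x))" for h :: "'i list \<Rightarrow> _" and A
      by (induction A rule: infinite_finite_induct)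
        (simp_all add: amult_linear P_add P_scl[of 0 0, simplified])
    then show ?thesis by (simp add: push_def)
  qed
  finally show ?thesis .
qed

lemma nichols_lookup: "t \<in> nichols_ideal d c \<Longrightarrow> Poly_Mapping.lookup t [] = 0"
  using nichols_ideal_largest(1)[of d c] by (simp add: nichols_cond_def coideal_def)

lemma in_U_ideal:
  "t \<in> nichols_ideal (elK D) (chr D) \<Longrightarrow> incl_V t \<in> U_ideal D l"
  "t \<in> nichols_ideal (elL D) (\<lambda>i g. inverse (chr D i g)) \<Longrightarrow> incl_W t \<in> U_ideal D l"
  "linking_rel D l i j \<in> U_ideal D l"
proof -
  have "incl_V ` nichols_ideal (elK D) (chr D)
      \<union> incl_W ` nichols_ideal (elL D) (\<lambda>i g. inverse (chr D i g))
      \<union> {linking_rel D l i j | i j. True} \<subseteq> U_ideal D l"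
    unfolding U_ideal_def by (rule smash.genideal_self) simp
  then show "t \<in> nichols_ideal (elK D) (chr D) \<Longrightarrow> incl_V t \<in> U_ideal D l"
    "t \<in> nichols_ideal (elL D) (\<lambda>i g. inverse (chr D i g)) \<Longrightarrow> incl_W t \<in> U_ideal D l"
    "linking_rel D l i j \<in> U_ideal D l" by blast+
qed

lemma character_chr_zero: "chr D i 0 = 1" using rd by (simp add: reduced_datum_def character_def)

sublocale U_rep scl D l eJ wJ gJ
proof (unfold_locales, goal_cases)
  case (9 h i x)
  show ?case
    by (simp only: eJ_def gJ_def P_amult_P amult_assoc[symmetric] gens_commute amult_scl P_scl)
next
  case (10 h i x)
  show ?case
    by (simp only: wJ_def gJ_def P_amult_P amult_assoc[symmetric] gens_commute amult_scl P_scl)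
next
  case (14 i j x)
  have "P (amult D (linking_rel D l i j) x) = 0" by (rule P_U_ideal[OF in_U_ideal(3)])
  then have "P (amult D (amult D (vgen i) (wgen j)) x)
      = scl (inverse (chr D j (elK D i))) (P (amult D (amult D (wgen j) (vgen i)) x))
       + (if i = j then scl (l i) (P (amult D (grp (elK D i + elL D i)) x) - P (amult D (grp 0) x)) else 0)"
    by (auto simp: linking_rel_def amult_diff amult_linear P_add amult_scl P_diff P_scl pm.scale_right_diff_distrib algebra_simps)
  then show ?case
    by (simp add: eJ_def wJ_def gJ_def P_amult_P amult_assoc q_def)
next
  case (15 t x)
  have "lext scl (\<lambda>u. foldr eJ u x) t = P (amult D (incl_V t) x)"
    unfolding incl_V_def by (rule lext_P_push[OF nichols_lookup[OF 15] foldr_eJ])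
  then show ?case using P_U_ideal[OF in_U_ideal(1)[OF 15]] by simp
next
  case (16 t x)
  have "lext scl (\<lambda>u. foldr wJ u x) t = P (amult D (incl_W t) x)"
    unfolding incl_W_def by (rule lext_P_push[OF nichols_lookup[OF 16] foldr_wJ])
  then show ?case using P_U_ideal[OF in_U_ideal(2)[OF 16]] by simp
qed (simp_all add: rd lp eJ_def wJ_def gJ_def amult_linear P_add amult_scl P_scl P_amult_P
    amult_assoc[symmetric] gens_commute character_chr_zero, simp_all add: grp_def vgen_def wgen_def amult_single wch)

lemma P_idem: "P (P x) = P x"
  using P0[of "x - P x"] PJ by (simp add: P_diff)

text \<open>The quotient is cyclic: basis elements arise by applying generators to the image of
  1.\<close>

lemma P_in_subm:
  assumes K: "subm K" and 1: "P sone \<in> K"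
  shows "P x \<in> K"
proof (induction x rule: pm_induct)
  case zero
  then show ?case using K P_scl[of 0 0] by (simp add: subm_def pm.subspace_0)
next
  case (single uh a)
  obtain u h where uh: "uh = (u, h)" by force
  have "P (Poly_Mapping.single (u, h) 1) \<in> K"
  proof (induction u)
    case Nil
    have "gJ h (P sone) = P (Poly_Mapping.single ([], h) 1)"
      by (simp add: gJ_def P_amult_P grp_def amult_single wch)
    then show ?case using K 1 by (metis subm_def)
  next
    case (Cons s u)
    have "eJ i (P (Poly_Mapping.single (u, h) 1)) = P (Poly_Mapping.single (Inl i # u, h) 1)"
      "wJ i (P (Poly_Mapping.single (u, h) 1)) = P (Poly_Mapping.single (Inr i # u, h) 1)" for i
      by (simp_all add: eJ_def wJ_def P_amult_P vgen_def wgen_def amult_single wch)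
    then show ?case using K Cons by (cases s) (metis subm_def)+
  qed
  then have "scl a (P (Poly_Mapping.single (u, h) 1)) \<in> K"
    using K by (simp add: subm_def pm.subspace_scale)
  then show ?case by (simp add: uh flip: P_scl)
next
  case (add x y)
  then show ?case using K by (simp add: P_add subm_def pm.subspace_add)
qed

end

section \<open>Sums of simple submodules\<close>

lemma (in comm_group) subgroup_finprod_closed:
  assumes "subgroup H G" "\<And>i. i \<in> A \<Longrightarrow> f i \<in> H"
  shows "finprod G f A \<in> H"
  using assms(2)
proof (induction A rule: infinite_finite_induct)
  case (insert i A)
  have "f \<in> A \<rightarrow> carrier G" "f i \<in> carrier G" using insert subgroup.mem_carrier[OF assms(1)] by auto
  then show ?case using insert by (simp add: subgroup.m_closed[OF assms(1)])
qed (simp_all add: subgroup.one_closed[OF assms(1)])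

lemma (in comm_group) subgroup_gfinprod_closed:
  assumes "subgroup H G" "\<And>i. i \<in> A \<Longrightarrow> f i \<in> H"
  shows "gfinprod G f A \<in> H"
  unfolding gfinprod_def using assms
  by (auto intro: subgroup_finprod_closed subgroup.one_closed)

text \<open>Only finite subfamilies are tested, so that the property passes to unions of
  chains.\<close>

definition independent_family :: "('b, 'm) monoid_scheme \<Rightarrow> 'b set set \<Rightarrow> bool" where
  "independent_family G \<N> \<longleftrightarrow> (\<forall>F f. finite F \<longrightarrow> F \<subseteq> \<N> \<longrightarrow> (\<forall>N\<in>F. f N \<in> N) \<longrightarrow>
     finprod G f F = \<one>\<^bsub>G\<^esub> \<longrightarrow> (\<forall>N\<in>F. f N = \<one>\<^bsub>G\<^esub>))"

lemma independent_familyD: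
  assumes "independent_family G \<N>" "finite F" "F \<subseteq> \<N>" "\<And>N. N \<in> F \<Longrightarrow> f N \<in> N" "finprod G f F = \<one>\<^bsub>G\<^esub>"
    "N \<in> F"
  shows "f N = \<one>\<^bsub>G\<^esub>"
proof -
  have "\<forall>N\<in>F. f N \<in> N" using assms(4) by blast
  then show ?thesis using assms unfolding independent_family_def by blast
qed

context left_module
begin

text \<open>The facts of the locale \<open>M.add\<close> speak about \<^const>\<open>finsum\<close>.\<close>
lemmas add_finprod_closed = comm_monoid.finprod_closed[OF comm_group.axioms(1)[OF M.a_comm_group]]
lemmas add_finprod_trivial =
  comm_monoid.finprod_empty[OF comm_group.axioms(1)[OF M.a_comm_group]]
  comm_monoid.finprod_infinite[OF comm_group.axioms(1)[OF M.a_comm_group]]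
lemmas add_finprod_insert = comm_monoid.finprod_insert[OF comm_group.axioms(1)[OF M.a_comm_group]]
lemmas add_gfinprod_eq_finprod = comm_monoid.gfinprod_eq_finprod[OF comm_group.axioms(1)[OF M.a_comm_group]]
lemmas add_gfinprod_cong_left =
  comm_monoid.gfinprod_mono_neutral_cong_left[OF comm_group.axioms(1)[OF M.a_comm_group]]
lemmas add_subgroup_finprod_closed = comm_group.subgroup_finprod_closed[OF M.a_comm_group]
lemmas add_hom_group_sum = comm_group.hom_group_sum[OF M.a_comm_group]

abbreviation "sumN \<N> \<equiv> sum_group \<N> (\<lambda>N. add_monoid (M\<lparr>carrier := N\<rparr>))"
abbreviation "sum_map \<N> \<equiv> (\<lambda>f. gfinprod (add_monoid M) f \<N>)"

lemma group_add_monoid_submodule: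
  assumes "submodule N R M" shows "group (add_monoid (M\<lparr>carrier := N\<rparr>))"
proof -
  have "group ((add_monoid M)\<lparr>carrier := N\<rparr>)"
    using assms by (intro subgroup.subgroup_is_group M.add.is_group submodule.axioms)
  then show ?thesis by simp
qed

lemma sum_map_hom:
  assumes "\<And>N. N \<in> \<N> \<Longrightarrow> submodule N R M"
  shows "sum_map \<N> \<in> hom (sumN \<N>) (add_monoid M)"
proof -
  have "(\<lambda>x. x) \<in> hom (add_monoid (M\<lparr>carrier := N\<rparr>)) (add_monoid M)" if "N \<in> \<N>" for N
    using subgroup.subset[OF submodule.axioms(1)[OF assms[OF that]]] by (auto simp: hom_def)
  from add_hom_group_sum[OF this group_add_monoid_submodule[OF assms]] show ?thesis by simp
qed

lemma sum_map_group_hom: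
  assumes "\<And>N. N \<in> \<N> \<Longrightarrow> submodule N R M"
  shows "group_hom (sumN \<N>) (add_monoid M) (sum_map \<N>)"
proof (intro group_hom.intro group_hom_axioms.intro M.add.is_group sum_map_hom assms)
  show "group (sumN \<N>)" by (rule sum_group, rule group_add_monoid_submodule[OF assms])
qed

lemma carrier_sumN:
  assumes "\<And>N. N \<in> \<N> \<Longrightarrow> submodule N R M"
  shows "carrier (sumN \<N>) = {x \<in> \<Pi>\<^sub>E N\<in>\<N>. N. finite {N \<in> \<N>. x N \<noteq> \<zero>\<^bsub>M\<^esub>}}"
  by (subst carrier_sum_group) (erule group_add_monoid_submodule[OF assms], simp)

lemma smult_zero: "r \<in> carrier R \<Longrightarrow> r \<odot>\<^bsub>M\<^esub> \<zero>\<^bsub>M\<^esub> = \<zero>\<^bsub>M\<^esub>"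
proof -
  assume r: "r \<in> carrier R"
  have "r \<odot>\<^bsub>M\<^esub> \<zero>\<^bsub>M\<^esub> \<oplus>\<^bsub>M\<^esub> r \<odot>\<^bsub>M\<^esub> \<zero>\<^bsub>M\<^esub> = r \<odot>\<^bsub>M\<^esub> \<zero>\<^bsub>M\<^esub>"
    using smult_r_distr[OF r M.zero_closed M.zero_closed] by simp
  then show ?thesis using smult_closed[OF r M.zero_closed]
    by (metis M.add.l_cancel_one)
qed

lemma smult_finsum:
  assumes "r \<in> carrier R" "f \<in> A \<rightarrow> carrier M"
  shows "r \<odot>\<^bsub>M\<^esub> finprod (add_monoid M) f A = finprod (add_monoid M) (\<lambda>i. r \<odot>\<^bsub>M\<^esub> f i) A"
  using assms(2)
proof (induction A rule: infinite_finite_induct)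
  case (insert i A)
  then have f: "f \<in> A \<rightarrow> carrier (add_monoid M)" "f i \<in> carrier (add_monoid M)" by auto
  then have f': "(\<lambda>i. r \<odot>\<^bsub>M\<^esub> f i) \<in> A \<rightarrow> carrier (add_monoid M)" "r \<odot>\<^bsub>M\<^esub> f i \<in> carrier (add_monoid M)"
    using assms(1) smult_closed by auto
  have "finprod (add_monoid M) f A \<in> carrier M" using add_finprod_closed[OF f(1)] by simp
  then show ?case using insert f f' assms(1)
    by (simp add: add_finprod_insert[OF insert(1,2) f] add_finprod_insert[OF insert(1,2) f'] smult_r_distr)
qed (simp_all add: add_finprod_trivial smult_zero assms(1))

lemma submodule_sum:
  assumes N: "\<And>N. N \<in> \<N> \<Longrightarrow> submodule N R M"
  shows "submodule (sum_map \<N> ` carrier (sumN \<N>)) R M" and "N \<in> \<N> \<Longrightarrow> N \<subseteq> sum_map \<N> ` carrier (sumN \<N>)"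
proof -
  let ?G = "add_monoid M" and ?Q = "sum_map \<N> ` carrier (sumN \<N>)"
  have cs: "carrier (sumN \<N>) = {x \<in> \<Pi>\<^sub>E N\<in>\<N>. N. finite {N \<in> \<N>. x N \<noteq> \<zero>\<^bsub>M\<^esub>}}"
    by (rule carrier_sumN[OF N])
  interpret h: group_hom "sumN \<N>" ?G "sum_map \<N>"
    by (rule sum_map_group_hom[OF N])
  have Nc: "x \<in> carrier M" if "x \<in> N" "N \<in> \<N>" for x N
    using subgroup.mem_carrier[OF submodule.axioms(1)[OF N]] that by auto
  have "r \<odot>\<^bsub>M\<^esub> m \<in> ?Q" if r: "r \<in> carrier R" and m: "m \<in> ?Q" for r m
  proof -
    obtain x where x: "x \<in> carrier (sumN \<N>)" "m = sum_map \<N> x" using m by blast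
    let ?S = "{N \<in> \<N>. x N \<noteq> \<zero>\<^bsub>M\<^esub>}" and ?y = "\<lambda>N\<in>\<N>. r \<odot>\<^bsub>M\<^esub> x N"
    have xN: "x N \<in> N" if "N \<in> \<N>" for N using x(1)[unfolded cs] that by auto
    have S: "finite ?S" using x(1)[unfolded cs] by simp
    have rx: "r \<odot>\<^bsub>M\<^esub> x N \<in> N" if "N \<in> \<N>" for N
      using submodule.smult_closed[OF N[OF that] r xN[OF that]] .
    have xc: "x \<in> ?S \<rightarrow> carrier M" using xN Nc by blast
    have rxc: "r \<odot>\<^bsub>M\<^esub> x N \<in> carrier M" if "N \<in> \<N>" for N
      using rx Nc that by blast
    have "?y \<in> carrier (sumN \<N>)" unfolding cs
      using rx S by (auto simp: smult_zero[OF r] intro: finite_subset[OF _ S])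
    moreover have "r \<odot>\<^bsub>M\<^esub> m = sum_map \<N> ?y"
    proof -
      have "r \<odot>\<^bsub>M\<^esub> m = finprod ?G (\<lambda>N. r \<odot>\<^bsub>M\<^esub> x N) ?S"
        unfolding x(2) gfinprod_def using S by (simp add: smult_finsum[OF r xc])
      also have "\<dots> = gfinprod ?G (\<lambda>N. r \<odot>\<^bsub>M\<^esub> x N) ?S"
        by (rule add_gfinprod_eq_finprod[symmetric]) (use S rxc in auto)
      also have "\<dots> = sum_map \<N> ?y"
        by (rule add_gfinprod_cong_left) (use rxc in \<open>auto simp: smult_zero[OF r]\<close>)
      finally show ?thesis .
    qed
    ultimately show ?thesis by blast
  qed
  then show "submodule ?Q R M"
    by (intro submodule.intro submodule_axioms.intro h.img_is_subgroup)
  assume NN: "N \<in> \<N>"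
  show "N \<subseteq> ?Q"
  proof
    fix n assume n: "n \<in> N"
    let ?x = "\<lambda>N'\<in>\<N>. if N' = N then n else \<zero>\<^bsub>M\<^esub>"
    have "{N' \<in> \<N>. ?x N' \<noteq> \<zero>\<^bsub>M\<^esub>} \<subseteq> {N}" by auto
    then have "finite {N' \<in> \<N>. ?x N' \<noteq> \<zero>\<^bsub>M\<^esub>}" by (rule finite_subset) simp
    moreover have "\<zero>\<^bsub>M\<^esub> \<in> N'" if "N' \<in> \<N>" for N'
      using subgroup.one_closed[OF submodule.axioms(1)[OF N[OF that]]] by simp
    ultimately have mem: "?x \<in> carrier (sumN \<N>)" unfolding cs using n by auto
    have val: "sum_map \<N> ?x = n"
    proof -
      have "sum_map \<N> ?x = gfinprod ?G (\<lambda>_. n) {N}"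
        by (rule add_gfinprod_cong_left[symmetric]) (use NN n Nc in auto)
      also have "\<dots> = n" using Nc[OF n NN] by (simp add: add_gfinprod_eq_finprod)
      finally show ?thesis .
    qed
    have "sum_map \<N> ?x \<in> ?Q" by (rule imageI[OF mem])
    then show "n \<in> ?Q" unfolding val .
  qed
qed

end

text \<open>\<^const>\<open>internal_direct_sum\<close> is only defined for records without further fields.\<close>

locale plain_left_module = left_module R M for R :: "'a ring" (structure) and M :: "('a, 'm) module" (structure)
begin

lemma internal_direct_sumI:
  assumes N: "\<And>N. N \<in> \<N> \<Longrightarrow> submodule N R M"
    and ind: "independent_family (add_monoid M) \<N>"
    and surj: "sum_map \<N> ` carrier (sumN \<N>) = carrier M"
  shows "internal_direct_sum M \<N> (\<lambda>N. N)"
proof -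
  let ?G = "add_monoid M"
  have cs: "carrier (sumN \<N>) = {x \<in> \<Pi>\<^sub>E N\<in>\<N>. N. finite {N \<in> \<N>. x N \<noteq> \<zero>\<^bsub>M\<^esub>}}"
    by (rule carrier_sumN[OF N])
  interpret h: group_hom "sumN \<N>" ?G "sum_map \<N>"
    by (rule sum_map_group_hom[OF N])
  have "inj_on (sum_map \<N>) (carrier (sumN \<N>))"
    unfolding h.inj_on_one_iff
  proof (intro allI impI)
    fix x assume x: "x \<in> carrier (sumN \<N>)" "sum_map \<N> x = \<one>\<^bsub>?G\<^esub>"
    let ?S = "{N \<in> \<N>. x N \<noteq> \<zero>\<^bsub>M\<^esub>}"
    have S: "finite ?S" "\<And>N. N \<in> \<N> \<Longrightarrow> x N \<in> N" using x(1)[unfolded cs] by auto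
    have "finprod ?G x ?S = \<one>\<^bsub>?G\<^esub>" using x(2) S(1) by (simp add: gfinprod_def)
    then have "x N = \<one>\<^bsub>?G\<^esub>" if "N \<in> ?S" for N
      by (rule independent_familyD[OF ind S(1) _ _ _ that, rotated 2]) (use S(2) in auto)
    then have "x N = \<zero>\<^bsub>M\<^esub>" if "N \<in> \<N>" for N using that by auto
    moreover have "x \<in> extensional \<N>" using x(1)[unfolded cs] by (auto simp: PiE_def)
    ultimately show "x = \<one>\<^bsub>sumN \<N>\<^esub>" by (auto simp: extensional_def fun_eq_iff)
  qed
  then have "sum_map \<N> \<in> iso (sumN \<N>) ?G"
    using surj by (intro isoI h.homh) (simp add: bij_betw_def)
  then show ?thesis
    using N by (auto simp: internal_direct_sum_def submodule_def)
qed

text \<open>A maximal independent subfamily has the whole module as its sum: a simple member not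
  contained in the sum would meet it in 0 and could be added.\<close>

theorem sum_of_simples:
  assumes simple: "\<And>N. N \<in> \<S> \<Longrightarrow> simple_submodule N R M"
    and gen: "\<And>Q. submodule Q R M \<Longrightarrow> \<Union>\<S> \<subseteq> Q \<Longrightarrow> Q = carrier M"
  shows "\<exists>\<N>\<subseteq>\<S>. internal_direct_sum M \<N> (\<lambda>N. N)"
proof -
  let ?G = "add_monoid M"
  have sub: "submodule N R M" if "N \<in> \<S>" for N using simple[OF that] by (simp add: simple_submodule_def)
  define A where "A = {\<N>. \<N> \<subseteq> \<S> \<and> independent_family ?G \<N>}"
  have "\<exists>\<N>\<in>A. \<forall>X\<in>A. \<N> \<subseteq> X \<longrightarrow> X = \<N>"
  proof (rule subset_Zorn')
    fix C assume C: "subset.chain A C"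
    have "independent_family ?G (\<Union>C)" unfolding independent_family_def
    proof (intro allI impI)
      fix F f assume F: "finite F" "F \<subseteq> \<Union>C" "\<forall>N\<in>F. f N \<in> N" "finprod ?G f F = \<one>\<^bsub>?G\<^esub>"
      show "\<forall>N\<in>F. f N = \<one>\<^bsub>?G\<^esub>"
      proof (cases "F = {}")
        case False
        then have "C \<noteq> {}" using F(2) by auto
        then obtain X where X: "X \<in> C" "F \<subseteq> X" using finite_subset_Union_chain[OF F(1,2) _ C] by blast
        then have "independent_family ?G X" using C by (auto simp: A_def subset.chain_def)
        then show ?thesis using F X unfolding independent_family_def by blast
      qed simp
    qed
    then show "\<Union>C \<in> A" using C by (auto simp: A_def subset.chain_def)
  qed
  then obtain \<N> where max: "\<N> \<in> A" "\<forall>X\<in>A. \<N> \<subseteq> X \<longrightarrow> X = \<N>" by blast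
  have "X = \<N>" if "X \<subseteq> \<S>" "independent_family ?G X" "\<N> \<subseteq> X" for X
    using max(2) that by (simp add: A_def)
  with max(1) have \<N>: "\<N> \<subseteq> \<S>" "independent_family ?G \<N>"
    "\<And>X. X \<subseteq> \<S> \<Longrightarrow> independent_family ?G X \<Longrightarrow> \<N> \<subseteq> X \<Longrightarrow> X = \<N>"
    by (simp_all add: A_def)
  define Q where "Q = sum_map \<N> ` carrier (sumN \<N>)"
  have N: "submodule N R M" if "N \<in> \<N>" for N using \<N>(1) sub that by blast
  have Q: "submodule Q R M" "\<And>N. N \<in> \<N> \<Longrightarrow> N \<subseteq> Q" using submodule_sum[OF N] unfolding Q_def by blast+
  note sQ = submodule.axioms(1)[OF Q(1)]
  have "S \<subseteq> Q" if S: "S \<in> \<S>" for S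
  proof (rule ccontr)
    assume nS: "\<not> S \<subseteq> Q"
    note sS = submodule.axioms(1)[OF sub[OF S]]
    have "submodule (S \<inter> Q) R M"
      by (intro submodule.intro submodule_axioms.intro M.add.subgroups_Inter_pair sQ sS)
        (auto simp: submodule.smult_closed[OF Q(1)] submodule.smult_closed[OF sub[OF S]])
    then have SQ: "S \<inter> Q = {\<zero>\<^bsub>M\<^esub>}" using simple[OF S] nS unfolding simple_submodule_def by blast
    have "independent_family ?G (insert S \<N>)" unfolding independent_family_def
    proof (intro allI impI)
      fix F f assume F: "finite F" "F \<subseteq> insert S \<N>" "\<forall>N\<in>F. f N \<in> N" "finprod ?G f F = \<one>\<^bsub>?G\<^esub>"
      have fc: "f N \<in> carrier ?G" if "N \<in> F" for N
        using F \<N>(1) S that subgroup.mem_carrier[OF submodule.axioms(1)[OF sub]] by blast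
      let ?F = "F - {S}"
      have FN: "?F \<subseteq> \<N>" "finite ?F" using F by auto
      have fin: "finprod ?G f ?F \<in> Q"
        by (rule add_subgroup_finprod_closed[OF sQ]) (use F FN Q(2) in blast)
      \<comment> \<open>A relation involving \<open>S\<close> exhibits \<open>f S\<close> as an
        element of both \<open>S\<close> and \<open>Q\<close>.\<close>
      have "S \<in> F \<Longrightarrow> f S = \<zero>\<^bsub>M\<^esub> \<and> finprod ?G f ?F = \<zero>\<^bsub>M\<^esub>"
      proof -
        assume SF: "S \<in> F"
        have c: "f \<in> ?F \<rightarrow> carrier ?G" "f S \<in> carrier M" using fc SF by auto
        have "f S \<in> carrier ?G" "S \<notin> ?F" using c(2) by simp_all
        from add_finprod_insert[OF FN(2) this(2) c(1) this(1)]
        have eq: "f S \<oplus>\<^bsub>M\<^esub> finprod ?G f ?F = \<zero>\<^bsub>M\<^esub>"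
          using F(4) SF by (simp add: insert_absorb)
        have fQ: "finprod ?G f ?F \<in> carrier M" using subgroup.mem_carrier[OF sQ fin] by simp
        have "f S = \<ominus>\<^bsub>M\<^esub> finprod ?G f ?F" using eq c(2) fQ by (simp add: M.minus_equality[symmetric])
        then have "f S \<in> Q" using subgroup.m_inv_closed[OF sQ fin] by (simp add: a_inv_def)
        then have "f S = \<zero>\<^bsub>M\<^esub>" using F(3) SF SQ by auto
        then show ?thesis using eq fQ by simp
      qed
      moreover have "S \<notin> F \<Longrightarrow> ?F = F" by simp
      ultimately have "finprod ?G f ?F = \<one>\<^bsub>?G\<^esub>" using F(4) by (cases "S \<in> F") auto
      then have "f N = \<one>\<^bsub>?G\<^esub>" if "N \<in> ?F" for N
        by (rule independent_familyD[OF \<N>(2) FN(2,1) _ _ that, rotated 1]) (use F(3) in auto)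
      then show "\<forall>N\<in>F. f N = \<one>\<^bsub>?G\<^esub>"
        using \<open>S \<in> F \<Longrightarrow> f S = \<zero>\<^bsub>M\<^esub> \<and> finprod ?G f ?F = \<zero>\<^bsub>M\<^esub>\<close> by auto
    qed
    then have "insert S \<N> = \<N>" using \<N>(1,3) S by blast
    then show False using Q(2) nS by blast
  qed
  then have "Q = carrier M" using gen[OF Q(1)] by blast
  then have "internal_direct_sum M \<N> (\<lambda>N. N)"
    using internal_direct_sumI[OF N \<N>(2)] by (simp add: Q_def)
  with \<N>(1) show ?thesis by blast
qed

end

section \<open>Modules over \<open>U\<close>\<close>

locale U_data =
  fixes D :: "('g::ab_group_add, 'i::finite, 'k::field) yd_datum" and l :: "'i \<Rightarrow> 'k"
  assumes rd: "reduced_datum D" and lp: "linking_parameter l"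
begin

abbreviation "U \<equiv> U_alg D l"
abbreviation "cl \<equiv> U_class D l"

sublocale sm: ring "smash_alg D"
  using rd by (intro ring_smash_alg) (simp add: reduced_datum_def)
sublocale I: ideal "U_ideal D l" "smash_alg D" by (rule ring_U_alg(1)[OF rd])
sublocale U: ring "U_alg D l" by (rule ring_U_alg(2)[OF rd])

lemma cl_hom: "cl \<in> ring_hom (smash_alg D) U"
  using I.rcos_ring_hom unfolding U_alg_def U_class_def by simp

lemma cl_closed [simp]: "cl x \<in> carrier U"
  using ring_hom_closed[OF cl_hom] by simp

lemma cl_add: "cl (x + y) = cl x \<oplus>\<^bsub>U\<^esub> cl y" and cl_mult: "cl (amult D x y) = cl x \<otimes>\<^bsub>U\<^esub> cl y"
  and cl_one: "cl sone = \<one>\<^bsub>U\<^esub>"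
  using ring_hom_add[OF cl_hom, of x y] ring_hom_mult[OF cl_hom, of x y] ring_hom_one[OF cl_hom] by simp_all

lemma cl_zero: "cl 0 = \<zero>\<^bsub>U\<^esub>"
  using ring_hom_zero[OF cl_hom sm.ring_axioms U.ring_axioms] by simp

lemma cl_minus: "cl (x - y) = cl x \<ominus>\<^bsub>U\<^esub> cl y"
proof -
  have "cl (x - y) \<oplus>\<^bsub>U\<^esub> cl y = cl x" by (simp flip: cl_add)
  then show ?thesis by (metis U.add.inv_solve_right cl_closed a_minus_def)
qed

lemma carrier_U: "a \<in> carrier U \<Longrightarrow> \<exists>x. a = cl x"
  by (auto simp: U_alg_def FactRing_def A_RCOSETS_def' U_class_def)

lemma cl_ideal: "x \<in> U_ideal D l \<Longrightarrow> cl x = \<zero>\<^bsub>U\<^esub>"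
  using I.a_rcos_const[of x] unfolding U_class_def U_alg_def FactRing_def by simp

lemma grp_0: "grp 0 = sone" by (simp add: grp_def)

lemma amult_sone: "amult D sone x = x" "amult D x sone = x"
  using sm.l_one[of x] sm.r_one[of x] by simp_all

text \<open>\<open>F i\<close> is \<open>w i\<close> times a group element, and group elements pass
  words up to nonzero scalars. With \<open>word_from_F_pow\<close>, which goes back by left
  multiplication, powers of \<open>F i\<close> and of \<open>w i\<close> are interchangeable in left
  ideals.\<close>

lemma U_F_pow: "\<exists>h \<kappa>. \<kappa> \<noteq> 0 \<and> U_F D l i [^]\<^bsub>U\<^esub> n = cl (Poly_Mapping.single (replicate n (Inr i), h) \<kappa>)"
proof (induction n)
  case 0
  show ?case by (intro exI[of _ 0] exI[of _ 1]) (simp add: cl_one)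
next
  case (Suc n)
  then obtain h \<kappa> where IH: "\<kappa> \<noteq> 0" "U_F D l i [^]\<^bsub>U\<^esub> n = cl (Poly_Mapping.single (replicate n (Inr i), h) \<kappa>)"
    by blast
  have nz: "chr_VW D x h \<noteq> 0" for x h
  proof -
    have c: "character (chr D i)" for i using rd by (simp add: reduced_datum_def)
    have "chr D i h \<noteq> 0" for i
    proof
      assume "chr D i h = 0"
      then have "chr D i (h + - h) = 0" using c[of i] unfolding character_def by (metis mult_zero_left)
      then show False using c[of i] by (simp add: character_def)
    qed
    then show ?thesis by (simp add: chr_VW_def split: sum.splits)
  qed
  have F: "U_F D l i = cl (Poly_Mapping.single ([Inr i], - elL D i) (wchar (chr_VW D) [] 0))"
    by (simp add: U_F_def wgen_def grp_def amult_single)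
  have "U_F D l i [^]\<^bsub>U\<^esub> Suc n = U_F D l i [^]\<^bsub>U\<^esub> n \<otimes>\<^bsub>U\<^esub> U_F D l i" by simp
  also have "\<dots> = cl (amult D (Poly_Mapping.single (replicate n (Inr i), h) \<kappa>)
      (Poly_Mapping.single ([Inr i], - elL D i) (wchar (chr_VW D) [] 0)))"
    unfolding IH(2) cl_mult unfolding F ..
  finally have "U_F D l i [^]\<^bsub>U\<^esub> Suc n = cl (Poly_Mapping.single (replicate (Suc n) (Inr i), h + - elL D i)
      (wchar (chr_VW D) [Inr i] h * \<kappa> * wchar (chr_VW D) [] 0))"
    by (simp only: amult_single replicate_append_same replicate_Suc)
  moreover have "wchar (chr_VW D) [Inr i] h * \<kappa> * wchar (chr_VW D) [] 0 \<noteq> 0"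
    using IH(1) nz by (simp add: wchar_def)
  ultimately show ?case by blast
qed

lemma word_from_F_pow:
  assumes "\<kappa> \<noteq> 0"
  shows "\<exists>s. Poly_Mapping.single (replicate n (Inr i), 0) 1 = amult D s (Poly_Mapping.single (replicate n (Inr i), h) \<kappa>)"
proof -
  let ?c = "wchar (chr_VW D) (replicate n (Inr i)) (- h) * \<kappa>"
  have c: "character (chr D i)" using rd by (simp add: reduced_datum_def)
  have "chr D i (- h) \<noteq> 0"
  proof
    assume "chr D i (- h) = 0"
    then have "chr D i (h + - h) = 0" using c unfolding character_def by (metis mult_zero_right)
    then show False using c by (simp add: character_def)
  qed
  then have "?c \<noteq> 0" using assms by (simp add: wchar_def chr_VW_def)
  then have "amult D (scl (inverse ?c) (grp (- h))) (Poly_Mapping.single (replicate n (Inr i), h) \<kappa>)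
      = Poly_Mapping.single (replicate n (Inr i), 0) 1"
    by (simp add: grp_def amult_scl amult_single del: scl_single) (simp add: field_simps)
  then show ?thesis by metis
qed

text \<open>Maximality of the left ideal of \<open>L(\<chi>)\<close>, phrased for preimages in the
  smash product. The quotient is generated by the primitive image of 1 and locally nilpotent by
  \<open>hw_w_nilpotent\<close>; the image of \<open>J'\<close> is a nonzero submodule, so it
  contains the generator.\<close>

lemma L_simple:
  assumes gen: "generic D" and reg: "regular D" and ct: "cartan_type D" and dom: "dominant D c"
    and J': "pm.subspace J'" "\<And>s x. x \<in> J' \<Longrightarrow> amult D s x \<in> J'" "\<And>x. cl x \<in> L_ideal D l c \<Longrightarrow> x \<in> J'"
    and y: "y \<in> J'" "cl y \<notin> L_ideal D l c"
  shows "sone \<in> J'"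
proof -
  define JL where "JL = {x. cl x \<in> L_ideal D l c}"
  let ?S = "range (U_E D l) \<union> range (\<lambda>i. U_F D l i [^]\<^bsub>U\<^esub> (dom_exp D c i + 1))
      \<union> range (\<lambda>g. U_grp D l g \<ominus>\<^bsub>U\<^esub> U_scalar D l (c g))"
  have "left_module U (regular_module U)" by (rule left_module_regular[OF U.ring_axioms])
  moreover have "?S \<subseteq> carrier (regular_module U)"
    by (auto simp: regular_module_def U_E_def U_F_def U_grp_def U_scalar_def U.minus_closed)
  ultimately have L: "submodule (L_ideal D l c) U (regular_module U)" "?S \<subseteq> L_ideal D l c"
    unfolding L_ideal_def by (rule submodule_gen_submodule)+
  note sL = submodule.axioms(1)[OF L(1)]
  have L_add: "a \<oplus>\<^bsub>U\<^esub> b \<in> L_ideal D l c" if "a \<in> L_ideal D l c" "b \<in> L_ideal D l c" for a b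
    using subgroup.m_closed[OF sL that] by (simp add: regular_module_def)
  have L_zero: "\<zero>\<^bsub>U\<^esub> \<in> L_ideal D l c"
    using subgroup.one_closed[OF sL] by (simp add: regular_module_def)
  have L_mult: "a \<otimes>\<^bsub>U\<^esub> b \<in> L_ideal D l c" if "a \<in> carrier U" "b \<in> L_ideal D l c" for a b
    using submodule.smult_closed[OF L(1) that] by (simp add: regular_module_def)
  have JL_left: "amult D s x \<in> JL" if "x \<in> JL" for s x
    using that L_mult by (simp add: JL_def cl_mult)
  have "scl a x = amult D (scl a sone) x" for a x by (simp add: amult_scl amult_sone del: scl_single)
  then have JL_sub: "pm.subspace JL"
    using L_add L_zero JL_left by (auto simp: pm.subspace_def JL_def cl_add cl_zero)
  obtain P where P: "Vector_Spaces.linear scl scl P" "\<And>x. P x = 0 \<longleftrightarrow> x \<in> JL" "\<And>x. x - P x \<in> JL"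
    using exists_projection[OF JL_sub] by blast
  interpret rep: left_ideal_rep D l JL P
  proof (rule left_ideal_rep.intro[OF rd lp JL_left _ P])
    show "U_ideal D l \<subseteq> JL" using L_zero by (auto simp: JL_def cl_ideal)
  qed
  define x where "x = P sone"
  have px: "rep.prim x"
  proof -
    have "vgen i \<in> JL" for i using L(2) by (auto simp: JL_def U_E_def)
    then have "P (vgen i) = 0" for i by (simp only: P(2))
    then show ?thesis by (simp add: rep.prim_def x_def rep.eJ_def rep.P_amult_P amult_sone)
  qed
  have wx: "rep.wt c x" unfolding rep.wt_def
  proof (intro conjI allI)
    show "character c" using dom by (simp add: dominant_def)
    fix h
    have "cl (grp h - scl (c h) sone) \<in> L_ideal D l c"
      using L(2) by (auto simp: cl_minus U_grp_def U_scalar_def grp_0 simp del: scl_single)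
    then have "P (grp h - scl (c h) sone) = 0" by (simp only: P(2) JL_def mem_Collect_eq)
    then show "rep.gJ h x = scl (c h) x"
      by (simp add: x_def rep.gJ_def rep.P_amult_P amult_sone rep.P_diff rep.P_scl del: scl_single)
  qed
  have funpow_w: "(rep.wJ i ^^ n) z = foldr rep.wJ (replicate n i) z" for i n z
    by (induction n) simp_all
  have nilx: "\<exists>n. (rep.wJ i ^^ n) x = 0" for i
  proof -
    let ?n = "dom_exp D c i + 1"
    obtain h \<kappa> where h: "\<kappa> \<noteq> 0" "U_F D l i [^]\<^bsub>U\<^esub> ?n = cl (Poly_Mapping.single (replicate ?n (Inr i), h) \<kappa>)"
      using U_F_pow by blast
    have "U_F D l i [^]\<^bsub>U\<^esub> ?n \<in> L_ideal D l c" using L(2) by blast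
    then have "Poly_Mapping.single (replicate ?n (Inr i), h) \<kappa> \<in> JL" unfolding JL_def h(2) by blast
    moreover obtain s where "Poly_Mapping.single (replicate ?n (Inr i), 0) 1
        = amult D s (Poly_Mapping.single (replicate ?n (Inr i), h) \<kappa>)"
      using word_from_F_pow[OF h(1)] by blast
    ultimately have "Poly_Mapping.single (replicate ?n (Inr i), 0) 1 \<in> JL" using JL_left by metis
    then have "P (Poly_Mapping.single (replicate ?n (Inr i), 0) 1) = 0" by (simp only: P(2))
    moreover have "(rep.wJ i ^^ ?n) x = P (Poly_Mapping.single (replicate ?n (Inr i), 0) 1)"
      unfolding funpow_w by (subst rep.foldr_wJ) (simp_all add: x_def rep.P_amult_P amult_sone del: replicate_Suc)
    ultimately show ?thesis by metis
  qed
  have sub: "rep.subm (rep.hw x)" by (rule rep.subm_hw[OF px wx])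
  have "x \<in> rep.hw x" unfolding rep.hw_def by (rule pm.span_base) (metis foldr.simps(1) id_apply rangeI)
  then have Phw: "P z \<in> rep.hw x" for z using rep.P_in_subm[OF sub] unfolding x_def by blast
  have JLJ': "JL \<subseteq> J'" using J'(3) by (auto simp: JL_def)
  have PJ': "P z \<in> J'" if "z \<in> J'" for z
    using pm.subspace_diff[OF J'(1) that, of "z - P z"] P(3)[of z] JLJ' by auto
  have "rep.subm (P ` J')" unfolding rep.subm_def
  proof (intro conjI ballI allI)
    show "pm.subspace (P ` J')"
    proof -
      interpret lin: Vector_Spaces.linear scl scl P by (rule P)
      show ?thesis by (rule lin.subspace_image[OF J'(1)])
    qed
    fix z i h assume "z \<in> P ` J'"
    then obtain t where t: "t \<in> J'" "z = P t" by blast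
    have "rep.eJ i z = P (amult D (vgen i) t)" "rep.wJ i z = P (amult D (wgen i) t)"
      "rep.gJ h z = P (amult D (grp h) t)"
      by (simp_all add: t rep.eJ_def rep.wJ_def rep.gJ_def rep.P_amult_P)
    then show "rep.eJ i z \<in> P ` J'" "rep.wJ i z \<in> P ` J'" "rep.gJ h z \<in> P ` J'" using J'(2)[OF t(1)] by auto
  qed
  moreover have "P ` J' \<subseteq> rep.hw x" using Phw by blast
  moreover have "P y \<in> P ` J'" "P y \<noteq> 0" using y P(2) by (auto simp: JL_def)
  ultimately have "x \<in> P ` J'"
    using rep.integrable_hw_simple[OF gen reg ct px wx rep.hw_w_nilpotent[OF ct nilx]] by blast
  then obtain z where "z \<in> J'" "P sone = P z" by (auto simp: x_def)
  then have "P sone \<in> J'" using PJ' by simp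
  moreover have "sone - P sone \<in> J'" using P(3) JLJ' by blast
  ultimately show ?thesis using pm.subspace_add[OF J'(1), of "P sone" "sone - P sone"] by simp
qed

end

section \<open>Vectors of a module, their annihilators and the submodules they generate\<close>

locale U_module = U_data D l + plain_left_module "U_alg D l" M
  for D :: "('g::ab_group_add, 'i::finite, 'k::field) yd_datum" and l :: "'i \<Rightarrow> 'k"
    and M :: "('g, 'i, 'k, 'm) U_module"
begin

definition act :: "('g, 'i, 'k) smash \<Rightarrow> 'm \<Rightarrow> 'm" where "act x m = cl x \<odot>\<^bsub>M\<^esub> m"

lemma act_closed [simp]: "m \<in> carrier M \<Longrightarrow> act x m \<in> carrier M"
  by (simp add: act_def smult_closed)

lemma act_add: "m \<in> carrier M \<Longrightarrow> act (x + y) m = act x m \<oplus>\<^bsub>M\<^esub> act y m"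
  by (simp add: act_def cl_add smult_l_distr)

lemma act_mult: "m \<in> carrier M \<Longrightarrow> act (amult D x y) m = act x (act y m)"
  by (simp add: act_def cl_mult smult_assoc)

lemma act_one: "m \<in> carrier M \<Longrightarrow> act sone m = m"
  by (simp add: act_def cl_one smult_one)

lemma act_zero: "m \<in> carrier M \<Longrightarrow> act 0 m = \<zero>\<^bsub>M\<^esub>"
proof -
  assume m: "m \<in> carrier M"
  have "act 0 m \<oplus>\<^bsub>M\<^esub> act 0 m = act 0 m" using act_add[OF m, of 0 0] by simp
  then show ?thesis using m by (metis M.add.l_cancel_one act_closed)
qed

lemma act_zero_right: "act x \<zero>\<^bsub>M\<^esub> = \<zero>\<^bsub>M\<^esub>"
  by (simp add: act_def smult_zero)

lemma act_ideal: "m \<in> carrier M \<Longrightarrow> x \<in> U_ideal D l \<Longrightarrow> act x m = \<zero>\<^bsub>M\<^esub>"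
  using act_zero by (simp add: act_def cl_ideal cl_zero)

text \<open>For \<open>Q = {0}\<close> this presents the cyclic module of \<open>m\<close>; for
  general \<open>Q\<close> it turns membership in \<open>Q\<close> into membership in a left
  ideal.\<close>

definition ann :: "'m set \<Rightarrow> 'm \<Rightarrow> ('g, 'i, 'k) smash set" where
  "ann Q m = {x. act x m \<in> Q}"

lemma ann_left_ideal:
  assumes Q: "submodule Q U M" and m: "m \<in> carrier M"
  shows "x \<in> ann Q m \<Longrightarrow> amult D s x \<in> ann Q m" "pm.subspace (ann Q m)"
proof -
  note sQ = submodule.axioms(1)[OF Q]
  show left: "amult D s x \<in> ann Q m" if "x \<in> ann Q m" for s x
  proof -
    have "act s (act x m) \<in> Q"
      using submodule.smult_closed[OF Q cl_closed, of "act x m" s] that by (simp add: ann_def act_def)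
    then show ?thesis by (simp add: ann_def act_mult[OF m])
  qed
  have "scl a x = amult D (scl a sone) x" for a x by (simp add: amult_scl amult_sone del: scl_single)
  then show "pm.subspace (ann Q m)"
    using left subgroup.m_closed[OF sQ] subgroup.one_closed[OF sQ] m
    by (auto simp: pm.subspace_def ann_def act_add act_zero)
qed

lemma zero_submodule: "submodule {\<zero>\<^bsub>M\<^esub>} U M"
  using M.add.triv_subgroup by (intro submodule.intro submodule_axioms.intro) (auto simp: smult_zero)

abbreviation "ann0 m \<equiv> ann {\<zero>\<^bsub>M\<^esub>} m"

definition orbit :: "'m \<Rightarrow> 'm set" where "orbit m = (\<lambda>a. a \<odot>\<^bsub>M\<^esub> m) ` carrier U"

lemma orbit_eq: "orbit m = range (\<lambda>x. act x m)"
  using carrier_U unfolding orbit_def act_def by fastforce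

lemma submodule_orbit:
  assumes m: "m \<in> carrier M" shows "submodule (orbit m) U M"
proof (intro submodule.intro submodule_axioms.intro)
  have neg: "\<ominus>\<^bsub>M\<^esub> x \<in> orbit m" if "x \<in> orbit m" for x
  proof -
    from that obtain y where y: "x = act y m" by (auto simp: orbit_eq)
    have "act (- y) m \<oplus>\<^bsub>M\<^esub> x = \<zero>\<^bsub>M\<^esub>" using act_add[OF m, of "- y" y] act_zero[OF m] by (simp add: y)
    then have "\<ominus>\<^bsub>M\<^esub> x = act (- y) m" using m by (intro M.minus_equality) (simp_all add: y)
    then show ?thesis by (simp add: orbit_eq)
  qed
  have add: "x \<oplus>\<^bsub>M\<^esub> y \<in> orbit m" if "x \<in> orbit m" "y \<in> orbit m" for x y
    using that m by (auto simp: orbit_eq act_add[symmetric])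
  have sub: "orbit m \<subseteq> carrier M" "orbit m \<noteq> {}" using m by (auto simp: orbit_eq)
  show "subgroup (orbit m) (add_monoid M)"
    by (rule M.add.subgroupI) (use neg add sub in \<open>simp_all add: a_inv_def\<close>)
  show "a \<odot>\<^bsub>M\<^esub> x \<in> orbit m" if "a \<in> carrier U" "x \<in> orbit m" for a x
    using that m U.m_closed unfolding orbit_def by (auto simp: smult_assoc[symmetric])
qed

definition primitive :: "('g \<Rightarrow> 'k) \<Rightarrow> 'm \<Rightarrow> bool" where
  "primitive c m \<longleftrightarrow> character c \<and> m \<in> carrier M \<and> (\<forall>i. act (vgen i) m = \<zero>\<^bsub>M\<^esub>)
     \<and> (\<forall>h. act (grp h) m = act (scl (c h) sone) m)"

lemma integrable_words:
  assumes int: "integrable D l M" and m: "m \<in> carrier M"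
  shows "\<exists>n\<ge>1. act (Poly_Mapping.single (replicate n (Inr i), 0) 1) m = \<zero>\<^bsub>M\<^esub>"
proof -
  from int m obtain n :: nat where n: "n \<ge> 1" "(U_F D l i [^]\<^bsub>U\<^esub> n) \<odot>\<^bsub>M\<^esub> m = \<zero>\<^bsub>M\<^esub>"
    unfolding integrable_def by blast
  obtain h \<kappa> where h: "\<kappa> \<noteq> 0" "U_F D l i [^]\<^bsub>U\<^esub> n = cl (Poly_Mapping.single (replicate n (Inr i), h) \<kappa>)"
    using U_F_pow by blast
  obtain s where "Poly_Mapping.single (replicate n (Inr i), 0) 1
        = amult D s (Poly_Mapping.single (replicate n (Inr i), h) \<kappa>)"
    using word_from_F_pow[OF h(1)] by blast
  then have "act (Poly_Mapping.single (replicate n (Inr i), 0) 1) m = \<zero>\<^bsub>M\<^esub>"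
    using n(2) m unfolding h(2) by (simp add: act_mult act_zero_right flip: act_def)
  with n(1) show ?thesis by blast
qed

lemma rep_of_vector:
  assumes m: "m \<in> carrier M"
  obtains P where "left_ideal_rep D l (ann0 m) P"
proof -
  obtain P where P: "Vector_Spaces.linear scl scl P" "\<And>x. P x = 0 \<longleftrightarrow> x \<in> ann0 m" "\<And>x. x - P x \<in> ann0 m"
    using exists_projection[OF ann_left_ideal(2)[OF zero_submodule m]] by blast
  have "left_ideal_rep D l (ann0 m) P"
  proof (rule left_ideal_rep.intro[OF rd lp ann_left_ideal(1)[OF zero_submodule m] _ P])
    show "U_ideal D l \<subseteq> ann0 m" using act_ideal[OF m] by (auto simp: ann_def)
  qed
  with that show ?thesis by blast
qed

text \<open>In the quotient by \<open>ann0 m\<close> the image of 1 is primitive of the same weight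
  as \<open>m\<close>, so the rank one computation applies; genericity identifies its exponent with
  \<open>dom_exp\<close>.\<close>

lemma primitive_dominant:
  assumes gen: "generic D" and int: "integrable D l M" and m: "primitive c m" "m \<noteq> \<zero>\<^bsub>M\<^esub>"
  shows "dominant D c"
    and "act (Poly_Mapping.single (replicate (dom_exp D c i + 1) (Inr i), 0) 1) m = \<zero>\<^bsub>M\<^esub>"
proof -
  have mM: "m \<in> carrier M" using m by (simp add: primitive_def)
  obtain P where "left_ideal_rep D l (ann0 m) P" using rep_of_vector[OF mM] .
  then interpret rep: left_ideal_rep D l "ann0 m" P .
  have P0: "P z = 0 \<longleftrightarrow> act z m = \<zero>\<^bsub>M\<^esub>" for z using rep.P0[of z] by (simp add: ann_def)
  define x where "x = P sone"
  have px: "rep.prim x"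
    using m P0 by (simp add: rep.prim_def x_def rep.eJ_def rep.P_amult_P amult_sone primitive_def)
  have wx: "rep.wt c x" unfolding rep.wt_def
  proof (intro conjI allI)
    show "character c" using m by (simp add: primitive_def)
    fix h
    have "act (grp h - scl (c h) sone) m \<oplus>\<^bsub>M\<^esub> act (scl (c h) sone) m = act (scl (c h) sone) m"
      using m unfolding act_add[OF mM, symmetric] by (simp add: primitive_def)
    then have "act (grp h - scl (c h) sone) m = \<zero>\<^bsub>M\<^esub>" using mM by (metis M.add.l_cancel_one' M.add.r_cancel_one act_closed)
    then have "P (grp h - scl (c h) sone) = 0" by (simp only: P0)
    then show "rep.gJ h x = scl (c h) x"
      by (simp add: x_def rep.gJ_def rep.P_amult_P amult_sone rep.P_diff rep.P_scl del: scl_single)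
  qed
  have x0: "x \<noteq> 0" using m P0 act_one[OF mM] by (simp add: x_def)
  have pow: "(rep.wJ i ^^ n) x = P (Poly_Mapping.single (replicate n (Inr i), 0) 1)" if "n \<ge> 1" for i n
  proof -
    have "(rep.wJ i ^^ n) x = foldr rep.wJ (replicate n i) x" by (induction n) simp_all
    then show ?thesis using that by (subst (asm) rep.foldr_wJ) (auto simp: x_def rep.P_amult_P amult_sone)
  qed
  have "\<exists>n. (rep.wJ i ^^ n) x = 0" for i
    using integrable_words[OF int mM, of i] pow P0 by metis
  then obtain mm where mm: "\<And>i. c (KL D i) = q D i i ^ mm i" "\<And>i. (rep.wJ i ^^ Suc (mm i)) x = 0"
    using rep.dominant_prim[OF gen px wx x0] by blast
  then show "dominant D c" using m by (auto simp: dominant_def primitive_def)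
  have "dom_exp D c i = mm i" for i unfolding dom_exp_def
  proof (rule the_equality)
    show "c (KL D i) = q D i i ^ mm i" by (rule mm)
    fix k assume "c (KL D i) = q D i i ^ k"
    then have eq: "q D i i ^ k = q D i i ^ mm i" by (simp add: mm)
    have "a = b" if "q D i i ^ a = q D i i ^ b" "a \<le> b" for a b
    proof (rule ccontr)
      assume "a \<noteq> b"
      have "q D i i ^ a * q D i i ^ (b - a) = q D i i ^ b" using that(2) by (simp flip: power_add)
      also have "\<dots> = q D i i ^ a * 1" by (simp add: that(1))
      finally have "q D i i ^ a * q D i i ^ (b - a) = q D i i ^ a * 1" .
      then have "q D i i ^ (b - a) = 1" by simp
      moreover have "b - a \<ge> 1" using that(2) \<open>a \<noteq> b\<close> by simp
      ultimately show False using gen unfolding generic_def by blast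
    qed
    then show "k = mm i" using eq by (metis nat_le_linear)
  qed
  then show "act (Poly_Mapping.single (replicate (dom_exp D c i + 1) (Inr i), 0) 1) m = \<zero>\<^bsub>M\<^esub>"
    using mm(2)[of i] pow[of "Suc (mm i)" i] P0 by simp
qed

lemma L_ideal_annihilates:
  assumes m: "primitive c m"
    and F: "\<And>i. act (Poly_Mapping.single (replicate (dom_exp D c i + 1) (Inr i), 0) 1) m = \<zero>\<^bsub>M\<^esub>"
    and a: "a \<in> L_ideal D l c"
  shows "a \<odot>\<^bsub>M\<^esub> m = \<zero>\<^bsub>M\<^esub>"
proof -
  let ?R = "regular_module U" and ?A = "{a \<in> carrier U. a \<odot>\<^bsub>M\<^esub> m = \<zero>\<^bsub>M\<^esub>}"
  have mM: "m \<in> carrier M" using m by (simp add: primitive_def)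
  interpret RM: left_module U ?R by (rule left_module_regular[OF U.ring_axioms])
  have reg: "carrier ?R = carrier U" "add ?R = add U" "\<zero>\<^bsub>?R\<^esub> = \<zero>\<^bsub>U\<^esub>" "module.smult ?R = mult U"
    by (simp_all add: regular_module_def)
  have z: "\<zero>\<^bsub>U\<^esub> \<odot>\<^bsub>M\<^esub> m = \<zero>\<^bsub>M\<^esub>" using act_zero[OF mM] by (simp add: act_def cl_zero)
  have "submodule ?A U ?R"
  proof (intro submodule.intro submodule_axioms.intro)
    have neg: "\<ominus>\<^bsub>?R\<^esub> b \<in> ?A" if b: "b \<in> ?A" for b
    proof -
      have nb: "\<ominus>\<^bsub>?R\<^esub> b \<in> carrier U" using b RM.M.a_inv_closed[of b] by (simp add: reg)
      have bU: "b \<in> carrier U" and bm: "b \<odot>\<^bsub>M\<^esub> m = \<zero>\<^bsub>M\<^esub>" using b by auto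
      have "\<ominus>\<^bsub>?R\<^esub> b \<oplus>\<^bsub>?R\<^esub> b = \<zero>\<^bsub>?R\<^esub>" using bU by (intro RM.M.l_neg) (simp only: reg)
      then have inv: "\<ominus>\<^bsub>?R\<^esub> b \<oplus>\<^bsub>U\<^esub> b = \<zero>\<^bsub>U\<^esub>" by (simp only: reg)
      have "(\<ominus>\<^bsub>?R\<^esub> b) \<odot>\<^bsub>M\<^esub> m = (\<ominus>\<^bsub>?R\<^esub> b) \<odot>\<^bsub>M\<^esub> m \<oplus>\<^bsub>M\<^esub> b \<odot>\<^bsub>M\<^esub> m"
        unfolding bm by (rule M.r_zero[symmetric, OF smult_closed[OF nb mM]])
      also have "\<dots> = (\<ominus>\<^bsub>?R\<^esub> b \<oplus>\<^bsub>U\<^esub> b) \<odot>\<^bsub>M\<^esub> m" by (rule smult_l_distr[symmetric, OF nb bU mM])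
      also have "\<dots> = \<zero>\<^bsub>M\<^esub>" unfolding inv by (rule z)
      finally show ?thesis using nb by blast
    qed
    have add: "a \<oplus>\<^bsub>U\<^esub> b \<in> ?A" if "a \<in> ?A" "b \<in> ?A" for a b
      using that by (simp add: smult_l_distr mM)
    have ne: "?A \<noteq> {}" using z by blast
    show "subgroup ?A (add_monoid ?R)"
      by (rule RM.M.add.subgroupI)
        (use neg add ne in \<open>simp_all only: reg a_inv_def monoid.simps partial_object.simps\<close>, blast+)
    show "b \<odot>\<^bsub>?R\<^esub> x \<in> ?A" if "b \<in> carrier U" "x \<in> ?A" for b x
      using that by (simp add: reg smult_assoc mM smult_zero)
  qed
  moreover have "range (U_E D l) \<subseteq> ?A"
    using m by (auto simp: U_E_def primitive_def act_def)
  moreover have "U_F D l i [^]\<^bsub>U\<^esub> (dom_exp D c i + 1) \<in> ?A" for i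
  proof -
    let ?w = "Poly_Mapping.single (replicate (dom_exp D c i + 1) (Inr i), 0 :: 'g) (1 :: 'k)"
    obtain h \<kappa> where h: "U_F D l i [^]\<^bsub>U\<^esub> (dom_exp D c i + 1)
        = cl (Poly_Mapping.single (replicate (dom_exp D c i + 1) (Inr i), h) \<kappa>)"
      using U_F_pow by blast
    \<comment> \<open>The group element is split off to the right, where it acts on \<open>m\<close>
      first and only by a scalar.\<close>
    have "Poly_Mapping.single (replicate (dom_exp D c i + 1) (Inr i), h) \<kappa>
        = amult D ?w (amult D (scl \<kappa> sone) (grp h))"
      by (simp add: amult_scl amult_sone grp_def amult_single wchar_def del: scl_single) (simp add: scl_single)
    then have "act (Poly_Mapping.single (replicate (dom_exp D c i + 1) (Inr i), h) \<kappa>) m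
        = act ?w (act (scl \<kappa> sone) (act (scl (c h) sone) m))"
      using m mM by (simp add: act_mult primitive_def del: scl_single)
    also have "\<dots> = act (amult D ?w (amult D (scl \<kappa> sone) (scl (c h) sone))) m"
      by (simp add: act_mult mM)
    also have "amult D ?w (amult D (scl \<kappa> sone) (scl (c h) sone)) = amult D (amult D (scl \<kappa> sone) (scl (c h) sone)) ?w"
      by (simp only: amult_scl amult_sone)
    also have "act \<dots> m = \<zero>\<^bsub>M\<^esub>" using F[of i] by (simp add: act_mult mM act_zero_right del: replicate_Suc)
    finally show ?thesis unfolding h by (simp add: act_def)
  qed
  moreover have "U_grp D l h \<ominus>\<^bsub>U\<^esub> U_scalar D l (c h) \<in> ?A" for h
  proof -
    have "act (grp h - scl (c h) sone) m \<oplus>\<^bsub>M\<^esub> act (scl (c h) sone) m = act (scl (c h) sone) m"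
      using m unfolding act_add[OF mM, symmetric] by (simp add: primitive_def)
    then have "act (grp h - scl (c h) sone) m = \<zero>\<^bsub>M\<^esub>" using mM by (metis M.add.l_cancel_one' M.add.r_cancel_one act_closed)
    then show ?thesis unfolding U_grp_def U_scalar_def grp_0 cl_minus[symmetric] by (simp add: act_def)
  qed
  ultimately have "L_ideal D l c \<subseteq> ?A" unfolding L_ideal_def gen_submodule_def by (intro Inter_lower) blast
  then show ?thesis using a by blast
qed

text \<open>The left ideal of \<open>L(\<chi>)\<close> kills \<open>m\<close> and is maximal by
  \<open>L_simple\<close>, while 1 does not kill \<open>m\<close>; hence it is the full
  annihilator.\<close>

lemma annihilator_primitive:
  assumes gen: "generic D" and reg: "regular D" and ct: "cartan_type D" and int: "integrable D l M"
    and m: "primitive c m" "m \<noteq> \<zero>\<^bsub>M\<^esub>"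
  shows "cl x \<in> L_ideal D l c \<longleftrightarrow> act x m = \<zero>\<^bsub>M\<^esub>"
proof
  note dom = primitive_dominant[OF gen int m]
  have mM: "m \<in> carrier M" using m by (simp add: primitive_def)
  show L: "act x m = \<zero>\<^bsub>M\<^esub>" if "cl x \<in> L_ideal D l c" for x
    using L_ideal_annihilates[OF m(1) dom(2) that] by (simp add: act_def)
  assume x: "act x m = \<zero>\<^bsub>M\<^esub>"
  show "cl x \<in> L_ideal D l c"
  proof (rule ccontr)
    assume "cl x \<notin> L_ideal D l c"
    then have "sone \<in> ann0 m"
      using L_simple[OF gen reg ct dom(1) ann_left_ideal(2,1)[OF zero_submodule mM], of x] L x
      by (auto simp: ann_def)
    then show False using m act_one[OF mM] by (simp add: ann_def)
  qed
qed

lemma orbit_self: "m \<in> carrier M \<Longrightarrow> m \<in> orbit m"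
  using act_one[of m] unfolding orbit_eq by (metis rangeI)

lemma simple_orbit:
  assumes gen: "generic D" and reg: "regular D" and ct: "cartan_type D" and int: "integrable D l M"
    and m: "primitive c m" "m \<noteq> \<zero>\<^bsub>M\<^esub>"
  shows "simple_submodule (orbit m) U M"
  unfolding simple_submodule_def
proof (intro conjI allI impI)
  have mM: "m \<in> carrier M" using m by (simp add: primitive_def)
  show "submodule (orbit m) U M" by (rule submodule_orbit[OF mM])
  show "orbit m \<noteq> {\<zero>\<^bsub>M\<^esub>}" using orbit_self[OF mM] m by auto
  fix N assume N: "submodule N U M \<and> N \<subseteq> orbit m"
  then have sN: "submodule N U M" by blast
  have zN: "\<zero>\<^bsub>M\<^esub> \<in> N" using subgroup.one_closed[OF submodule.axioms(1)[OF sN]] by simp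
  show "N = {\<zero>\<^bsub>M\<^esub>} \<or> N = orbit m"
  proof (cases "N = {\<zero>\<^bsub>M\<^esub>}")
    case False
    then obtain n where n: "n \<in> N" "n \<noteq> \<zero>\<^bsub>M\<^esub>" using zN by blast
    then obtain y where y: "n = act y m" using N unfolding orbit_eq by blast
    note ann = annihilator_primitive[OF gen reg ct int m]
    have "sone \<in> ann N m"
      using L_simple[OF gen reg ct primitive_dominant(1)[OF gen int m] ann_left_ideal(2,1)[OF sN mM], of y]
        ann n y zN by (auto simp: ann_def)
    then have "m \<in> N" using act_one[OF mM] by (simp add: ann_def)
    then have "orbit m \<subseteq> N" unfolding orbit_def using submodule.smult_closed[OF sN] by blast
    then show ?thesis using N by blast
  qed blast
qed

lemma orbit_isomorphic:
  assumes gen: "generic D" and reg: "regular D" and ct: "cartan_type D" and int: "integrable D l M"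
    and m: "primitive c m" "m \<noteq> \<zero>\<^bsub>M\<^esub>"
  shows "isomorphic_modules U (M\<lparr>carrier := orbit m\<rparr>) (L_mod D l c)"
proof -
  let ?R = "regular_module U"
  let ?L = "L_ideal D l c"
  have mM: "m \<in> carrier M" using m by (simp add: primitive_def)
  interpret RM: left_module U ?R by (rule left_module_regular[OF U.ring_axioms])
  have rg: "carrier ?R = carrier U" "add ?R = add U" "\<zero>\<^bsub>?R\<^esub> = \<zero>\<^bsub>U\<^esub>" "module.smult ?R = mult U"
    by (simp_all add: regular_module_def)
  have gens: "range (U_E D l) \<union> range (\<lambda>i. U_F D l i [^]\<^bsub>U\<^esub> (dom_exp D c i + 1))
      \<union> range (\<lambda>g. U_grp D l g \<ominus>\<^bsub>U\<^esub> U_scalar D l (c g)) \<subseteq> carrier ?R"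
    by (auto simp: regular_module_def U_E_def U_F_def U_grp_def U_scalar_def U.minus_closed)
  have subL: "submodule ?L U ?R"
    unfolding L_ideal_def by (rule submodule_gen_submodule(1)[OF RM.left_module_axioms gens])
  interpret L: submodule ?L U ?R by (rule subL)
  have "abelian_subgroup ?L ?R"
    by (rule abelian_subgroupI3)
       (simp_all add: additive_subgroup_def L.subgroup_axioms RM.M.abelian_group_axioms)
  then interpret L: abelian_subgroup ?L ?R .
  have Lc: "a \<in> carrier U" if "a \<in> ?L" for a using L.a_subset that by (auto simp: rg)
  have Liff: "a \<in> ?L \<longleftrightarrow> a \<odot>\<^bsub>M\<^esub> m = \<zero>\<^bsub>M\<^esub>" if "a \<in> carrier U" for a
    using carrier_U[OF that] annihilator_primitive[OF gen reg ct int m] by (auto simp: act_def)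
  \<comment> \<open>The inverse of the map induced by acting on \<open>m\<close>: the fibre over
    \<open>n\<close> is a coset of the annihilator, so no representative has to be chosen.\<close>
  define f where "f = (\<lambda>n. {a \<in> carrier U. a \<odot>\<^bsub>M\<^esub> m = n})"
  have coset: "?L +>\<^bsub>?R\<^esub> a = f (a \<odot>\<^bsub>M\<^esub> m)" if a: "a \<in> carrier U" for a
  proof (intro equalityI subsetI)
    fix b assume "b \<in> ?L +>\<^bsub>?R\<^esub> a"
    then obtain k where k: "k \<in> ?L" "b = k \<oplus>\<^bsub>U\<^esub> a" by (auto simp: a_r_coset_def' rg)
    then show "b \<in> f (a \<odot>\<^bsub>M\<^esub> m)"
      using Lc[OF k(1)] Liff[of k] a mM by (simp add: f_def smult_l_distr smult_closed)
  next
    fix b assume "b \<in> f (a \<odot>\<^bsub>M\<^esub> m)"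
    then have b: "b \<in> carrier U" "b \<odot>\<^bsub>M\<^esub> m = a \<odot>\<^bsub>M\<^esub> m" by (simp_all add: f_def)
    let ?k = "b \<ominus>\<^bsub>U\<^esub> a"
    have k: "?k \<in> carrier U" "b = ?k \<oplus>\<^bsub>U\<^esub> a"
      using a b by (simp_all add: U.minus_eq U.add.m_assoc U.l_neg)
    have "?k \<odot>\<^bsub>M\<^esub> m \<oplus>\<^bsub>M\<^esub> a \<odot>\<^bsub>M\<^esub> m = a \<odot>\<^bsub>M\<^esub> m"
      using smult_l_distr[OF k(1) a mM] k(2) b(2) by simp
    then have "?k \<odot>\<^bsub>M\<^esub> m = \<zero>\<^bsub>M\<^esub>"
      using smult_closed[OF k(1) mM] smult_closed[OF a mM] by (metis M.add.l_cancel_one' M.add.r_cancel_one)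
    then have "?k \<in> ?L" using Liff k by blast
    then show "b \<in> ?L +>\<^bsub>?R\<^esub> a" using k(2) by (auto simp: a_r_coset_def' rg)
  qed
  have car: "carrier (L_mod D l c) = {?L +>\<^bsub>?R\<^esub> a | a. a \<in> carrier U}"
    by (auto simp: L_mod_def quot_module_def A_RCOSETS_def' rg)
  have addL: "X \<oplus>\<^bsub>L_mod D l c\<^esub> Y = X <+>\<^bsub>?R\<^esub> Y" for X Y by (simp add: L_mod_def quot_module_def)
  have "f \<in> iso (add_monoid (M\<lparr>carrier := orbit m\<rparr>)) (add_monoid (L_mod D l c))"
  proof (rule isoI)
    show "f \<in> hom (add_monoid (M\<lparr>carrier := orbit m\<rparr>)) (add_monoid (L_mod D l c))"
    proof (rule homI)
      fix x assume "x \<in> carrier (add_monoid (M\<lparr>carrier := orbit m\<rparr>))"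
      then obtain a where a: "a \<in> carrier U" "x = a \<odot>\<^bsub>M\<^esub> m" by (auto simp: orbit_def)
      then show "f x \<in> carrier (add_monoid (L_mod D l c))" using coset[OF a(1)] by (auto simp: car)
      fix y assume "y \<in> carrier (add_monoid (M\<lparr>carrier := orbit m\<rparr>))"
      then obtain b where b: "b \<in> carrier U" "y = b \<odot>\<^bsub>M\<^esub> m" by (auto simp: orbit_def)
      have "f (x \<oplus>\<^bsub>M\<^esub> y) = ?L +>\<^bsub>?R\<^esub> (a \<oplus>\<^bsub>U\<^esub> b)"
        using a b mM by (simp add: coset smult_l_distr)
      also have "\<dots> = (?L +>\<^bsub>?R\<^esub> a) <+>\<^bsub>?R\<^esub> (?L +>\<^bsub>?R\<^esub> b)"
        using L.a_rcos_sum[of a b] a b by (simp add: rg)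
      finally show "f (x \<otimes>\<^bsub>add_monoid (M\<lparr>carrier := orbit m\<rparr>)\<^esub> y) = f x \<otimes>\<^bsub>add_monoid (L_mod D l c)\<^esub> f y"
        using a b by (simp add: coset addL)
    qed
    show "bij_betw f (carrier (add_monoid (M\<lparr>carrier := orbit m\<rparr>))) (carrier (add_monoid (L_mod D l c)))"
      unfolding bij_betw_def
    proof
      show "inj_on f (carrier (add_monoid (M\<lparr>carrier := orbit m\<rparr>)))"
      proof (rule inj_onI)
        fix x y assume x: "x \<in> carrier (add_monoid (M\<lparr>carrier := orbit m\<rparr>))" and eq: "f x = f y"
        then obtain a where a: "a \<in> carrier U" "x = a \<odot>\<^bsub>M\<^esub> m" by (auto simp: orbit_def)
        then have "a \<in> f x" by (simp add: f_def)
        then have "a \<in> f y" unfolding eq .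
        then show "x = y" using a by (simp add: f_def)
      qed
      have "f ` orbit m = {?L +>\<^bsub>?R\<^esub> a | a. a \<in> carrier U}"
        using coset unfolding orbit_def by (auto simp: image_iff)
      then show "f ` carrier (add_monoid (M\<lparr>carrier := orbit m\<rparr>)) = carrier (add_monoid (L_mod D l c))"
        by (simp add: car)
    qed
  qed
  moreover have "f (b \<odot>\<^bsub>M\<^esub> x) = b \<odot>\<^bsub>L_mod D l c\<^esub> f x" if b: "b \<in> carrier U" and x: "x \<in> orbit m" for b x
  proof -
    obtain a where a: "a \<in> carrier U" "x = a \<odot>\<^bsub>M\<^esub> m" using x by (auto simp: orbit_def)
    have "?L +>\<^bsub>?R\<^esub> (b \<otimes>\<^bsub>U\<^esub> y) = f (b \<odot>\<^bsub>M\<^esub> x)" if "y \<in> f x" for y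
      using that b mM by (simp add: f_def[unfolded fun_eq_iff] coset smult_assoc)
    moreover have "f x \<noteq> {}" using a by (auto simp: f_def)
    ultimately have "(\<Union>y\<in>f x. ?L +>\<^bsub>?R\<^esub> (b \<otimes>\<^bsub>U\<^esub> y)) = f (b \<odot>\<^bsub>M\<^esub> x)" by (intro SUP_eq_const)
    then show ?thesis by (simp add: L_mod_def quot_module_def rg)
  qed
  ultimately show ?thesis unfolding isomorphic_modules_def by (intro bexI[of _ f]) auto
qed

text \<open>In the quotient by \<open>ann0 v\<close> the image of 1 has weight \<open>c\<close>, and
  local nilpotency is inherited from the vectors \<open>act y v\<close>. Primitive weight vectors
  there act on \<open>v\<close> to give primitive vectors of \<open>M\<close>, so \<open>PV\<close>
  lies in \<open>ann Q v\<close>.\<close>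

lemma weight_vectors_generate:
  assumes gen: "generic D" and ct: "cartan_type D" and int: "integrable D l M" and hi: "in_C_hi D l M"
    and Q: "submodule Q U M" "\<And>c m. primitive c m \<Longrightarrow> m \<in> Q"
    and v: "v \<in> weight_space D l M c" "character c"
  shows "v \<in> Q"
proof -
  have vM: "v \<in> carrier M" using v by (simp add: weight_space_def)
  obtain P where "left_ideal_rep D l (ann0 v) P" using rep_of_vector[OF vM] .
  then interpret rep: left_ideal_rep D l "ann0 v" P .
  have P0: "P z = 0 \<longleftrightarrow> act z v = \<zero>\<^bsub>M\<^esub>" for z using rep.P0[of z] by (simp add: ann_def)
  have sub: "act (x - y) v = \<zero>\<^bsub>M\<^esub> \<longleftrightarrow> act x v = act y v" for x y
  proof -
    have "act (x - y) v \<oplus>\<^bsub>M\<^esub> act y v = act x v" unfolding act_add[OF vM, symmetric] by simp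
    then show ?thesis using vM by (metis M.add.l_cancel_one' M.add.r_cancel_one act_closed M.l_zero)
  qed
  have Peq: "P x = P y \<longleftrightarrow> act x v = act y v" for x y
    using P0[of "x - y"] sub[of x y] by (simp add: rep.P_diff)
  have PP: "act (P x) v = act x v" for x using Peq[of "P x" x] rep.P_idem by simp
  have "rep.wt c (P sone)" unfolding rep.wt_def
  proof (intro conjI allI v(2))
    fix h
    have "act (grp h) v = act (scl (c h) sone) v"
      using v(1) by (simp add: weight_space_def act_def U_grp_def U_scalar_def grp_0 del: scl_single)
    then have "P (grp h) = P (scl (c h) sone)" by (simp only: Peq)
    then show "rep.gJ h (P sone) = scl (c h) (P sone)"
      by (simp add: rep.gJ_def rep.P_amult_P amult_sone rep.P_scl del: scl_single)
  qed
  moreover have "\<exists>n. (rep.wJ i ^^ n) y = 0" for i y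
  proof -
    obtain n where n: "n \<ge> 1" "act (Poly_Mapping.single (replicate n (Inr i), 0) 1) (act y v) = \<zero>\<^bsub>M\<^esub>"
      using integrable_words[OF int act_closed[OF vM]] by blast
    have "(rep.wJ i ^^ n) y = foldr rep.wJ (replicate n i) y" for n by (induction n) simp_all
    also have "foldr rep.wJ (replicate n i) y = 0"
      using n by (subst rep.foldr_wJ) (auto simp: P0 act_mult vM)
    finally show ?thesis by blast
  qed
  moreover have "\<exists>N. \<forall>b. length b \<ge> N \<longrightarrow> foldr rep.eJ b y = 0" for y
  proof -
    obtain N where N: "\<And>\<alpha> :: 'i \<Rightarrow> nat. (\<Sum>i\<in>UNIV. \<alpha> i) \<ge> N \<Longrightarrow>
        (\<forall>x\<in>U_plus_comp D l \<alpha>. x \<odot>\<^bsub>M\<^esub> act y v = \<zero>\<^bsub>M\<^esub>)"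
      using hi act_closed[OF vM, of y] unfolding in_C_hi_def by blast
    \<comment> \<open>\<open>Suc N\<close> makes \<open>b\<close> nonempty, as
      \<open>foldr_eJ\<close> requires.\<close>
    have "foldr rep.eJ b y = 0" if b: "length b \<ge> Suc N" for b
    proof -
      have "(\<Sum>i\<in>UNIV. count_list b i) = length b"
        using sum_count_set[of b UNIV] by simp
      then have "N \<le> (\<Sum>i\<in>UNIV. count_list b i)" using b by simp
      moreover have "cl (incl_V (word b)) \<in> U_plus_comp D l (count_list b)"
        unfolding U_plus_comp_def by (rule CollectI, intro exI[of _ "word b"]) simp
      ultimately have "act (incl_V (word b)) (act y v) = \<zero>\<^bsub>M\<^esub>" using N unfolding act_def by blast
      moreover have "incl_V (word b) = (Poly_Mapping.single (map Inl b, 0) 1 :: ('g, 'i, 'k) smash)"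
        by (simp add: incl_V_def push_def)
      ultimately show ?thesis using b by (subst rep.foldr_eJ) (auto simp: P0 act_mult vM)
    qed
    then show ?thesis by blast
  qed
  ultimately have "P sone \<in> rep.PV" by (intro rep.integrable_generated_by_primitive[OF gen ct])
  moreover have "rep.PV \<subseteq> ann Q v" unfolding rep.PV_def
  proof (rule pm.span_minimal)
    show "pm.subspace (ann Q v)" by (rule ann_left_ideal(2)[OF Q(1) vM])
    show "{foldr rep.wJ u x | u x \<mu>. rep.prim x \<and> rep.wt \<mu> x} \<subseteq> ann Q v"
    proof clarify
      fix u x \<mu> assume x: "rep.prim x" "rep.wt \<mu> x"
      \<comment> \<open>The neutral group element acts as \<open>P\<close>, so a weight vector is
        its own representative.\<close>
      have Px: "P x = x"
        using rep.wt_g0[OF x(2)] by (simp add: rep.gJ_def grp_0 amult_sone)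
      have "primitive \<mu> (act x v)" unfolding primitive_def
      proof (intro conjI allI)
        show "character \<mu>" using x by (rule_tac rep.wt_character)
        show "act x v \<in> carrier M" using vM by simp
        show "act (vgen i) (act x v) = \<zero>\<^bsub>M\<^esub>" for i
          using x(1) by (simp add: rep.prim_def rep.eJ_def P0 act_mult vM)
        fix h
        have "P (amult D (grp h) x) = P (amult D (scl (\<mu> h) sone) x)"
          using x(2) by (simp add: rep.wt_def rep.gJ_def amult_scl amult_sone rep.P_scl Px del: scl_single)
        then show "act (grp h) (act x v) = act (scl (\<mu> h) sone) (act x v)"
          by (simp only: Peq act_mult[OF vM])
      qed
      then have xQ: "x \<in> ann Q v" using Q(2) by (simp add: ann_def)
      show "foldr rep.wJ u x \<in> ann Q v"
      proof (cases "u = []")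
        case False
        have "amult D (Poly_Mapping.single (map Inr u, 0) 1) x \<in> ann Q v"
          by (rule ann_left_ideal(1)[OF Q(1) vM xQ])
        then show ?thesis unfolding rep.foldr_wJ[OF False] by (simp add: ann_def PP)
      qed (simp add: xQ)
    qed
  qed
  ultimately have "act (P sone) v \<in> Q" by (auto simp: ann_def)
  then show ?thesis by (simp add: PP act_one[OF vM])
qed

text \<open>A submodule containing all primitive vectors contains every weight vector, and
  \<open>M\<close> is the sum of its weight spaces; so the simple orbits generate
  \<open>M\<close>.\<close>

theorem complete_reducibility:
  assumes gen: "generic D" and reg: "regular D" and ct: "cartan_type D"
    and int: "integrable D l M" and hi: "in_C_hi D l M"
  shows "\<exists>\<N>. (\<forall>N\<in>\<N>. \<exists>c m. primitive c m \<and> m \<noteq> \<zero>\<^bsub>M\<^esub> \<and> N = orbit m) \<and> internal_direct_sum M \<N> (\<lambda>N. N)"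
proof -
  define \<S> where "\<S> = {orbit m | c m. primitive c m \<and> m \<noteq> \<zero>\<^bsub>M\<^esub>}"
  have "\<exists>\<N>\<subseteq>\<S>. internal_direct_sum M \<N> (\<lambda>N. N)"
  proof (rule sum_of_simples)
    show "simple_submodule N U M" if "N \<in> \<S>" for N
      using that simple_orbit[OF gen reg ct int] unfolding \<S>_def by blast
    fix Q assume Q: "submodule Q U M" "\<Union>\<S> \<subseteq> Q"
    note sQ = submodule.axioms(1)[OF Q(1)]
    have prim: "m \<in> Q" if "primitive c m" for c m
    proof (cases "m = \<zero>\<^bsub>M\<^esub>")
      case True
      then show ?thesis using subgroup.one_closed[OF sQ] by simp
    next
      case False
      then have "orbit m \<in> \<S>" unfolding \<S>_def using that by blast
      moreover have "m \<in> orbit m" using that by (intro orbit_self) (simp add: primitive_def)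
      ultimately show ?thesis using Q(2) by blast
    qed
    let ?I = "{c. character c}" and ?W = "weight_space D l M" and ?G = "add_monoid M"
    have W: "v \<in> Q" if "c \<in> ?I" "v \<in> ?W c" for c v
      by (rule weight_vectors_generate[OF gen ct int hi Q(1) _ that(2)]) (use prim that(1) in auto)
    have ds: "internal_direct_sum M ?I ?W" using hi by (simp add: in_C_hi_def in_C_def)
    then have sW: "\<And>c. c \<in> ?I \<Longrightarrow> subgroup (?W c) ?G" by (simp add: internal_direct_sum_def)
    have grp: "group (add_monoid (M\<lparr>carrier := ?W c\<rparr>))" if "c \<in> ?I" for c
      using subgroup.subgroup_is_group[OF sW[OF that] M.add.is_group] by simp
    have "carrier M \<subseteq> Q"
    proof
      fix x assume "x \<in> carrier M"
      then have "x \<in> (\<lambda>f. gfinprod ?G f ?I) ` carrier (sum_group ?I (\<lambda>c. add_monoid (M\<lparr>carrier := ?W c\<rparr>)))"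
        using ds unfolding internal_direct_sum_def iso_def bij_betw_def by auto
      then obtain f where f: "x = gfinprod ?G f ?I"
        "f \<in> carrier (sum_group ?I (\<lambda>c. add_monoid (M\<lparr>carrier := ?W c\<rparr>)))" by blast
      have "carrier (sum_group ?I (\<lambda>c. add_monoid (M\<lparr>carrier := ?W c\<rparr>)))
        \<subseteq> (\<Pi>\<^sub>E c\<in>?I. carrier (add_monoid (M\<lparr>carrier := ?W c\<rparr>)))"
        by (subst carrier_sum_group) (erule grp, blast)
      with f(2) have "f \<in> (\<Pi>\<^sub>E c\<in>?I. carrier (add_monoid (M\<lparr>carrier := ?W c\<rparr>)))" by blast
      then have "f c \<in> ?W c" if "c \<in> ?I" for c using that by auto
      then show "x \<in> Q" unfolding f(1) using W
        by (intro comm_group.subgroup_gfinprod_closed[OF M.a_comm_group sQ]) blast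
    qed
    then show "Q = carrier M" using subgroup.subset[OF sQ] by auto
  qed
  then obtain \<N> where \<N>: "\<N> \<subseteq> \<S>" "internal_direct_sum M \<N> (\<lambda>N. N)" by (elim exE conjE)
  have "\<exists>c m. primitive c m \<and> m \<noteq> \<zero>\<^bsub>M\<^esub> \<and> N = orbit m" if "N \<in> \<N>" for N
  proof -
    have "N \<in> \<S>" using \<N>(1) that by (rule subsetD)
    then show ?thesis unfolding \<S>_def by (simp only: mem_Collect_eq) metis
  qed
  with \<N>(2) show ?thesis by (intro exI[of _ \<N>] conjI ballI)
qed

end

theorem theorem4p17:
  fixes D :: "('g::ab_group_add, 'i::finite, 'k::{alg_closed_field, field_char_0}) yd_datum"
    and l :: "'i \<Rightarrow> 'k"
    and M :: "('g, 'i, 'k, 'm) U_module"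
  assumes "reduced_datum D" and "generic D" and "regular D" and "cartan_type D"
    and "linking_parameter l"
    and "integrable D l M" and "in_C_hi D l M"
  shows "completely_reducible (U_alg D l) M
    \<and> (\<exists>\<N>. (\<forall>N\<in>\<N>. submodule N (U_alg D l) M
             \<and> (\<exists>c. dominant D c
                  \<and> isomorphic_modules (U_alg D l) (M\<lparr>carrier := N\<rparr>) (L_mod D l c)))
           \<and> internal_direct_sum M \<N> (\<lambda>N. N))"
proof -
  have "left_module (U_alg D l) M" using assms(7) by (simp add: in_C_hi_def in_C_def)
  then interpret U_module D l M
    by (intro U_module.intro U_data.intro plain_left_module.intro assms)
  from complete_reducibility[OF assms(2-4,6,7)] obtain \<N> where \<N>: "internal_direct_sum M \<N> (\<lambda>N. N)"
    "\<forall>N\<in>\<N>. \<exists>c m. primitive c m \<and> m \<noteq> \<zero>\<^bsub>M\<^esub> \<and> N = orbit m" by (elim exE conjE)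
  have "simple_submodule N (U_alg D l) M \<and> (\<exists>c. dominant D c
      \<and> isomorphic_modules (U_alg D l) (M\<lparr>carrier := N\<rparr>) (L_mod D l c))" if N: "N \<in> \<N>" for N
  proof -
    obtain c m where "primitive c m" "m \<noteq> \<zero>\<^bsub>M\<^esub>" "N = orbit m" using bspec[OF \<N>(2) N] by (elim exE conjE)
    then show ?thesis
      using simple_orbit[OF assms(2-4,6)] orbit_isomorphic[OF assms(2-4,6)]
        primitive_dominant(1)[OF assms(2,6)] by blast
  qed
  then have 1: "\<And>N. N \<in> \<N> \<Longrightarrow> simple_submodule N (U_alg D l) M"
    and 2: "\<And>N. N \<in> \<N> \<Longrightarrow> \<exists>c. dominant D c \<and> isomorphic_modules (U_alg D l) (M\<lparr>carrier := N\<rparr>) (L_mod D l c)"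
    by simp_all
  have 3: "\<And>N. N \<in> \<N> \<Longrightarrow> submodule N (U_alg D l) M" using 1 by (simp add: simple_submodule_def)
  \<comment> \<open>One family of orbits witnesses both claims.\<close>
  show ?thesis unfolding completely_reducible_def
    by (intro conjI exI[of _ \<N>] ballI) (rule 1 2 3 \<N>(1), assumption?)+
qed

end
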